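(* Let $C_E$ be the edit cost function with vertex insertion cost $0$, vertex deletion cost $0$, vertex relabeling cost $\infty$, edge insertion cost $1$, edge deletion cost $1$, and edge relabeling cost $2$. Computing the graph edit distance $\mathrm{GED}(G_1,G_2;C_E)$ is $\mathsf{NP}$-hard even when both input graphs $G_1$ and $G_2$ are trees, both in the setting of labeled graphs and in the setting of unlabeled graphs.
   Context: Graphs are finite, simple and undirected; trees are unrooted and unordered. A labeled graph is a graph $G=(V,E)$ with a labeling function $\ell\colon V\cup E\to\Sigma$, where $\Sigma$ is a finite alphabet; unlabeled graphs are graphs without labels (equivalently, all vertices carry one common label and all edges carry one common label, so no relabeling ever occurs). Isomorphisms preserve adjacency, non-adjacency, and all labels. Graph edit distance. An edit operation is an insertion, deletion, or relabeling of a vertex or an edge, with a non-negative cost given by a cost function $C$; the relabeling cost is charged when the labels do not match (leaving a label unchanged costs $0$). An edit path $\gamma=(o_1,\dots,o_k)$ from $G_1$ to $G_2$ is a sequence of edit operations transforming $G_1$ into a graph isomorphic to $G_2$ (intermediate graphs may be arbitrary graphs), with cost $C(\gamma)=\sum_i C(o_i)$. A restricted edit path is an edit path in which a vertex can only be deleted after its incident edges have been deleted, an edge can only be inserted if its endpoints exist, each vertex and each edge is edited at most once, and deleting and reinserting an edge between relabeled (i.e. substituted) vertices is forbidden. Then $\mathrm{GED}(G_1,G_2;C)=\min_{\gamma} C(\gamma)$ over all restricted edit paths $\gamma$ from $G_1$ to $G_2$. It is a known fact that this is equivalent to the node map formulation: the minimum, over all bijections $\phi$ from a subset $U_1\subseteq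 V_1$ to a subset $U_2\subseteq V_2$, of the total induced cost, where vertices in $U_1$ are mapped (relabeled if the labels differ), vertices of $V_1\setminus U_1$ are deleted, vertices of $V_2\setminus U_2$ are inserted, an edge $(u,v)\in E_1$ with $u,v\in U_1$ and $(\phi(u),\phi(v))\in E_2$ is kept (relabeled if the labels differ), all other edges of $E_1$ are deleted, and all other edges of $E_2$ are inserted. $\mathsf{NP}$-hardness refers to the associated decision problem: given $G_1,G_2$ and a number $k$, decide whether $\mathrm{GED}(G_1,G_2;C_E)\le k$. *)

theory Defs
  imports
    "HOL-Library.Extended_Nonnegative_Real"
    "HOL-Computational_Algebra.Polynomial"
begin

section \<open>Labeled graphs and trees\<close>

text \<open>
  Only the labels of vertices in \<open>verts\<close> and edges in \<open>edges\<close> are meaningful. Unlabeled graphs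
  are the instance with label type \<^typ>\<open>unit\<close>. Vertices are natural numbers, so that there is
  always an unused name for a vertex to be inserted.
\<close>

record 'l lgraph =
  verts :: "nat set"
  edges :: "nat set set"
  vlab :: "nat \<Rightarrow> 'l"
  elab :: "nat set \<Rightarrow> 'l"

definition simple_graph :: "'l lgraph \<Rightarrow> bool" where
  "simple_graph G \<longleftrightarrow> finite (verts G) \<and> (\<forall>e\<in>edges G. e \<subseteq> verts G \<and> card e = 2)"

definition labeled_over :: "'l set \<Rightarrow> 'l lgraph \<Rightarrow> bool" where
  "labeled_over \<Sigma> G \<longleftrightarrow> vlab G ` verts G \<subseteq> \<Sigma> \<and> elab G ` edges G \<subseteq> \<Sigma>"

definition isomorphic :: "'l lgraph \<Rightarrow> 'l lgraph \<Rightarrow> bool" where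
  "isomorphic G H \<longleftrightarrow> (\<exists>f. bij_betw f (verts G) (verts H) \<and>
     (\<forall>u\<in>verts G. \<forall>v\<in>verts G. {u, v} \<in> edges G \<longleftrightarrow> {f u, f v} \<in> edges H) \<and>
     (\<forall>v\<in>verts G. vlab H (f v) = vlab G v) \<and>
     (\<forall>e\<in>edges G. elab H (f ` e) = elab G e))"

definition connected_graph :: "'l lgraph \<Rightarrow> bool" where
  "connected_graph G \<longleftrightarrow> verts G \<noteq> {} \<and>
     (\<forall>u\<in>verts G. \<forall>v\<in>verts G. (u, v) \<in> {(a, b). {a, b} \<in> edges G}\<^sup>*)"

definition is_cycle :: "'l lgraph \<Rightarrow> nat list \<Rightarrow> bool" where
  "is_cycle G c \<longleftrightarrow> length c \<ge> 3 \<and> distinct c \<and>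
     (\<forall>i. Suc i < length c \<longrightarrow> {c ! i, c ! Suc i} \<in> edges G) \<and> {last c, hd c} \<in> edges G"

definition is_tree :: "'l lgraph \<Rightarrow> bool" where
  "is_tree G \<longleftrightarrow> simple_graph G \<and> connected_graph G \<and> (\<nexists>c. is_cycle G c)"

section \<open>Graph edit distance\<close>

datatype 'l edit_op =
    InsV nat 'l | DelV nat | RelV nat 'l
  | InsE "nat set" 'l | DelE "nat set" | RelE "nat set" 'l

text \<open>
  Applicability already contains two of the conditions on restricted edit paths: a vertex is
  deleted only when it has no incident edges left, and an edge is inserted only between existing
  vertices.
\<close>

fun applicable :: "'l lgraph \<Rightarrow> 'l edit_op \<Rightarrow> bool" where
  "applicable G (InsV v a) \<longleftrightarrow> v \<notin> verts G"
| "applicable G (DelV v) \<longleftrightarrow> v \<in> verts G \<and> (\<forall>e\<in>edges G. v \<notin> e)"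
| "applicable G (RelV v a) \<longleftrightarrow> v \<in> verts G"
| "applicable G (InsE e a) \<longleftrightarrow> e \<subseteq> verts G \<and> card e = 2 \<and> e \<notin> edges G"
| "applicable G (DelE e) \<longleftrightarrow> e \<in> edges G"
| "applicable G (RelE e a) \<longleftrightarrow> e \<in> edges G"

fun apply_op :: "'l edit_op \<Rightarrow> 'l lgraph \<Rightarrow> 'l lgraph" where
  "apply_op (InsV v a) G = G\<lparr>verts := insert v (verts G), vlab := (vlab G)(v := a)\<rparr>"
| "apply_op (DelV v) G = G\<lparr>verts := verts G - {v}\<rparr>"
| "apply_op (RelV v a) G = G\<lparr>vlab := (vlab G)(v := a)\<rparr>"
| "apply_op (InsE e a) G = G\<lparr>edges := insert e (edges G), elab := (elab G)(e := a)\<rparr>"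
| "apply_op (DelE e) G = G\<lparr>edges := edges G - {e}\<rparr>"
| "apply_op (RelE e a) G = G\<lparr>elab := (elab G)(e := a)\<rparr>"

fun target :: "'l edit_op \<Rightarrow> nat + nat set" where
  "target (InsV v a) = Inl v"
| "target (DelV v) = Inl v"
| "target (RelV v a) = Inl v"
| "target (InsE e a) = Inr e"
| "target (DelE e) = Inr e"
| "target (RelE e a) = Inr e"

fun edit_path :: "'l lgraph \<Rightarrow> 'l edit_op list \<Rightarrow> 'l lgraph \<Rightarrow> bool" where
  "edit_path G [] H \<longleftrightarrow> isomorphic G H"
| "edit_path G (x # xs) H \<longleftrightarrow> applicable G x \<and> edit_path (apply_op x G) xs H"

text \<open>
  An edge is identified with its pair of endpoints, so editing every vertex and every edge at
  most once also rules out deleting and reinserting an edge between substituted vertices.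
\<close>

definition restricted_edit_path :: "'l lgraph \<Rightarrow> 'l edit_op list \<Rightarrow> 'l lgraph \<Rightarrow> bool" where
  "restricted_edit_path G xs H \<longleftrightarrow> edit_path G xs H \<and> distinct (map target xs)"

record edit_cost =
  vins :: ennreal
  vdel :: ennreal
  vrel :: ennreal
  eins :: ennreal
  edel :: ennreal
  erel :: ennreal

fun op_cost :: "edit_cost \<Rightarrow> 'l lgraph \<Rightarrow> 'l edit_op \<Rightarrow> ennreal" where
  "op_cost C G (InsV v a) = vins C"
| "op_cost C G (DelV v) = vdel C"
| "op_cost C G (RelV v a) = (if vlab G v = a then 0 else vrel C)"
| "op_cost C G (InsE e a) = eins C"
| "op_cost C G (DelE e) = edel C"
| "op_cost C G (RelE e a) = (if elab G e = a then 0 else erel C)"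

fun path_cost :: "edit_cost \<Rightarrow> 'l lgraph \<Rightarrow> 'l edit_op list \<Rightarrow> ennreal" where
  "path_cost C G [] = 0"
| "path_cost C G (x # xs) = op_cost C G x + path_cost C (apply_op x G) xs"

text \<open>
  For finite graphs the infimum is a minimum: path costs are sums of natural multiples of the six
  constants of \<open>C\<close>.
\<close>

definition ged :: "'l lgraph \<Rightarrow> 'l lgraph \<Rightarrow> edit_cost \<Rightarrow> ennreal" where
  "ged G H C = Inf {path_cost C G xs | xs. restricted_edit_path G xs H}"

definition C_E :: edit_cost where
  "C_E = \<lparr>vins = 0, vdel = 0, vrel = \<infinity>, eins = 1, edel = 1, erel = 2\<rparr>"

section \<open>Polynomial time, NP and NP-hardness\<close>

text \<open>
  Deterministic Turing machines with \<open>num_tapes\<close> two-way infinite tapes, states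
  \<open>{..<num_states}\<close> and tape alphabet \<open>{..<num_syms}\<close>, where 0 is the blank and 1, 2 are the
  bits. The values of \<open>delta\<close> outside this finite domain are never consulted.
\<close>

datatype direction = MoveL | Stay | MoveR

record tm =
  num_tapes :: nat
  num_syms :: nat
  num_states :: nat
  start_state :: nat
  halt_state :: nat
  delta :: "nat \<Rightarrow> nat list \<Rightarrow> nat \<times> (nat \<times> direction) list"

definition wf_tm :: "tm \<Rightarrow> bool" where
  "wf_tm M \<longleftrightarrow> num_tapes M \<ge> 1 \<and> num_syms M \<ge> 3 \<and>
     start_state M < num_states M \<and> halt_state M < num_states M \<and>
     (\<forall>q<num_states M. \<forall>as. length as = num_tapes M \<and> (\<forall>a\<in>set as. a < num_syms M) \<longrightarrow>
        (case delta M q as of (q', bs) \<Rightarrow>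
           q' < num_states M \<and> length bs = num_tapes M \<and> (\<forall>(b, d)\<in>set bs. b < num_syms M)))"

type_synonym tape = "int \<times> (int \<Rightarrow> nat)"  \<comment> \<open>head position and contents\<close>

type_synonym config = "nat \<times> tape list"

fun read_tape :: "tape \<Rightarrow> nat" where
  "read_tape (h, c) = c h"

fun act_tape :: "nat \<times> direction \<Rightarrow> tape \<Rightarrow> tape" where
  "act_tape (a, d) (h, c) = (h + (case d of MoveL \<Rightarrow> -1 | Stay \<Rightarrow> 0 | MoveR \<Rightarrow> 1), c(h := a))"

fun tm_step :: "tm \<Rightarrow> config \<Rightarrow> config" where
  "tm_step M (q, ts) =
     (if q = halt_state M then (q, ts)
      else (case delta M q (map read_tape ts) of (q', bs) \<Rightarrow> (q', map2 act_tape bs ts)))"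

definition string_contents :: "bool list \<Rightarrow> int \<Rightarrow> nat" where
  "string_contents x i =
     (if 0 \<le> i \<and> i < int (length x) then (if x ! nat i then 2 else 1) else 0)"

definition init_config :: "tm \<Rightarrow> bool list \<Rightarrow> config" where
  "init_config M x = (start_state M,
     (0, string_contents x) # replicate (num_tapes M - 1) (0, string_contents []))"

text \<open>
  The input is written on the first tape, the output on the last one. Halting configurations are
  fixed points of \<open>tm_step\<close>, so being halted after exactly \<open>t\<close> steps means halting within \<open>t\<close>
  steps.
\<close>

definition computes_within :: "tm \<Rightarrow> nat \<Rightarrow> bool list \<Rightarrow> bool list \<Rightarrow> bool" where
  "computes_within M t x y \<longleftrightarrow>
     (case (tm_step M ^^ t) (init_config M x) of (q, ts) \<Rightarrow>
        q = halt_state M \<and> snd (last ts) = string_contents y)"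

definition poly_time :: "(bool list \<Rightarrow> bool list) \<Rightarrow> bool" where
  "poly_time f \<longleftrightarrow> (\<exists>M (p :: nat poly). wf_tm M \<and>
     (\<forall>x. computes_within M (poly p (length x)) x (f x)))"

definition class_P :: "bool list set set" where
  "class_P = {L. poly_time (\<lambda>x. [x \<in> L])}"

definition string_pair :: "bool list \<Rightarrow> bool list \<Rightarrow> bool list" where
  "string_pair x y = concat (map (\<lambda>b. [b, b]) x) @ [False, True] @ y"

definition class_NP :: "bool list set set" where
  "class_NP = {L. \<exists>V\<in>class_P. \<exists>p :: nat poly. \<forall>x.
     x \<in> L \<longleftrightarrow> (\<exists>y. length y \<le> poly p (length x) \<and> string_pair x y \<in> V)}"

text \<open>
  NP-hardness of the problem \<open>Q\<close> restricted to the instances in \<open>D\<close>: the reductions produce only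
  instances in \<open>D\<close>.
\<close>

definition NP_hard_on :: "bool list set \<Rightarrow> bool list set \<Rightarrow> bool" where
  "NP_hard_on D Q \<longleftrightarrow>
     (\<forall>L\<in>class_NP. \<exists>f. poly_time f \<and> (\<forall>x. f x \<in> D \<and> (x \<in> L \<longleftrightarrow> f x \<in> Q)))"

section \<open>The decision problem\<close>

text \<open>
  Numbers are written in binary (least significant bit first), each digit preceded by
  \<^term>\<open>True\<close> and the whole number terminated by \<^term>\<open>False\<close>, which gives a prefix-free code.
\<close>

fun bits :: "nat \<Rightarrow> bool list" where
  "bits n = (if n = 0 then [] else odd n # bits (n div 2))"

declare bits.simps [simp del]

definition encode_nat :: "nat \<Rightarrow> bool list" where
  "encode_nat n = concat (map (\<lambda>b. [True, b]) (bits n)) @ [False]"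

text \<open>
  A graph on the vertices \<open>0, \<dots>, n - 1\<close> is given by \<open>n\<close>, the vertex labels, and a list of its
  edges, each occurring once, with their labels. Labels are encoded by \<open>enc\<close>.
\<close>

definition encodes_graph :: "('l \<Rightarrow> bool list) \<Rightarrow> bool list \<Rightarrow> 'l lgraph \<Rightarrow> bool" where
  "encodes_graph enc s G \<longleftrightarrow> (\<exists>n es. verts G = {..<n} \<and>
     distinct (map (\<lambda>(u, v). {u, v}) es) \<and> edges G = (\<lambda>(u, v). {u, v}) ` set es \<and>
     s = encode_nat n @ concat (map (\<lambda>v. enc (vlab G v)) [0..<n]) @ encode_nat (length es) @
         concat (map (\<lambda>(u, v). encode_nat u @ encode_nat v @ enc (elab G {u, v})) es))"

definition ged_instance ::
  "('l \<Rightarrow> bool list) \<Rightarrow> 'l set \<Rightarrow> bool list \<Rightarrow> 'l lgraph \<Rightarrow> 'l lgraph \<Rightarrow> nat \<Rightarrow> bool" where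
  "ged_instance enc \<Sigma> s G1 G2 k \<longleftrightarrow>
     simple_graph G1 \<and> simple_graph G2 \<and> labeled_over \<Sigma> G1 \<and> labeled_over \<Sigma> G2 \<and>
     (\<exists>s1 s2. encodes_graph enc s1 G1 \<and> encodes_graph enc s2 G2 \<and> s = s1 @ s2 @ encode_nat k)"

definition ged_problem :: "('l \<Rightarrow> bool list) \<Rightarrow> 'l set \<Rightarrow> edit_cost \<Rightarrow> bool list set" where
  "ged_problem enc \<Sigma> C = {s. \<exists>G1 G2 k. ged_instance enc \<Sigma> s G1 G2 k \<and> ged G1 G2 C \<le> of_nat k}"

definition tree_instances :: "('l \<Rightarrow> bool list) \<Rightarrow> 'l set \<Rightarrow> bool list set" where
  "tree_instances enc \<Sigma> =
     {s. \<exists>G1 G2 k. ged_instance enc \<Sigma> s G1 G2 k \<and> is_tree G1 \<and> is_tree G2}"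

definition encode_unit :: "unit \<Rightarrow> bool list" where
  "encode_unit a = []"

end

(*
For graphs with uniform labels, GED under C_E is |E1| + |E2| minus twice the largest number of common
edges: vertices are free and cannot profitably be relabelled.

Hardness is shown directly from the definition of NP. A run of a verifier on (x, y) is a space-time
diagram, and the existence of a certificate y is equivalent to the tilability of a polynomial-size
torus whose rows are the configurations; row 0 sees both the initial and, across the seam, the final
configuration. A tiling is an exact cover: choosing a tile for a cell covers the cell itself and,
for every colour, one of two elements on each of its sides, the neighbour having to cover the other.
Adjoining to each element e its mirror image n - 1 - e gives all options the same weight.

An exact cover instance becomes two trees of the same size. In the second tree every option is a
center whose s hubs encode its elements by their numbers of leaves; in the first tree m - N centers
with small hubs block the options that are not selected, and n loose hubs, one for each element, go
to the remaining options. Both roots have dominating degree, so a cheap edit path maps root to root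
and embeds all edges of the first tree that avoid the root. Then each loose hub goes to a hub whose
element is at least as large, and since all options have equal weight the sums agree, so that the
elements are equal. Numbers of leaves are spaced by 2, which absorbs the edge joining a hub to its
center.

That the reduction runs in polynomial time follows from a compiler of register programs into Turing
machines, a register being the distance of a head from a marked cell.
*)
theory Submission
  imports Defs
begin

section \<open>Edit distance and symmetric difference of edge sets\<close>

text \<open>Vertex edits are free, so an edit path may place vertices anywhere and only counting
  constrains it. Both trees have \<open>n - 1\<close> edges, so a budget of
  \<open>2 * excess\<close> allows at most \<open>excess\<close> edges of the first tree to be lost,
  and its root has \<open>excess\<close> more children than the root of the second tree. Once the
  roots correspond, these extra root edges consume the whole budget and every other edge must
  survive. The budget is printed by the reduction and must not depend on the elements; balancing by
  mirror images also serves this.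

  Membership in the problem is existential over decoded graphs, so unique parsing is part of the
  correctness proof; it has to fix vertices and edges, whereas the lower bound ignores labels.

  The tile sets depend on the machine only, and the input enters through the class of each cell.
  Hence the machine contributes finite tables, and the rest is arithmetic on polynomially bounded
  numbers, for which unary registers are fast enough.\<close>

definition edge_diff :: "'l lgraph \<Rightarrow> 'l lgraph \<Rightarrow> nat" where
  "edge_diff G H = card (edges G - edges H) + card (edges H - edges G)"

lemma simple_graph_finite_edges: "simple_graph G \<Longrightarrow> finite (edges G)"
  by (rule finite_subset[of _ "Pow (verts G)"]) (auto simp: simple_graph_def)

lemma simple_graph_apply_op:
  assumes "simple_graph G" "applicable G x"
  shows "simple_graph (apply_op x G)"
  using assms by (cases x) (auto simp: simple_graph_def)

text \<open>Only edge insertions and deletions change the edge set, each by one edge and at cost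
  1.\<close>

lemma edge_diff_apply_op:
  assumes "simple_graph G" "applicable G x"
  shows "of_nat (edge_diff G (apply_op x G)) \<le> op_cost C_E G x"
proof -
  have [simp]: "A - B - A = {}" for A B :: "nat set set" by blast
  show ?thesis
    using assms by (cases x) (auto simp: edge_diff_def C_E_def Diff_Diff_Int Int_absorb1 insert_Diff_if)
qed

lemma edge_diff_triangle:
  assumes "simple_graph G" "simple_graph H" "simple_graph K"
  shows "edge_diff G K \<le> edge_diff G H + edge_diff H K"
proof -
  note fin = assms[THEN simple_graph_finite_edges]
  have "card (edges G - edges K) \<le> card ((edges G - edges H) \<union> (edges H - edges K))"
    and "card (edges K - edges G) \<le> card ((edges H - edges G) \<union> (edges K - edges H))"
    by (intro card_mono; use fin in blast)+
  moreover note card_Un_le[of "edges G - edges H" "edges H - edges K"]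
    card_Un_le[of "edges H - edges G" "edges K - edges H"]
  ultimately show ?thesis unfolding edge_diff_def by linarith
qed

text \<open>Operations refer to vertices by name, so the graph \<open>G'\<close> reached before the
  final isomorphism can be compared with \<open>G\<close> edge by edge.\<close>

lemma edit_path_edge_diff:
  assumes "edit_path G xs H" "simple_graph G"
  shows "\<exists>G'. simple_graph G' \<and> isomorphic G' H \<and> of_nat (edge_diff G G') \<le> path_cost C_E G xs"
  using assms
proof (induction xs arbitrary: G)
  case Nil
  then show ?case by (intro exI[of _ G]) (auto simp: edge_diff_def)
next
  case (Cons x xs)
  let ?G = "apply_op x G"
  have x: "applicable G x" "simple_graph ?G"
    using Cons.prems simple_graph_apply_op by auto
  obtain G' where G': "simple_graph G'" "isomorphic G' H" "of_nat (edge_diff ?G G') \<le> path_cost C_E ?G xs"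
    using Cons.IH[of ?G] Cons.prems x by auto
  have "(of_nat (edge_diff G G') :: ennreal) \<le> of_nat (edge_diff G ?G + edge_diff ?G G')"
    using edge_diff_triangle[OF Cons.prems(2) x(2) G'(1)] by (rule of_nat_mono)
  also have "\<dots> \<le> op_cost C_E G x + path_cost C_E ?G xs"
    using edge_diff_apply_op[OF Cons.prems(2) x(1)] G'(3) by (simp add: add_mono)
  finally show ?case using G' by auto
qed

text \<open>Edge differences are integers: if all of them exceeded \<open>k\<close>, the infimum of
  the costs would be at least \<open>k + 1\<close>. This avoids constructing a path of minimal
  cost.\<close>

lemma ged_le_imp:
  assumes "simple_graph G" "ged G H C_E \<le> of_nat k"
  obtains G' where "simple_graph G'" "isomorphic G' H" "edge_diff G G' \<le> k"
proof (rule ccontr)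
  assume *: "\<not> thesis"
  have no: "Suc k \<le> edge_diff G G'" if "simple_graph G'" "isomorphic G' H" for G'
    using * \<open>\<And>G'. simple_graph G' \<Longrightarrow> _ \<Longrightarrow> _ \<Longrightarrow> thesis\<close>[OF that] by fastforce
  have "of_nat (Suc k) \<le> ged G H C_E"
    unfolding ged_def
  proof (rule Inf_greatest, clarify)
    fix xs assume "restricted_edit_path G xs H"
    then obtain G' where "simple_graph G'" "isomorphic G' H" "of_nat (edge_diff G G') \<le> path_cost C_E G xs"
      using edit_path_edge_diff[OF _ assms(1)] unfolding restricted_edit_path_def by blast
    moreover from this have "(of_nat (Suc k) :: ennreal) \<le> of_nat (edge_diff G G')"
      using no by (intro of_nat_mono) auto
    ultimately show "of_nat (Suc k) \<le> path_cost C_E G xs" by (meson order_trans)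
  qed
  then have "(of_nat (Suc k) :: ennreal) \<le> of_nat k" using assms(2) by (rule order_trans)
  then show False by (simp only: of_nat_le_iff)
qed

section \<open>Edit paths to a prescribed target graph\<close>

lemma edit_path_delete_edges:
  assumes "distinct es" "set es \<subseteq> edges G" "edit_path (G\<lparr>edges := edges G - set es\<rparr>) ys H"
  shows "edit_path G (map DelE es @ ys) H \<and>
    path_cost C_E G (map DelE es @ ys) = of_nat (length es) + path_cost C_E (G\<lparr>edges := edges G - set es\<rparr>) ys"
  using assms
proof (induction es arbitrary: G)
  case (Cons e es)
  let ?G = "G\<lparr>edges := edges G - {e}\<rparr>"
  have G: "?G\<lparr>edges := edges ?G - set es\<rparr> = G\<lparr>edges := edges G - set (e # es)\<rparr>"
    by (cases G) auto
  have "edit_path ?G (map DelE es @ ys) H \<and> path_cost C_E ?G (map DelE es @ ys) =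
      of_nat (length es) + path_cost C_E (G\<lparr>edges := edges G - set (e # es)\<rparr>) ys"
    unfolding G[symmetric] by (rule Cons.IH) (use Cons.prems in \<open>auto simp only: G\<close>, use Cons.prems in auto)
  moreover have c: "op_cost C_E G (DelE e) = 1" by (simp add: C_E_def)
  ultimately show ?case
    unfolding list.map append.simps edit_path.simps path_cost.simps apply_op.simps
    using Cons.prems(2) c by (simp add: add.assoc)
next
  case Nil
  have "G\<lparr>edges := edges G - set []\<rparr> = G" by simp
  with Nil show ?case by (simp only: list.map append_Nil list.size of_nat_0 add_0_left)
qed

text \<open>The labeling is constant on all names, not only on vertices, so an insertion with label
  \<open>a\<close> leaves the label function literally unchanged, and only the vertex set is
  updated.\<close>

lemma edit_path_insert_vertices:
  assumes "distinct vs" "set vs \<inter> verts G = {}" "vlab G = (\<lambda>_. a)"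
    "edit_path (G\<lparr>verts := set vs \<union> verts G\<rparr>) ys H"
  shows "edit_path G (map (\<lambda>v. InsV v a) vs @ ys) H \<and>
    path_cost C_E G (map (\<lambda>v. InsV v a) vs @ ys) = path_cost C_E (G\<lparr>verts := set vs \<union> verts G\<rparr>) ys"
  using assms
proof (induction vs arbitrary: G)
  case (Cons v vs)
  let ?G = "G\<lparr>verts := insert v (verts G)\<rparr>"
  have G: "G\<lparr>verts := insert v (verts G), vlab := (vlab G)(v := a)\<rparr> = ?G"
    using Cons.prems(3) by (cases G) (simp add: fun_eq_iff)
  have "?G\<lparr>verts := set vs \<union> verts ?G\<rparr> = G\<lparr>verts := set (v # vs) \<union> verts G\<rparr>" by simp
  with Cons.IH[of ?G] Cons.prems show ?case
    unfolding list.map append.simps edit_path.simps path_cost.simps apply_op.simps G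
    by (simp add: C_E_def)
next
  case Nil
  have "G\<lparr>verts := set [] \<union> verts G\<rparr> = G" by simp
  with Nil show ?case by (simp only: list.map append_Nil list.size of_nat_0 simp_thms)
qed

lemma edit_path_insert_edges:
  assumes "distinct es" "set es \<inter> edges G = {}" "elab G = (\<lambda>_. a)"
    "\<And>e. e \<in> set es \<Longrightarrow> e \<subseteq> verts G \<and> card e = 2"
    "isomorphic (G\<lparr>edges := set es \<union> edges G\<rparr>) H"
  shows "edit_path G (map (\<lambda>e. InsE e a) es) H \<and>
    path_cost C_E G (map (\<lambda>e. InsE e a) es) = of_nat (length es)"
  using assms
proof (induction es arbitrary: G)
  case (Cons e es)
  let ?G = "G\<lparr>edges := insert e (edges G)\<rparr>"
  have G: "G\<lparr>edges := insert e (edges G), elab := (elab G)(e := a)\<rparr> = ?G"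
    using Cons.prems(3) by (cases G) (simp add: fun_eq_iff)
  have "?G\<lparr>edges := set es \<union> edges ?G\<rparr> = G\<lparr>edges := set (e # es) \<union> edges G\<rparr>" by simp
  with Cons.IH[of ?G] Cons.prems show ?case
    unfolding list.map append.simps edit_path.simps path_cost.simps apply_op.simps G
    by (simp add: C_E_def)
next
  case Nil
  have "G\<lparr>edges := set [] \<union> edges G\<rparr> = G" by simp
  with Nil show ?case by (simp only: list.map append_Nil list.size of_nat_0 edit_path.simps path_cost.simps simp_thms)
qed

text \<open>Deleting edges, inserting vertices and inserting edges, in this order, respects
  applicability, and the three stages have disjoint targets, so the path is restricted.\<close>

lemma ged_le_edge_diff:
  assumes "simple_graph G" "simple_graph G'" "verts G \<subseteq> verts G'" "isomorphic G' H"
    and "vlab G = (\<lambda>_. a)" "elab G = (\<lambda>_. a)" "vlab G' = (\<lambda>_. a)" "elab G' = (\<lambda>_. a)"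
  shows "ged G H C_E \<le> of_nat (edge_diff G G')"
proof -
  have fin: "finite (edges G)" "finite (edges G')" "finite (verts G')"
    using assms simple_graph_finite_edges by (auto simp: simple_graph_def)
  obtain es where es: "set es = edges G - edges G'" "distinct es" using fin finite_distinct_list by blast
  obtain fs where fs: "set fs = edges G' - edges G" "distinct fs" using fin finite_distinct_list by blast
  obtain vs where vs: "set vs = verts G' - verts G" "distinct vs" using fin finite_distinct_list by blast
  let ?G1 = "G\<lparr>edges := edges G - set es\<rparr>"
  let ?G2 = "?G1\<lparr>verts := set vs \<union> verts ?G1\<rparr>"
  let ?ys = "map (\<lambda>e. InsE e a) fs" and ?zs = "map (\<lambda>v. InsV v a) vs"
  have G': "?G2\<lparr>edges := set fs \<union> edges ?G2\<rparr> = G'"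
    using assms es fs vs by (cases G; cases G') auto
  have 1: "edit_path ?G2 ?ys H \<and> path_cost C_E ?G2 ?ys = of_nat (length fs)"
    using G' assms es fs vs by (intro edit_path_insert_edges) (auto simp: simple_graph_def)
  have 2: "edit_path ?G1 (?zs @ ?ys) H \<and> path_cost C_E ?G1 (?zs @ ?ys) = path_cost C_E ?G2 ?ys"
    using 1 assms vs by (intro edit_path_insert_vertices) auto
  have 3: "edit_path G (map DelE es @ ?zs @ ?ys) H \<and>
    path_cost C_E G (map DelE es @ ?zs @ ?ys) = of_nat (length es) + path_cost C_E ?G1 (?zs @ ?ys)"
    using 2 es by (intro edit_path_delete_edges) auto
  have "restricted_edit_path G (map DelE es @ ?zs @ ?ys) H"
    unfolding restricted_edit_path_def using 3 es fs vs
    by (auto simp: distinct_map comp_def inj_on_def)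
  moreover have "path_cost C_E G (map DelE es @ ?zs @ ?ys) = of_nat (edge_diff G G')"
    using 1 2 3 es fs by (simp add: edge_diff_def distinct_card[symmetric])
  ultimately show ?thesis unfolding ged_def by (intro Inf_lower) force
qed

section \<open>Trees given by parent functions\<close>

locale parent_function =
  fixes n :: nat and p :: "nat \<Rightarrow> nat"
  assumes nonempty: "n > 0" and parent_less: "\<And>v. v > 0 \<Longrightarrow> p v < v"

definition parent_edges :: "nat \<Rightarrow> (nat \<Rightarrow> nat) \<Rightarrow> nat set set" where
  "parent_edges n p = (\<lambda>v. {p v, v}) ` {1..<n}"

definition parent_graph :: "'l \<Rightarrow> nat \<Rightarrow> (nat \<Rightarrow> nat) \<Rightarrow> 'l lgraph" where
  "parent_graph a n p = \<lparr>verts = {..<n}, edges = parent_edges n p, vlab = \<lambda>_. a, elab = \<lambda>_. a\<rparr>"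

lemma parent_graph_simps [simp]:
  "verts (parent_graph a n p) = {..<n}" "edges (parent_graph a n p) = parent_edges n p"
  "vlab (parent_graph a n p) = (\<lambda>_. a)" "elab (parent_graph a n p) = (\<lambda>_. a)"
  by (simp_all add: parent_graph_def)

context parent_function
begin

text \<open>The child of a parent edge is its larger endpoint.\<close>

lemma parent_edge_inj: "inj_on (\<lambda>v. {p v, v}) {1..}"
proof (rule inj_onI)
  fix v w assume "v \<in> {1..}" "w \<in> {1..}" and e: "{p v, v} = {p w, w}"
  then have "p v < v" "p w < w" using parent_less by auto
  with e show "v = w" unfolding doubleton_eq_iff by linarith
qed

lemma parent_edge_inj': "A \<subseteq> {1..} \<Longrightarrow> inj_on (\<lambda>v. {p v, v}) A"
  using parent_edge_inj by (rule inj_on_subset)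

lemma card_parent_edges: "card (parent_edges n p) = n - 1"
  unfolding parent_edges_def by (subst card_image[OF parent_edge_inj']) auto

lemma simple_parent_edges: "e \<in> parent_edges n p \<Longrightarrow> e \<subseteq> {..<n} \<and> card e = 2"
proof -
  assume "e \<in> parent_edges n p"
  then obtain v where v: "e = {p v, v}" "0 < v" "v < n" by (auto simp: parent_edges_def)
  then show ?thesis using parent_less[OF v(2)] by auto
qed

lemma parent_edge_iff:
  "{u, v} \<in> parent_edges n p \<longleftrightarrow> u < n \<and> v < n \<and> (v > 0 \<and> u = p v \<or> u > 0 \<and> v = p u)"
proof
  assume "{u, v} \<in> parent_edges n p"
  then obtain w where e: "{u, v} = {p w, w}" and "w \<in> {1..<n}" unfolding parent_edges_def by (elim imageE)
  then have w: "w > 0" "0 < w" "w < n" by simp_all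
  consider "u = p w" "v = w" | "u = w" "v = p w" using e unfolding doubleton_eq_iff by (elim disjE conjE)
  then show "u < n \<and> v < n \<and> (v > 0 \<and> u = p v \<or> u > 0 \<and> v = p u)"
  proof cases
    case 1
    show ?thesis unfolding 1 using parent_less[OF w(2)] w(2,3) by simp
  next
    case 2
    show ?thesis unfolding 2 using parent_less[OF w(2)] w(2,3) by simp
  qed
next
  have *: "{p w, w} \<in> parent_edges n p" if "0 < w" "w < n" for w
    using that by (simp add: parent_edges_def)
  assume "u < n \<and> v < n \<and> (v > 0 \<and> u = p v \<or> u > 0 \<and> v = p u)"
  then consider "u = p v" "0 < v" "v < n" | "v = p u" "0 < u" "u < n" by blast
  then show "{u, v} \<in> parent_edges n p"
  proof cases
    case 1
    then show ?thesis using *[of v] by metis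
  next
    case 2
    then show ?thesis using *[of u] insert_commute[of "p u" u] by metis
  qed
qed

lemma simple_parent_graph: "simple_graph (parent_graph a n p)"
  unfolding simple_graph_def parent_graph_simps using simple_parent_edges by blast

lemma tree_parent_graph: "is_tree (parent_graph a n p)"
proof -
  let ?G = "parent_graph a n p"
  define R where "R = {(a, b). {a, b} \<in> edges ?G}"
  have root: "(v, 0) \<in> R\<^sup>* \<and> (0, v) \<in> R\<^sup>*" if "v < n" for v
    using that
  proof (induction v rule: less_induct)
    case (less v)
    show ?case
    proof (cases "v = 0")
      case False
      then have v: "p v < v" using parent_less by simp
      then have "(v, p v) \<in> R" "(p v, v) \<in> R"
        using less.prems False by (auto simp: R_def parent_edge_iff)
      moreover have "(p v, 0) \<in> R\<^sup>* \<and> (0, p v) \<in> R\<^sup>*" using less v by simp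
      ultimately show ?thesis by (meson converse_rtrancl_into_rtrancl rtrancl.rtrancl_into_rtrancl)
    qed simp
  qed
  have conn: "connected_graph ?G"
    unfolding connected_graph_def R_def[symmetric] using nonempty root by (auto intro: rtrancl_trans)
  have "\<not> is_cycle ?G c" for c
  proof
    assume c: "is_cycle ?G c"
    let ?l = "length c"
    have l: "?l \<ge> 3" "distinct c" using c by (auto simp: is_cycle_def)
    have e: "{c ! i, c ! ((i + 1) mod ?l)} \<in> parent_edges n p" if "i < ?l" for i
    proof (cases "Suc i < ?l")
      case True
      then show ?thesis using c by (auto simp: is_cycle_def)
    next
      case False
      then have "i = ?l - 1" "c \<noteq> []" using that by auto
      then show ?thesis using c l by (auto simp: is_cycle_def last_conv_nth hd_conv_nth)
    qed
    \<comment> \<open>Both cyclic neighbours of the largest vertex are at most as large, hence equal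
      to its parent, although the vertices of a cycle are distinct.\<close>
    define v where "v = Max (set c)"
    have "v \<in> set c" unfolding v_def using l by (intro Max_in) auto
    then obtain i where i: "i < ?l" "c ! i = v" by (auto simp: in_set_conv_nth)
    let ?s = "(i + 1) mod ?l" and ?q = "(i + ?l - 1) mod ?l"
    have s_eq: "?s = (if i + 1 = ?l then 0 else i + 1)" using i(1) by auto
    have q_eq: "?q = (if i = 0 then ?l - 1 else i - 1)" using i(1) l(1)
      by (cases i) auto
    have q: "(?q + 1) mod ?l = i" using i(1) l(1) unfolding q_eq by auto
    have lt: "?s < ?l" "?q < ?l" using i(1) unfolding s_eq q_eq by auto
    have neq: "?s \<noteq> ?q" using i(1) l(1) unfolding s_eq q_eq by auto
    have le: "c ! j \<le> v" if "j < ?l" for j unfolding v_def using that by simp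
    have "c ! ?s = p v" using e[OF i(1)] i(2) le[OF lt(1)] parent_less[of "c ! ?s"]
      by (auto simp: parent_edge_iff)
    moreover have "c ! ?q = p v" using e[OF lt(2)] i(2) le[OF lt(2)] parent_less[of "c ! ?q"]
      unfolding q by (auto simp: parent_edge_iff)
    ultimately show False using neq nth_eq_iff_index_eq[OF l(2) lt] by simp
  qed
  then show ?thesis unfolding is_tree_def using conn simple_parent_graph by auto
qed

end

text \<open>The child endpoints of the edges that avoid the root, so that its cardinality counts
  these edges.\<close>

definition nonroot :: "nat \<Rightarrow> (nat \<Rightarrow> nat) \<Rightarrow> nat set" where
  "nonroot n p = {v \<in> {1..<n}. p v \<noteq> 0}"

locale parent_pair = P1: parent_function n p1 + P2: parent_function n p2 for n p1 p2
begin

text \<open>Both trees have the same number of edges, so unless the subtraction truncates, this is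
  the number of additional children of the root in the first tree.\<close>

abbreviation excess :: nat where
  "excess \<equiv> card (nonroot n p2) - card (nonroot n p1)"

text \<open>Pulling the second tree back along \<open>f\<close> gives a target on the same vertices.
  It shares with the first tree all edges of the first tree that avoid the root and all of its own
  root edges, so only \<open>excess\<close> root edges of the first tree are lost.\<close>

lemma ged_parent_graph_le:
  assumes f: "bij_betw f {..<n} {..<n}" "f 0 = 0"
    and pres: "\<And>v. v < n \<Longrightarrow> p1 v \<noteq> 0 \<Longrightarrow> v > 0 \<Longrightarrow> p2 (f v) = f (p1 v)"
  shows "ged (parent_graph a n p1) (parent_graph a n p2) C_E \<le> of_nat (2 * excess)"
proof -
  define g where "g = inv_into {..<n} f"
  have g: "bij_betw g {..<n} {..<n}" unfolding g_def using f(1) by (rule bij_betw_inv_into)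
  have g_less: "g v < n" if "v < n" for v using bij_betwE[OF g] that by simp
  have f_less: "f v < n" if "v < n" for v using bij_betwE[OF f(1)] that by simp
  have f_g: "f (g v) = v" if "v < n" for v
    unfolding g_def by (rule bij_betw_inv_into_right[OF f(1)]) (use that in simp)
  have g_f: "g (f v) = v" if "v < n" for v
    unfolding g_def by (rule bij_betw_inv_into_left[OF f(1)]) (use that in simp)
  note fg = f_g g_less and gf = g_f f_less
  have g0: "g 0 = 0" using g_f[OF P1.nonempty] f(2) by simp
  have f0: "f v = 0 \<longleftrightarrow> v = 0" if "v < n" for v
    using g_f[OF that] f(2) g0 by auto
  have f_pos: "0 < f v" if "0 < v" "v < n" for v
    using f0[OF that(2)] that(1) by (cases "f v") auto
  define E where "E = (`) g ` parent_edges n p2"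
  define G' where "G' = \<lparr>verts = {..<n}, edges = E, vlab = \<lambda>_ :: nat. a, elab = \<lambda>_ :: nat set. a\<rparr>"
  have fge: "f ` g ` e = e" if "e \<subseteq> {..<n}" for e
  proof -
    have "(\<lambda>v. f (g v)) ` e = (\<lambda>v. v) ` e" using that by (intro image_cong refl f_g) blast
    then show ?thesis by (simp only: image_image image_ident)
  qed
  have gfe: "g ` f ` e = e" if "e \<subseteq> {..<n}" for e
  proof -
    have "(\<lambda>v. g (f v)) ` e = (\<lambda>v. v) ` e" using that by (intro image_cong refl g_f) blast
    then show ?thesis by (simp only: image_image image_ident)
  qed
  have sub2: "e \<subseteq> {..<n}" if "e \<in> parent_edges n p2" for e
    using P2.simple_parent_edges[OF that] by (rule conjunct1)
  have injg: "inj_on ((`) g) (parent_edges n p2)"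
    by (rule inj_on_inverseI[of _ "(`) f"]) (rule fge[OF sub2])
  have E_iff: "e \<in> E \<longleftrightarrow> f ` e \<in> parent_edges n p2" if "e \<subseteq> {..<n}" for e
  proof
    assume "e \<in> E"
    then obtain e' where e': "e' \<in> parent_edges n p2" "e = g ` e'" unfolding E_def by (elim imageE)
    show "f ` e \<in> parent_edges n p2" unfolding e'(2) fge[OF sub2[OF e'(1)]] by (rule e'(1))
  next
    assume "f ` e \<in> parent_edges n p2"
    then have "g ` f ` e \<in> E" unfolding E_def by (rule imageI)
    then show "e \<in> E" unfolding gfe[OF that] .
  qed
  have simpG': "simple_graph G'"
  proof -
    have "e \<subseteq> {..<n} \<and> card e = 2" if eE: "e \<in> E" for e
    proof -
      obtain e' where e': "e' \<in> parent_edges n p2" "e = g ` e'" using eE unfolding E_def by (elim imageE)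
      have "inj_on g e'" using bij_betw_imp_inj_on[OF g] sub2[OF e'(1)] by (rule inj_on_subset)
      then have "card e = 2" using P2.simple_parent_edges[OF e'(1)] unfolding e'(2) by (simp only: card_image)
      moreover have "e \<subseteq> {..<n}" unfolding e'(2) using sub2[OF e'(1)] g_less by blast
      ultimately show ?thesis by simp
    qed
    then show ?thesis unfolding simple_graph_def by (simp add: G'_def)
  qed
  have iso: "isomorphic G' (parent_graph a n p2)"
    unfolding isomorphic_def
    by (rule exI[of _ f]) (use f(1) E_iff in \<open>simp add: G'_def\<close>)
  have "ged (parent_graph a n p1) (parent_graph a n p2) C_E \<le> of_nat (edge_diff (parent_graph a n p1) G')"
    by (rule ged_le_edge_diff[OF P1.simple_parent_graph simpG' _ iso]) (simp_all add: G'_def)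
  also have "edge_diff (parent_graph a n p1) G' \<le> 2 * excess"
  proof -
    let ?E1 = "parent_edges n p1"
    have fin: "finite ?E1" "finite E" by (auto simp: parent_edges_def E_def)
    have cardE: "card E = n - 1" unfolding E_def using card_image[OF injg] P2.card_parent_edges by simp
    let ?A = "nonroot n p1" and ?B = "{v \<in> {1..<n}. p2 (f v) = 0}"
    \<comment> \<open>If \<open>p1 v\<close> were not the root, \<open>f v\<close> would have the
      parent \<open>f (p1 v)\<close>, which is not 0.\<close>
    have B0: "p1 v = 0" if "v \<in> ?B" for v
    proof (rule ccontr)
      assume "p1 v \<noteq> 0"
      moreover have "p1 v < n" using that P1.parent_less[of v] by auto
      ultimately show False using pres[of v] that f0[of "p1 v"] by auto
    qed
    have AB: "?A \<union> ?B \<subseteq> {1..}" by (auto simp: nonroot_def)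
    have "(\<lambda>v. {p1 v, v}) ` (?A \<union> ?B) \<subseteq> ?E1 \<inter> E"
    proof (rule image_subsetI)
      fix v assume v: "v \<in> ?A \<union> ?B"
      then have v': "0 < v" "v < n" by (auto simp: nonroot_def)
      then have pv: "p1 v < n" using P1.parent_less[of v] by simp
      have "p2 (f v) = f (p1 v)"
      proof (cases "p1 v = 0")
        case True
        then show ?thesis using v f(2) by (auto simp: nonroot_def)
      next
        case False
        then show ?thesis using v' pres by simp
      qed
      moreover have "0 < f v" "f v < n" using v' f_less[of v] f0[of v] by simp_all
      ultimately have "{f (p1 v), f v} \<in> parent_edges n p2"
        unfolding parent_edges_def by (intro image_eqI[of _ _ "f v"]) simp_all
      then have "{p1 v, v} \<in> E" using v' pv by (simp add: E_iff)
      then show "{p1 v, v} \<in> ?E1 \<inter> E"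
        using v' by (simp add: parent_edges_def)
    qed
    then have "card ((\<lambda>v. {p1 v, v}) ` (?A \<union> ?B)) \<le> card (?E1 \<inter> E)"
      using fin by (intro card_mono) simp_all
    then have "card (?A \<union> ?B) \<le> card (?E1 \<inter> E)"
      unfolding card_image[OF P1.parent_edge_inj'[OF AB]] .
    moreover have "card (?A \<union> ?B) = card ?A + card ?B"
      by (rule card_Un_disjoint) (use B0 in \<open>auto simp: nonroot_def\<close>)
    moreover have "card ?B = n - 1 - card (nonroot n p2)"
    proof -
      have "bij_betw f ?B ({1..<n} - nonroot n p2)"
      proof (rule bij_betw_byWitness[of _ g])
        show "f ` ?B \<subseteq> {1..<n} - nonroot n p2"
          using f_less f_pos by (auto simp: nonroot_def Suc_le_eq)
        show "g ` ({1..<n} - nonroot n p2) \<subseteq> ?B"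
        proof (rule image_subsetI)
          fix w assume w: "w \<in> {1..<n} - nonroot n p2"
          then have "w < n" "w \<noteq> 0" "p2 w = 0" by (auto simp: nonroot_def)
          moreover from this have "g w \<noteq> 0" using f_g[of w] f(2) by metis
          ultimately show "g w \<in> ?B" using g_less f_g by (simp add: Suc_le_eq)
        qed
      qed (use f_g g_f in auto)
      then have "card ?B = card ({1..<n} - nonroot n p2)" by (rule bij_betw_same_card)
      then show ?thesis by (subst (asm) card_Diff_subset) (auto simp: nonroot_def)
    qed
    ultimately have int: "card ?A + (n - 1 - card (nonroot n p2)) \<le> card (?E1 \<inter> E)" by simp
    have "nonroot n p2 \<subseteq> {1..<n}" by (auto simp: nonroot_def)
    then have "card (nonroot n p2) \<le> n - 1" using card_mono[of "{1..<n}"] by simp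
    then show ?thesis
      unfolding edge_diff_def using int fin cardE P1.card_parent_edges
      by (simp add: G'_def card_Diff_subset_Int Int_commute)
  qed
  finally show ?thesis by (simp only: of_nat_le_iff)
qed

text \<open>At most \<open>excess\<close> edges of the first tree are lost, so many root edges
  survive, and by \<open>deg\<close> only the root of the second tree can be the image of the root.
  That root has \<open>excess\<close> fewer children, so at least that many root edges are lost,
  which exhausts the budget. Vertices may have been deleted and inserted, hence the domain
  \<open>W\<close>.\<close>

lemma ged_parent_graph_embedding:
  fixes G H :: "'l lgraph"
  assumes G: "simple_graph G" "verts G = {..<n}" "edges G = parent_edges n p1"
    and H: "simple_graph H" "verts H = {..<n}" "edges H = parent_edges n p2"
    and ged: "ged G H C_E \<le> of_nat (2 * excess)"
    and le: "card (nonroot n p1) \<le> card (nonroot n p2)"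
    and deg: "\<And>v. v > 0 \<Longrightarrow> v < n \<Longrightarrow>
      card {w \<in> {1..<n}. p2 w = v} + 1 < n - 1 - card (nonroot n p2)"
    and pos: "card (nonroot n p2) < n - 1"
  obtains f W where "inj_on f W" "0 \<in> W" "f 0 = 0"
    "\<And>v. v \<in> nonroot n p1 \<Longrightarrow> v \<in> W \<and> p1 v \<in> W \<and> {f (p1 v), f v} \<in> parent_edges n p2"
proof -
  obtain G' where G': "simple_graph G'" "isomorphic G' H" "edge_diff G G' \<le> 2 * excess"
    using ged_le_imp[OF G(1) ged] .
  obtain f where f: "bij_betw f (verts G') {..<n}"
    and adj: "\<And>u v. u \<in> verts G' \<Longrightarrow> v \<in> verts G' \<Longrightarrow> {u, v} \<in> edges G' \<longleftrightarrow> {f u, f v} \<in> parent_edges n p2"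
    using G'(2) H unfolding isomorphic_def by auto
  let ?W = "verts G'" and ?E' = "edges G'" and ?E1 = "parent_edges n p1"
  have inj: "inj_on f ?W" using f by (simp add: bij_betw_def)
  have sub': "e \<subseteq> ?W" "\<exists>u v. e = {u, v} \<and> u \<noteq> v" if "e \<in> ?E'" for e
    using G'(1) that unfolding simple_graph_def by (auto simp: card_2_iff)
  have fin: "finite ?E'" "finite ?E1" using simple_graph_finite_edges[OF G'(1)] by (auto simp: parent_edges_def)
  have fE': "(`) f ` ?E' = parent_edges n p2"
  proof (intro equalityI subsetI)
    fix e assume "e \<in> (`) f ` ?E'"
    then obtain u v where "{u, v} \<in> ?E'" "e = f ` {u, v}" using sub'(2) by blast
    then show "e \<in> parent_edges n p2" using adj[of u v] sub'(1) by auto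
  next
    fix e assume e: "e \<in> parent_edges n p2"
    then obtain u v where uv: "e = {u, v}" "u < n" "v < n"
      using P2.simple_parent_edges[OF e] by (auto simp: card_2_iff)
    then obtain u' v' where "u' \<in> ?W" "v' \<in> ?W" "u = f u'" "v = f v'"
      using f by (metis bij_betw_imp_surj_on imageE lessThan_iff)
    then show "e \<in> (`) f ` ?E'" using adj[of u' v'] e uv by (intro image_eqI[of _ _ "{u', v'}"]) auto
  qed
  have injE: "inj_on ((`) f) ?E'"
    by (rule inj_on_subset[OF inj_on_image_Pow[OF inj]]) (use sub' in auto)
  have cardE': "card ?E' = n - 1" using card_image[OF injE] fE' P2.card_parent_edges by simp
  \<comment> \<open>Edge sets of equal size differ by equally many edges in both directions, so each
    direction gets half of the budget.\<close>
  have lost: "card (?E1 - ?E') \<le> excess"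
  proof -
    have "card (?E1 - ?E') = n - 1 - card (?E1 \<inter> ?E')" "card (?E' - ?E1) = n - 1 - card (?E1 \<inter> ?E')"
      using fin cardE' P1.card_parent_edges by (simp_all add: card_Diff_subset_Int Int_commute)
    then show ?thesis using G'(3) G(3) by (simp add: edge_diff_def)
  qed
  let ?N = "{1..<n} - nonroot n p1"
  let ?R = "(\<lambda>v. {p1 v, v}) ` ?N"
  have N: "p1 v = 0" "0 < v" "v < n" if "v \<in> ?N" for v using that by (auto simp: nonroot_def)
  have "nonroot n p1 \<subseteq> {1..<n}" by (auto simp: nonroot_def)
  then have cardR: "card ?R = n - 1 - card (nonroot n p1)"
    by (subst card_image[OF P1.parent_edge_inj']) (auto simp: card_Diff_subset finite_subset)
  have R1: "?R \<subseteq> ?E1" by (auto simp: parent_edges_def)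
  have finR: "finite ?R" by simp
  have cR: "card (?R - ?E') + card (?R \<inter> ?E') = n - 1 - card (nonroot n p1)"
    using cardR card_Int_Diff[OF finR, of ?E'] by simp
  have "card (?R - ?E') \<le> card (?E1 - ?E')" using R1 fin by (intro card_mono) auto
  then have kept: "n - 1 - card (nonroot n p2) \<le> card (?R \<inter> ?E')"
    using cR lost le pos by linarith
  then have "?R \<inter> ?E' \<noteq> {}" using pos by auto
  then obtain v0 where v0: "v0 \<in> ?N" "{0, v0} \<in> ?E'" using N by fastforce
  have zW: "0 \<in> ?W" using sub'(1)[OF v0(2)] by simp
  let ?K = "{v \<in> ?N. {0, v} \<in> ?E'}"
  have RK: "?R \<inter> ?E' = (\<lambda>v. {p1 v, v}) ` ?K" using N(1) by force
  have cardK: "card (?R \<inter> ?E') = card ?K" unfolding RK by (rule card_image[OF P1.parent_edge_inj']) auto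
  have KW: "v \<in> ?W" if "v \<in> ?K" for v using that sub'(1) by auto
  have fK: "card (f ` ?K) = card ?K" using inj KW by (intro card_image inj_on_subset[OF inj]) auto
  have fKadj: "{f 0, w} \<in> parent_edges n p2" if wK: "w \<in> f ` ?K" for w
  proof -
    obtain v where v: "v \<in> ?K" "w = f v" using wK by (elim imageE)
    then have "{0, v} \<in> ?E'" by simp
    then show ?thesis using adj[OF zW KW[OF v(1)]] v(2) by simp
  qed
  \<comment> \<open>The neighbours of any other vertex are its children and its parent, fewer than
    the surviving root edges.\<close>
  have f0: "f 0 = 0"
  proof (rule ccontr)
    assume nz: "f 0 \<noteq> 0"
    have f0n: "f 0 < n" using f zW by (auto dest: bij_betwE)
    have "f ` ?K \<subseteq> insert (p2 (f 0)) {w \<in> {1..<n}. p2 w = f 0}"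
    proof (rule subsetI)
      fix w assume "w \<in> f ` ?K"
      then have "w < n" "w > 0 \<and> f 0 = p2 w \<or> w = p2 (f 0)"
        using fKadj[of w] unfolding P2.parent_edge_iff by blast+
      then show "w \<in> insert (p2 (f 0)) {w \<in> {1..<n}. p2 w = f 0}" by auto
    qed
    then have "card (f ` ?K) \<le> card (insert (p2 (f 0)) {w \<in> {1..<n}. p2 w = f 0})" by (intro card_mono) auto
    also have "\<dots> \<le> card {w \<in> {1..<n}. p2 w = f 0} + 1" by (simp add: card_insert_if)
    finally show False using deg[of "f 0"] nz f0n kept cardK fK by linarith
  qed
  have "f ` ?K \<subseteq> {1..<n} - nonroot n p2"
  proof (rule subsetI)
    fix w assume "w \<in> f ` ?K"
    then have "w < n" "w > 0" "p2 w = 0"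
      using fKadj[of w] unfolding P2.parent_edge_iff f0 by auto
    then show "w \<in> {1..<n} - nonroot n p2" by (simp add: nonroot_def)
  qed
  then have "card (f ` ?K) \<le> card ({1..<n} - nonroot n p2)" by (intro card_mono) simp_all
  then have "card ?K \<le> card ({1..<n} - nonroot n p2)" unfolding fK .
  also have "\<dots> = n - 1 - card (nonroot n p2)" by (subst card_Diff_subset) (auto simp: nonroot_def)
  \<comment> \<open>The lost root edges alone already reach the bound on all lost edges.\<close>
  finally have "card (?R - ?E') \<ge> excess" using cR cardK le pos by linarith
  then have "?R - ?E' = ?E1 - ?E'"
    using lost R1 fin by (intro card_seteq) (simp_all, blast)
  then have inE': "{p1 v, v} \<in> ?E'" if "v \<in> nonroot n p1" for v
  proof -
    have v: "{p1 v, v} \<in> ?E1" using that by (auto simp: parent_edges_def nonroot_def)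
    have "{p1 v, v} \<notin> ?R"
    proof
      assume "{p1 v, v} \<in> ?R"
      then obtain w where w: "{p1 v, v} = {p1 w, w}" "w \<in> ?N" by (elim imageE)
      have "v \<in> {1..}" "w \<in> {1..}" using that w(2) by (simp_all add: nonroot_def)
      then have "v = w" using P1.parent_edge_inj w(1) unfolding inj_on_def by blast
      then show False using w that by simp
    qed
    then show ?thesis using v \<open>?R - ?E' = ?E1 - ?E'\<close> by blast
  qed
  show thesis
  proof (rule that[of f ?W, OF inj zW f0])
    fix v assume v: "v \<in> nonroot n p1"
    then have "v \<in> ?W" "p1 v \<in> ?W" using sub'(1)[OF inE'[OF v]] by simp_all
    then show "v \<in> ?W \<and> p1 v \<in> ?W \<and> {f (p1 v), f v} \<in> parent_edges n p2"
      using adj inE'[OF v] by simp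
  qed
qed

end

section \<open>Exact cover and pairs of trees\<close>

text \<open>
  Vertices in order: the root 0, \<open>m\<close> centers, \<open>m * s\<close> hubs, \<open>H\<close> leaf positions for each hub, and
  spare leaves. The first \<open>M * s\<close> hubs are children of the centers, \<open>s\<close> for each; all other hubs are
  children of the root. Hub \<open>h\<close> has \<open>cd h\<close> leaves, and unused leaf positions are children of the
  root.
\<close>

definition layout_parent :: "nat \<Rightarrow> nat \<Rightarrow> nat \<Rightarrow> nat \<Rightarrow> (nat \<Rightarrow> nat) \<Rightarrow> nat \<Rightarrow> nat" where
  "layout_parent m s H M cd v =
    (if v < 1 + m then 0
     else if v < 1 + m + m * s then (if v - (1 + m) < M * s then 1 + (v - (1 + m)) div s else 0)
     else if v < 1 + m + m * s + m * s * H \<and>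
         (v - (1 + m + m * s)) mod H < cd ((v - (1 + m + m * s)) div H)
       then 1 + m + (v - (1 + m + m * s)) div H
     else 0)"

locale layout =
  fixes m s H L :: nat
  assumes s_pos: "s > 0" and H_pos: "H > 0"
begin

definition hub :: "nat \<Rightarrow> nat" where "hub h = 1 + m + h"
definition leaf :: "nat \<Rightarrow> nat \<Rightarrow> nat" where "leaf h q = 1 + m + m * s + (h * H + q)"
definition size :: nat where "size = 1 + m + m * s + m * s * H + L"

lemma flat_less: "h < a \<Longrightarrow> q < H \<Longrightarrow> h * H + q < a * H"
  by (metis Suc_leI add.commute less_le_trans mult_Suc mult_le_mono1 nat_add_left_cancel_less)

lemma hub_less: "h < m * s \<Longrightarrow> hub h < size" "h < m * s \<Longrightarrow> m < hub h"
  by (auto simp: hub_def size_def)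

lemma leaf_less: "h < m * s \<Longrightarrow> q < H \<Longrightarrow> leaf h q < 1 + m + m * s + m * s * H"
  using flat_less[of h "m * s" q] by (simp add: leaf_def)

lemma leaf_div_mod: "q < H \<Longrightarrow> (h * H + q) div H = h" "q < H \<Longrightarrow> (h * H + q) mod H = q"
  by simp_all

lemma vertex_cases:
  obtains (center) "v \<le> m" | (hub) h where "h < m * s" "v = hub h"
    | (leaf) h q where "h < m * s" "q < H" "v = leaf h q"
    | (spare) "1 + m + m * s + m * s * H \<le> v"
proof -
  consider "v \<le> m" | "m < v" "v < 1 + m + m * s"
    | "1 + m + m * s \<le> v" "v < 1 + m + m * s + m * s * H" | "1 + m + m * s + m * s * H \<le> v"
    by linarith
  then show thesis
  proof cases
    case 2
    then show thesis by (intro hub[of "v - (1 + m)"]) (auto simp: hub_def)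
  next
    case 3
    let ?l = "v - (1 + m + m * s)"
    have "?l < m * s * H" using 3 by linarith
    then have "?l div H < m * s" by (simp add: less_mult_imp_div_less)
    moreover have "v = leaf (?l div H) (?l mod H)" using 3(1) by (simp add: leaf_def)
    ultimately show thesis using leaf[of "?l div H" "?l mod H"] H_pos by simp
  qed (fact center spare)+
qed

end

locale layout_tree = layout +
  fixes M :: nat and cd :: "nat \<Rightarrow> nat"
  assumes M_le: "M \<le> m" and cd_le: "\<And>h. h < m * s \<Longrightarrow> cd h \<le> H"
begin

abbreviation par :: "nat \<Rightarrow> nat" where "par \<equiv> layout_parent m s H M cd"

lemma par_center: "v \<le> m \<Longrightarrow> par v = 0"
  by (simp add: layout_parent_def)

lemma par_hub: "h < m * s \<Longrightarrow> par (hub h) = (if h < M * s then 1 + h div s else 0)"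
  by (simp add: layout_parent_def hub_def)

lemma par_leaf: "h < m * s \<Longrightarrow> q < H \<Longrightarrow> par (leaf h q) = (if q < cd h then hub h else 0)"
  using flat_less[of h "m * s" q] leaf_div_mod[of q h]
  by (simp add: layout_parent_def leaf_def hub_def)

lemma par_spare: "1 + m + m * s + m * s * H \<le> v \<Longrightarrow> par v = 0"
  by (simp add: layout_parent_def)

lemma par_cases:
  assumes "par v \<noteq> 0"
  obtains (hub) h where "h < M * s" "v = hub h" "par v = 1 + h div s" "h div s < M"
    | (leaf) h q where "h < m * s" "q < cd h" "q < H" "v = leaf h q" "par v = hub h"
  using vertex_cases[of v]
proof cases
  case (hub h)
  then have "h < M * s" using assms par_hub[of h] by (auto split: if_splits)
  then show ?thesis using that(1)[of h] hub par_hub[of h] by (simp add: less_mult_imp_div_less)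
next
  case (leaf h q)
  then have "q < cd h" using assms par_leaf[of h q] by (auto split: if_splits)
  then show ?thesis using that(2)[of h q] leaf par_leaf[of h q] by simp
qed (use assms par_center par_spare in auto)

lemma Ms_le: "M * s \<le> m * s" using M_le by simp

sublocale parent_function size par
proof
  show "size > 0" by (simp add: size_def)
  fix v :: nat assume v: "v > 0"
  show "par v < v"
  proof (cases "par v = 0")
    case False
    then show ?thesis
    proof (cases rule: par_cases)
      case (hub h)
      then have "h div s < m" using M_le by simp
      then show ?thesis using hub by (simp add: hub_def)
    next
      case (leaf h q)
      then show ?thesis by (simp add: leaf_def hub_def)
    qed
  qed (use v in simp)
qed

lemma nonroot_layout:
  "nonroot size par = hub ` {..<M * s} \<union> (\<lambda>(h, q). leaf h q) ` (SIGMA h:{..<m * s}. {..<cd h})"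
proof (intro equalityI subsetI)
  fix v assume "v \<in> nonroot size par"
  then have "par v \<noteq> 0" by (simp add: nonroot_def)
  then show "v \<in> hub ` {..<M * s} \<union> (\<lambda>(h, q). leaf h q) ` (SIGMA h:{..<m * s}. {..<cd h})"
    by (cases rule: par_cases) auto
next
  fix v assume "v \<in> hub ` {..<M * s} \<union> (\<lambda>(h, q). leaf h q) ` (SIGMA h:{..<m * s}. {..<cd h})"
  then consider h where "h < M * s" "v = hub h" | h q where "h < m * s" "q < cd h" "v = leaf h q" by auto
  then show "v \<in> nonroot size par"
  proof cases
    case 1
    then have "h < m * s" using Ms_le by (blast intro: less_le_trans)
    then show ?thesis using 1 par_hub hub_less[of h] by (simp add: nonroot_def)
  next
    case 2
    then have "q < H" using cd_le by (meson less_le_trans)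
    then show ?thesis using 2 par_leaf leaf_less[of h q] by (simp add: nonroot_def size_def hub_def leaf_def)
  qed
qed

lemma inj_hub: "inj_on hub A" by (auto simp: inj_on_def hub_def)

lemma leaf_eq_iff: "q < H \<Longrightarrow> q' < H \<Longrightarrow> leaf h q = leaf h' q' \<longleftrightarrow> h = h' \<and> q = q'"
  by (metis add_left_cancel leaf_def leaf_div_mod)

lemma card_nonroot: "card (nonroot size par) = M * s + (\<Sum>h<m * s. cd h)"
proof -
  have 1: "card (hub ` {..<M * s}) = M * s" by (simp add: card_image inj_hub)
  let ?S = "SIGMA h:{..<m * s}. {..<cd h}"
  have "inj_on (\<lambda>(h, q). leaf h q) ?S"
  proof (rule inj_onI)
    fix x y assume x: "x \<in> ?S" and y: "y \<in> ?S" and e: "(\<lambda>(h, q). leaf h q) x = (\<lambda>(h, q). leaf h q) y"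
    have "snd z < H" if "z \<in> ?S" for z using that cd_le[of "fst z"] by auto
    then have "snd x < H" "snd y < H" using x y by blast+
    then show "x = y" using e leaf_eq_iff[of "snd x" "snd y" "fst x" "fst y"]
      by (simp add: case_prod_beta prod_eq_iff)
  qed
  then have 2: "card ((\<lambda>(h, q). leaf h q) ` ?S) = (\<Sum>h<m * s. cd h)" by (simp add: card_image)
  have "hub ` {..<M * s} \<inter> (\<lambda>(h, q). leaf h q) ` ?S = {}"
  proof -
    have "hub h < leaf h' q" if "h < M * s" for h h' q
      using that Ms_le unfolding hub_def leaf_def by linarith
    then show ?thesis by (fastforce simp: disjoint_iff)
  qed
  then show ?thesis unfolding nonroot_layout using 1 2 by (subst card_Un_disjoint) auto
qed

lemma children_of_center:
  assumes "0 < v" "v \<le> m"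
  shows "card {w \<in> {1..<size}. par w = v} \<le> s"
proof -
  have "{w \<in> {1..<size}. par w = v} \<subseteq> hub ` {(v - 1) * s..<(v - 1) * s + s}"
  proof (rule subsetI)
    fix w assume "w \<in> {w \<in> {1..<size}. par w = v}"
    then have pw: "par w = v" by simp
    then have "par w \<noteq> 0" using assms by simp
    then show "w \<in> hub ` {(v - 1) * s..<(v - 1) * s + s}"
    proof (cases rule: par_cases)
      case (hub h)
      then have "h div s = v - 1" using pw by simp
      then have "(v - 1) * s \<le> h" "h < (v - 1) * s + s"
        using div_times_less_eq_dividend[of h s] dividend_less_div_times[OF s_pos, of h] by auto
      then show ?thesis using hub(2) by simp
    next
      case (leaf h q)
      then show ?thesis using pw assms by (simp add: hub_def)
    qed
  qed
  then have "card {w \<in> {1..<size}. par w = v} \<le> card (hub ` {(v - 1) * s..<(v - 1) * s + s})"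
    by (intro card_mono) simp_all
  also have "\<dots> \<le> s" using card_image_le[of "{(v - 1) * s..<(v - 1) * s + s}" hub] by simp
  finally show ?thesis .
qed

lemma children_of_hub:
  assumes "h < m * s"
  shows "card {w \<in> {1..<size}. par w = hub h} \<le> cd h"
proof -
  have "{w \<in> {1..<size}. par w = hub h} \<subseteq> leaf h ` {..<cd h}"
  proof (rule subsetI)
    fix w assume "w \<in> {w \<in> {1..<size}. par w = hub h}"
    then have pw: "par w = hub h" by simp
    then have "par w \<noteq> 0" by (simp add: hub_def)
    then show "w \<in> leaf h ` {..<cd h}"
    proof (cases rule: par_cases)
      case (hub h')
      then show ?thesis using pw M_le by (simp add: hub_def)
    next
      case (leaf h' q)
      then have "h' = h" using pw by (simp add: hub_def)
      then show ?thesis using leaf by simp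
    qed
  qed
  then have "card {w \<in> {1..<size}. par w = hub h} \<le> card (leaf h ` {..<cd h})"
    by (intro card_mono) simp_all
  also have "\<dots> \<le> cd h" using card_image_le[of "{..<cd h}" "leaf h"] by simp
  finally show ?thesis .
qed

lemma no_children:
  assumes "1 + m + m * s \<le> v"
  shows "{w \<in> {1..<size}. par w = v} = {}"
proof -
  have "par w \<noteq> v" for w
  proof
    assume pw: "par w = v"
    then have "par w \<noteq> 0" using assms by simp
    then show False
    proof (cases rule: par_cases)
      case (hub h)
      then show ?thesis using pw assms M_le by simp
    next
      case (leaf h q)
      then show ?thesis using pw assms by (simp add: hub_def)
    qed
  qed
  then show ?thesis by simp
qed

lemma children_le:
  assumes "0 < v"
  shows "card {w \<in> {1..<size}. par w = v} \<le> s + H"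
  using vertex_cases[of v]
proof cases
  case center
  then show ?thesis using children_of_center[OF assms] by simp
next
  case (hub h)
  then show ?thesis using children_of_hub[of h] cd_le[of h] by simp
next
  case (leaf h q)
  then have "1 + m + m * s \<le> v" by (simp add: leaf_def)
  from no_children[OF this] show ?thesis by (simp only: card.empty)
next
  case spare
  then have "1 + m + m * s \<le> v" by simp
  from no_children[OF this] show ?thesis by (simp only: card.empty)
qed

end

section \<open>Sums over blocks of slots\<close>

lemma sum_lessThan_split: "(\<Sum>h<a + n. g h) = (\<Sum>h<a. g h) + (\<Sum>u<n. g (a + u))" for g :: "nat \<Rightarrow> nat"
  by (induction n) (simp_all add: add.assoc)

lemma double_sum_lessThan: "2 * (\<Sum>u<n. u) = n * (n - 1)" for n :: nat
proof (induction n)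
  case (Suc n)
  then show ?case by (cases n) simp_all
qed simp

lemma div_eq_iff_interval:
  assumes "(s :: nat) > 0"
  shows "h div s = j \<longleftrightarrow> j * s \<le> h \<and> h < j * s + s"
proof
  assume "h div s = j"
  then show "j * s \<le> h \<and> h < j * s + s"
    using div_times_less_eq_dividend[of h s] dividend_less_div_times[OF assms, of h] by auto
next
  assume "j * s \<le> h \<and> h < j * s + s"
  then show "h div s = j" by (intro div_nat_eqI) (simp_all add: mult.commute)
qed

lemma interval_eq_div: "s > 0 \<Longrightarrow> {j * s..<j * s + s} = {h :: nat. h div s = j}"
  by (auto simp: div_eq_iff_interval)

text \<open>As a preimage under \<open>div\<close>, rather than a union of intervals, it commutes
  with unions and preserves disjointness at once.\<close>

definition slots :: "nat \<Rightarrow> nat set \<Rightarrow> nat set" where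
  "slots s S = {h. h div s \<in> S}"

lemma sum_slots:
  fixes g :: "nat \<Rightarrow> nat"
  assumes "s > 0" "finite S"
  shows "sum g (slots s S) = (\<Sum>j\<in>S. \<Sum>h=j * s..<j * s + s. g h)"
proof -
  have "slots s S = (\<Union>j\<in>S. {j * s..<j * s + s})"
    unfolding slots_def interval_eq_div[OF assms(1)] by auto
  moreover have "{i * s..<i * s + s} \<inter> {j * s..<j * s + s} = {}" if "i \<noteq> j" for i j
    unfolding interval_eq_div[OF assms(1)] using that by auto
  ultimately show ?thesis using assms(2) by (simp add: sum.UNION_disjoint)
qed

lemma slots_Un: "slots s (A \<union> B) = slots s A \<union> slots s B"
  by (auto simp: slots_def)

lemma slots_disjoint: "A \<inter> B = {} \<Longrightarrow> slots s A \<inter> slots s B = {}"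
  by (auto simp: slots_def)

lemma finite_slots: "s > 0 \<Longrightarrow> finite S \<Longrightarrow> finite (slots s S)"
proof -
  assume s: "s > 0" and S: "finite S"
  have "slots s S = (\<Union>j\<in>S. {j * s..<j * s + s})"
    unfolding slots_def interval_eq_div[OF s] by auto
  then show "finite (slots s S)" using S by simp
qed

lemma card_slots: "s > 0 \<Longrightarrow> finite S \<Longrightarrow> card (slots s S) = card S * s"
  using sum_slots[of s S "\<lambda>_. 1"] by simp

lemma slots_lessThan: "s > 0 \<Longrightarrow> slots s {..<m} = {..<m * s}"
  by (auto simp: slots_def less_mult_imp_div_less div_less_iff_less_mult)

text \<open>
  Option \<open>j < m\<close> consists of the elements \<open>el h\<close> for the slots \<open>h\<close> with \<open>h div s = j\<close>.
\<close>

locale cover_system =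
  fixes m s N :: nat and el :: "nat \<Rightarrow> nat"
  assumes s_ge: "s \<ge> 2" and N_le: "N \<le> m"
    and el_less: "\<And>h. h < m * s \<Longrightarrow> el h < s * N"
    and balanced: "\<And>j. j < m \<Longrightarrow> 2 * (\<Sum>h=j * s..<j * s + s. el h) = s * (s * N - 1)"
begin

text \<open>\<open>N\<close> options have \<open>s * N\<close> slots, as many as there are elements,
  so injectivity alone means that every element is covered exactly once.\<close>

definition exact_cover :: bool where
  "exact_cover \<longleftrightarrow> (\<exists>S\<subseteq>{..<m}. card S = N \<and> inj_on el (slots s S))"

abbreviation n :: nat where "n \<equiv> s * N"
text \<open>A center of the second tree has at most \<open>s\<close> children besides its parent, so
  a hub with at least \<open>s + 2\<close> leaves cannot be mapped to a center.\<close>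

definition D :: nat where "D = s + 2"
definition H :: nat where "H = D + 2 * n"
text \<open>By \<open>children_le\<close>, a vertex other than the root has at most
  \<open>s + H\<close> children; the spare leaves give the root the margin that
  \<open>ged_parent_graph_embedding\<close> asks for.\<close>

definition L :: nat where "L = s + H + 2"
abbreviation (input) a :: nat where "a \<equiv> (m - N) * s"

text \<open>Hubs below \<open>a\<close> belong to the blocking centers and are small enough for
  every hub of the second tree. Hub \<open>a + u\<close> is loose and stands for element
  \<open>u\<close>.\<close>

definition leaves1 :: "nat \<Rightarrow> nat" where
  "leaves1 h = (if h < a then D else D + 2 * (h - a))"
definition leaves2 :: "nat \<Rightarrow> nat" where
  "leaves2 h = D + 2 * el h"

lemma s_pos: "s > 0" using s_ge by simp

lemma a_plus_n: "a + n = m * s"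
  using N_le by (metis add_mult_distrib le_add_diff_inverse2 mult.commute)

sublocale layout m s H L
  by unfold_locales (use s_pos in \<open>simp_all add: H_def D_def\<close>)

sublocale T1: layout_tree m s H L "m - N" leaves1
proof
  fix h assume "h < m * s"
  then have "h - a < n \<or> h < a" using a_plus_n by linarith
  then show "leaves1 h \<le> H" by (auto simp: leaves1_def H_def)
qed simp

sublocale T2: layout_tree m s H L m leaves2
proof
  fix h assume "h < m * s"
  from el_less[OF this] show "leaves2 h \<le> H" by (simp add: leaves2_def H_def)
qed simp

abbreviation par1 :: "nat \<Rightarrow> nat" where "par1 \<equiv> layout_parent m s H (m - N) leaves1"
abbreviation par2 :: "nat \<Rightarrow> nat" where "par2 \<equiv> layout_parent m s H m leaves2"

sublocale parent_pair size par1 par2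
  by unfold_locales

lemma sum_el: "S \<subseteq> {..<m} \<Longrightarrow> 2 * sum el (slots s S) = card S * (s * (n - 1))"
proof -
  assume S: "S \<subseteq> {..<m}"
  then have "finite S" by (rule finite_subset) simp
  then have "2 * sum el (slots s S) = (\<Sum>j\<in>S. 2 * (\<Sum>h=j * s..<j * s + s. el h))"
    using s_pos by (simp add: sum_slots sum_distrib_left)
  also have "\<dots> = (\<Sum>j\<in>S. s * (n - 1))" using S by (intro sum.cong refl balanced) blast
  finally show ?thesis by simp
qed

lemma sum_leaves1: "(\<Sum>h<m * s. leaves1 h) = m * s * D + n * (n - 1)"
proof -
  have "(\<Sum>h<m * s. leaves1 h) = (\<Sum>h<a. leaves1 h) + (\<Sum>u<n. leaves1 (a + u))"
    unfolding a_plus_n[symmetric] by (rule sum_lessThan_split)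
  also have "(\<Sum>h<a. leaves1 h) = a * D" by (simp add: leaves1_def)
  also have "(\<Sum>u<n. leaves1 (a + u)) = n * D + 2 * (\<Sum>u<n. u)"
    by (simp add: leaves1_def sum.distrib sum_distrib_left)
  also have "2 * (\<Sum>u<n. u) = n * (n - 1)" by (rule double_sum_lessThan)
  also have "a * D + (n * D + n * (n - 1)) = (a + n) * D + n * (n - 1)" by (simp only: add_mult_distrib)
  finally show ?thesis unfolding a_plus_n .
qed

lemma sum_leaves2: "(\<Sum>h<m * s. leaves2 h) = m * s * D + m * s * (n - 1)"
proof -
  have "(\<Sum>h<m * s. leaves2 h) = m * s * D + 2 * (\<Sum>h<m * s. el h)"
    by (simp add: leaves2_def sum.distrib sum_distrib_left)
  moreover have "2 * (\<Sum>h<m * s. el h) = m * (s * (n - 1))"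
    using sum_el[of "{..<m}"] s_pos by (simp add: slots_lessThan)
  ultimately show ?thesis by (simp only: mult.assoc)
qed

text \<open>The excess in closed form: \<open>n\<close> loose hubs lack an edge to a center, and the
  rest is the difference of the leaf totals. Balance makes it independent of
  \<open>el\<close>.\<close>

definition surplus :: nat where "surplus = n + (m * s - n) * (n - 1)"

lemma nonroot_counts:
  "card (nonroot size par2) = card (nonroot size par1) + surplus"
proof -
  have "m * s * (n - 1) = n * (n - 1) + (m * s - n) * (n - 1)"
    using a_plus_n by (metis add_diff_cancel_right' add.commute add_mult_distrib)
  moreover have "m * s = a + n" using a_plus_n by simp
  ultimately show ?thesis
    unfolding T1.card_nonroot T2.card_nonroot sum_leaves1 sum_leaves2 surplus_def by linarith
qed

lemma excess: "excess = surplus" using nonroot_counts by simp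

section \<open>From exact covers to cheap edit paths\<close>

text \<open>
  An exact cover permutes the options (selected ones last) and the slots, which extends to the
  vertices.
\<close>

definition relabel :: "(nat \<Rightarrow> nat) \<Rightarrow> (nat \<Rightarrow> nat) \<Rightarrow> nat \<Rightarrow> nat" where
  "relabel f g v =
    (if v = 0 then 0
     else if v < 1 + m then 1 + f (v - 1)
     else if v < 1 + m + m * s then hub (g (v - (1 + m)))
     else if v < 1 + m + m * s + m * s * H
       then leaf (g ((v - (1 + m + m * s)) div H)) ((v - (1 + m + m * s)) mod H)
     else v)"

lemma relabel_simps:
  "relabel f g 0 = 0"
  "j < m \<Longrightarrow> relabel f g (1 + j) = 1 + f j"
  "h < m * s \<Longrightarrow> relabel f g (hub h) = hub (g h)"
  "h < m * s \<Longrightarrow> q < H \<Longrightarrow> relabel f g (leaf h q) = leaf (g h) q"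
  "1 + m + m * s + m * s * H \<le> v \<Longrightarrow> relabel f g v = v"
proof -
  show "relabel f g (leaf h q) = leaf (g h) q" if "h < m * s" "q < H"
    using that flat_less[of h "m * s" q] leaf_div_mod[of q h] unfolding relabel_def leaf_def by simp
qed (simp_all add: relabel_def hub_def)

lemma relabel_inverse:
  assumes "\<And>j. j < m \<Longrightarrow> f j < m \<and> f' (f j) = j" "\<And>h. h < m * s \<Longrightarrow> g h < m * s \<and> g' (g h) = h" "v < size"
  shows "relabel f' g' (relabel f g v) = v \<and> relabel f g v < size"
  using vertex_cases[of v]
proof cases
  case center
  show ?thesis
  proof (cases v)
    case 0
    then show ?thesis using assms(3) by (simp add: relabel_simps)
  next
    case (Suc j)
    then have "v = 1 + j" "j < m" using center by simp_all
    then show ?thesis using assms(1)[of j] by (simp only: relabel_simps) (simp add: size_def)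
  qed
next
  case (hub h)
  then show ?thesis using assms(2)[of h] hub_less by (simp add: relabel_simps)
next
  case (leaf h q)
  then have "relabel f g v = leaf (g h) q" by (simp only: relabel_simps)
  then show ?thesis using leaf assms(2)[of h] leaf_less[of "g h" q]
    by (simp only: relabel_simps) (simp add: size_def)
next
  case spare
  then show ?thesis using assms(3) by (simp only: relabel_simps)
qed

lemma exact_cover_imp_ged:
  assumes exact_cover
  shows "ged (parent_graph c size par1) (parent_graph c size par2) C_E \<le> of_nat (2 * surplus)"
proof -
  obtain S where S: "S \<subseteq> {..<m}" "card S = N" "inj_on el (slots s S)"
    using assms unfolding exact_cover_def by blast
  have finS: "finite S" using S(1) by (rule finite_subset) simp
  let ?B = "{..<m} - S"
  have cardB: "card ?B = m - N" using S finS by (simp add: card_Diff_subset)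
  \<comment> \<open>Blocking centers go to the options outside \<open>S\<close>. The other centers
    of the first tree carry no hubs, and \<open>f1\<close> merely completes the permutation.\<close>
  obtain f0 where f0: "bij_betw f0 {..<m - N} ?B"
    using finite_same_card_bij[of "{..<m - N}" ?B] cardB by auto
  obtain f1 where f1: "bij_betw f1 {m - N..<m} S"
    using finite_same_card_bij[of "{m - N..<m}" S] S(2) finS N_le by auto
  define f where "f j = (if j < m - N then f0 j else f1 j)" for j
  have "bij_betw f {..<m - N} ?B"
    using f0 by (rule bij_betw_cong[THEN iffD1, rotated]) (simp add: f_def)
  moreover have "bij_betw f {m - N..<m} S"
    using f1 by (rule bij_betw_cong[THEN iffD1, rotated]) (simp add: f_def)
  ultimately have "bij_betw f ({..<m - N} \<union> {m - N..<m}) (?B \<union> S)"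
    by (rule bij_betw_combine) blast
  moreover have "{..<m - N} \<union> {m - N..<m} = {..<m}" by (rule ivl_disj_un_one(2)) simp
  moreover have "?B \<union> S = {..<m}" using S(1) by blast
  ultimately have f: "bij_betw f {..<m} {..<m}" by simp
  have fB: "f j \<in> ?B" if "j < m - N" for j
    using bij_betwE[OF f0] that by (simp add: f_def)
  have slots_S: "slots s S \<subseteq> {..<m * s}"
    using S(1) s_pos by (auto simp: slots_lessThan[symmetric] slots_def)
  have el_bij: "bij_betw el (slots s S) {..<n}"
  proof -
    have sub: "el ` slots s S \<subseteq> {..<n}" using slots_S el_less by auto
    have "card (el ` slots s S) = card {..<n}"
      using card_image[OF S(3)] card_slots[OF s_pos finS] S(2) by (simp add: mult.commute)
    then have "el ` slots s S = {..<n}" using sub by (intro card_subset_eq) simp_all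
    then show ?thesis using S(3) by (simp add: bij_betw_def)
  qed
  \<comment> \<open>\<open>e u\<close> is the selected slot that covers element
    \<open>u\<close>.\<close>
  define e where "e = inv_into (slots s S) el"
  have e: "bij_betw e {..<n} (slots s S)" unfolding e_def by (rule bij_betw_inv_into[OF el_bij])
  have el_e: "el (e u) = u" if "u < n" for u
    unfolding e_def by (rule bij_betw_inv_into_right[OF el_bij]) (use that in simp)
  \<comment> \<open>Hubs of a blocking center follow it and keep their place \<open>h mod s\<close>;
    the loose hub \<open>a + u\<close> goes to the slot covering \<open>u\<close>.\<close>
  define g where "g h = (if h < a then f (h div s) * s + h mod s else e (h - a))" for h
  have g_div: "g h div s = f (h div s)" if "h < a" for h
    using that s_pos by (simp add: g_def)
  have div_less: "h div s < m - N" if "h < a" for h using that by (rule less_mult_imp_div_less)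
  have g_less: "g h < m * s" if "h < m * s" for h
  proof (cases "h < a")
    case True
    then have "g h div s < m" using g_div fB[OF div_less] by simp
    then show ?thesis using s_pos by (simp add: div_less_iff_less_mult)
  next
    case False
    then have "h - a < n" using that a_plus_n by linarith
    then have "g h \<in> slots s S" using bij_betwE[OF e] False by (simp add: g_def)
    then show ?thesis using slots_S by blast
  qed
  have g_inj: "inj_on g {..<m * s}"
  proof (rule inj_onI)
    fix h h' assume h: "h \<in> {..<m * s}" "h' \<in> {..<m * s}" and eq: "g h = g h'"
    have mixed: False if "x < a" "\<not> y < a" "y < m * s" "g x = g y" for x y
    proof -
      have "y - a < n" using that a_plus_n by linarith
      then have "g y div s \<in> S" using bij_betwE[OF e] that by (simp add: g_def slots_def)
      then show False using g_div[OF that(1)] fB[OF div_less[OF that(1)]] that(4) by simp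
    qed
    consider "h < a" "h' < a" | "\<not> h < a" "\<not> h' < a"
      using mixed[of h h'] mixed[of h' h] h eq by fastforce
    then show "h = h'"
    proof cases
      case 1
      have "f (h div s) = f (h' div s)" using eq g_div[OF 1(1)] g_div[OF 1(2)] by simp
      then have d: "h div s = h' div s"
        using bij_betw_imp_inj_on[OF f] div_less[OF 1(1)] div_less[OF 1(2)]
        by (auto simp: inj_on_def)
      have "g h mod s = g h' mod s" using eq by simp
      then have "h mod s = h' mod s" using 1 s_pos by (simp add: g_def)
      then show ?thesis using d by (metis div_mult_mod_eq)
    next
      case 2
      then have "e (h - a) = e (h' - a)" using eq by (simp add: g_def)
      moreover have "h - a < n" "h' - a < n" using h 2 a_plus_n by auto
      ultimately have "h - a = h' - a" using el_e by metis
      then show ?thesis using 2 by linarith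
    qed
  qed
  have g: "bij_betw g {..<m * s} {..<m * s}"
    unfolding bij_betw_def using g_inj endo_inj_surj[OF finite_lessThan _ g_inj] g_less by blast
  have fw: "relabel (inv_into {..<m} f) (inv_into {..<m * s} g) (relabel f g v) = v \<and> relabel f g v < size"
    if "v < size" for v
    by (rule relabel_inverse) (use that f g bij_betwE[OF f] bij_betwE[OF g] in \<open>auto simp: bij_betw_inv_into_left\<close>)
  have inj: "inj_on (relabel f g) {..<size}"
    by (rule inj_on_inverseI[of _ "relabel (inv_into {..<m} f) (inv_into {..<m * s} g)"]) (use fw in simp)
  have bij: "bij_betw (relabel f g) {..<size} {..<size}"
    unfolding bij_betw_def using inj endo_inj_surj[OF finite_lessThan _ inj] fw by blast
  have "ged (parent_graph c size par1) (parent_graph c size par2) C_E \<le> of_nat (2 * excess)"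
  proof (rule ged_parent_graph_le[OF bij])
    show "relabel f g 0 = 0" by (rule relabel_simps)
    fix v assume "par1 v \<noteq> 0"
    then show "par2 (relabel f g v) = relabel f g (par1 v)"
    proof (cases rule: T1.par_cases)
      case (hub h)
      have h: "h < m * s" using hub(1) T1.Ms_le by (rule less_le_trans)
      have "par2 (relabel f g v) = par2 (layout.hub m (g h))" unfolding hub(2) relabel_simps(3)[OF h] ..
      also have "\<dots> = 1 + g h div s" using T2.par_hub[OF g_less[OF h]] g_less[OF h] by simp
      also have "\<dots> = 1 + f (h div s)" using g_div[OF hub(1)] by simp
      also have "\<dots> = relabel f g (par1 v)"
        unfolding hub(3) using hub(4) by (intro relabel_simps(2)[symmetric]) simp
      finally show ?thesis .
    next
      case (leaf h q)
      \<comment> \<open>Loose hubs have equality here and blocking hubs have the minimum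
        \<open>D\<close>, so every leaf can keep its position.\<close>
      have "leaves1 h \<le> leaves2 (g h)"
      proof (cases "h < a")
        case False
        then have "h - a < n" using leaf(1) a_plus_n by linarith
        then show ?thesis using el_e False by (simp add: leaves1_def leaves2_def g_def)
      qed (simp add: leaves1_def leaves2_def)
      then have "q < leaves2 (g h)" using leaf(2) by simp
      then have "par2 (relabel f g v) = layout.hub m (g h)"
        unfolding leaf(4) relabel_simps(4)[OF leaf(1,3)] using T2.par_leaf[OF g_less[OF leaf(1)] leaf(3)] by simp
      then show ?thesis unfolding leaf(5) relabel_simps(3)[OF leaf(1)] .
    qed
  qed
  then show ?thesis unfolding excess .
qed

section \<open>From cheap edit paths to exact covers\<close>

lemma root_degree_dominates:
  assumes "v > 0"
  shows "card {w \<in> {1..<size}. par2 w = v} + 1 < size - 1 - card (nonroot size par2)"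
    and "card (nonroot size par2) < size - 1"
proof -
  have "(\<Sum>h<m * s. leaves2 h) \<le> (\<Sum>h<m * s. H)"
    by (intro sum_mono T2.cd_le) simp
  then have "(\<Sum>h<m * s. leaves2 h) \<le> m * s * H" by simp
  then have "card (nonroot size par2) + m + L \<le> size - 1"
    using T2.card_nonroot size_def by linarith
  moreover have "L = s + H + 2" by (rule L_def)
  ultimately show "card {w \<in> {1..<size}. par2 w = v} + 1 < size - 1 - card (nonroot size par2)"
    and "card (nonroot size par2) < size - 1"
    using T2.children_le[OF assms] by linarith+
qed

lemma neighbour_of_hub:
  assumes "h < m * s" "{layout.hub m h, y} \<in> parent_edges size par2"
  shows "y = 1 + h div s \<or> par2 y = layout.hub m h"
  using assms(2) T2.par_hub[OF assms(1)] assms(1) unfolding T2.parent_edge_iff by auto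

lemma ged_imp_exact_cover:
  fixes G1 G2 :: "'l lgraph"
  assumes G1: "simple_graph G1" "verts G1 = {..<size}" "edges G1 = parent_edges size par1"
    and G2: "simple_graph G2" "verts G2 = {..<size}" "edges G2 = parent_edges size par2"
    and ged: "ged G1 G2 C_E \<le> of_nat (2 * surplus)"
  shows exact_cover
proof -
  obtain f W where inj: "inj_on f W" and W0: "0 \<in> W" "f 0 = 0"
    and emb: "\<And>v. v \<in> nonroot size par1 \<Longrightarrow> v \<in> W \<and> par1 v \<in> W \<and> {f (par1 v), f v} \<in> parent_edges size par2"
    by (rule ged_parent_graph_embedding[OF G1 G2 ged[folded excess]])
      (use nonroot_counts root_degree_dominates in auto)
  have leaf1: "leaf h q \<in> W \<and> hub h \<in> W \<and> {f (hub h), f (leaf h q)} \<in> parent_edges size par2"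
    if "h < m * s" "q < leaves1 h" for h q
  proof -
    have q: "q < H" using that T1.cd_le[OF that(1)] by simp
    have "leaf h q \<in> nonroot size par1"
      using that q T1.par_leaf leaf_less[OF that(1) q] by (simp add: nonroot_def size_def hub_def leaf_def)
    from emb[OF this] show ?thesis using T1.par_leaf[OF that(1) q] that(2) by simp
  qed
  have leaves1_ge: "leaves1 h \<ge> s + 2" for h by (simp add: leaves1_def D_def)
  have hubW: "hub h \<in> W" if "h < m * s" for h
    using leaf1[OF that, of 0] leaves1_ge[of h] by simp
  have f_nz: "f v \<noteq> 0" if "v \<in> W" "v \<noteq> 0" for v
    using inj W0 that by (metis inj_onD)
  \<comment> \<open>The image has at least \<open>leaves1 h\<close> neighbours, which excludes
    centers, leaf positions and spare leaves. The \<open>+ 1\<close> accounts for the parent of the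
    image hub, to which a leaf may be mapped.\<close>
  have hub_image: "\<exists>h'. h' < m * s \<and> f (hub h) = hub h' \<and> leaves1 h \<le> leaves2 h' + 1" if h: "h < m * s" for h
  proof -
    let ?x = "f (hub h)"
    have x0: "?x > 0" using f_nz[OF hubW[OF h]] by (simp add: hub_def)
    have "f ` leaf h ` {..<leaves1 h} \<subseteq> insert (par2 ?x) {w \<in> {1..<size}. par2 w = ?x}"
    proof (rule subsetI)
      fix w assume "w \<in> f ` leaf h ` {..<leaves1 h}"
      then obtain q where "q < leaves1 h" "w = f (leaf h q)" by auto
      then have "{?x, w} \<in> parent_edges size par2" using leaf1[OF h] by simp
      then have "w < size" "w > 0 \<and> ?x = par2 w \<or> w = par2 ?x"
        unfolding T2.parent_edge_iff by blast+
      then show "w \<in> insert (par2 ?x) {w \<in> {1..<size}. par2 w = ?x}" by auto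
    qed
    then have "card (f ` leaf h ` {..<leaves1 h}) \<le> card (insert (par2 ?x) {w \<in> {1..<size}. par2 w = ?x})"
      by (intro card_mono) simp_all
    also have "\<dots> \<le> card {w \<in> {1..<size}. par2 w = ?x} + 1" by (simp add: card_insert_if)
    also have "card (f ` leaf h ` {..<leaves1 h}) = leaves1 h"
    proof -
      have "inj_on (leaf h) {..<leaves1 h}" by (auto simp: inj_on_def leaf_def)
      moreover have "inj_on f (leaf h ` {..<leaves1 h})"
        by (rule inj_on_subset[OF inj]) (use leaf1[OF h] in auto)
      ultimately show ?thesis by (simp add: card_image)
    qed
    finally have deg: "leaves1 h \<le> card {w \<in> {1..<size}. par2 w = ?x} + 1" .
    show ?thesis
      using vertex_cases[of ?x]
    proof cases
      case center
      then show ?thesis using T2.children_of_center[OF x0] deg leaves1_ge[of h] by simp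
    next
      case (hub h')
      have "leaves1 h \<le> leaves2 h' + 1"
        using deg T2.children_of_hub[OF hub(1)] unfolding hub(2) by linarith
      then show ?thesis using hub by blast
    next
      case (leaf h' q)
      then have "1 + m + m * s \<le> ?x" by (simp add: leaf_def)
      from T2.no_children[OF this] show ?thesis using deg leaves1_ge[of h] by (simp only: card.empty)
    next
      case spare
      then have "1 + m + m * s \<le> ?x" by simp
      from T2.no_children[OF this] show ?thesis using deg leaves1_ge[of h] by (simp only: card.empty)
    qed
  qed
  define g where "g h = f (hub h) - (1 + m)" for h
  have g: "g h < m * s" "f (hub h) = hub (g h)" "leaves1 h \<le> leaves2 (g h) + 1" if "h < m * s" for h
    using hub_image[OF that] by (auto simp: g_def hub_def)
  have g_inj: "inj_on g {..<m * s}"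
  proof (rule inj_onI)
    fix h h' assume h: "h \<in> {..<m * s}" "h' \<in> {..<m * s}" and "g h = g h'"
    then have "f (hub h) = f (hub h')" using g(2) by simp
    then have "hub h = hub h'" by (rule inj_onD[OF inj]) (use h hubW in simp_all)
    then show "h = h'" by (simp add: hub_def)
  qed
  have g_surj: "g ` {..<m * s} = {..<m * s}"
    using endo_inj_surj[OF finite_lessThan _ g_inj] g(1) by blast
  \<comment> \<open>A blocking center has at least two hubs, with distinct images, and only a center
    is adjacent to two different hubs of the second tree. So all its hubs go to the option of that
    center.\<close>
  have blocker: "1 + k \<in> W \<and> f (1 + k) = 1 + g h div s" if h: "h < a" "h div s = k" for h k
  proof -
    have edge: "1 + k \<in> W \<and> {hub (g h), f (1 + k)} \<in> parent_edges size par2" if h: "h < a" "h div s = k" for h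
    proof -
      have hm: "h < m * s" using h(1) T1.Ms_le by (rule less_le_trans)
      have "hub h \<in> nonroot size par1"
        using hm h T1.par_hub[OF hm] hub_less[OF hm] by (simp add: nonroot_def)
      from emb[OF this] show ?thesis using T1.par_hub[OF hm] h g(2)[OF hm] by (simp add: insert_commute)
    qed
    \<comment> \<open>Another hub of the same center, which exists by \<open>s_ge\<close>.\<close>
    define h' where "h' = (if h = k * s then k * s + 1 else k * s)"
    have ks: "k * s \<le> h" "h < k * s + s" using h(2) div_eq_iff_interval[OF s_pos] by blast+
    have k: "k < m - N" using h less_mult_imp_div_less by blast
    then have "k * s + s \<le> a" by (metis Suc_leI add.commute mult_Suc mult_le_mono1)
    then have h': "h' < a" "h' div s = k" "h' \<noteq> h"
      using k s_ge ks div_eq_iff_interval[OF s_pos, of h' k] by (auto simp: h'_def)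
    have m: "h < m * s" "h' < m * s" using h(1) h'(1) T1.Ms_le by (blast intro: less_le_trans)+
    have ne: "g h \<noteq> g h'" using g_inj m h'(3) by (auto dest: inj_onD)
    let ?y = "f (1 + k)"
    have 1: "?y = 1 + g h div s \<or> par2 ?y = hub (g h)"
      by (rule neighbour_of_hub[OF g(1)[OF m(1)]]) (use edge[OF h] in simp)
    have 2: "?y = 1 + g h' div s \<or> par2 ?y = hub (g h')"
      by (rule neighbour_of_hub[OF g(1)[OF m(2)]]) (use edge[OF h'(1,2)] in simp)
    have "par2 ?y \<noteq> hub (g h)"
    proof
      assume p: "par2 ?y = hub (g h)"
      then have "par2 ?y \<noteq> hub (g h')" using ne by (simp add: hub_def)
      then have "?y = 1 + g h' div s" using 2 by blast
      moreover have "g h' div s < m" using g(1)[OF m(2)] by (simp add: less_mult_imp_div_less)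
      ultimately have "par2 ?y = 0" by (intro T2.par_center) simp
      then show False using p by (simp add: hub_def)
    qed
    then show ?thesis using 1 edge[OF h] by blast
  qed
  \<comment> \<open>The option that center \<open>k\<close> blocks, read off from its first
    hub.\<close>
  define b where "b k = g (k * s) div s" for k
  have first: "k * s < a" "k * s div s = k" if "k < m - N" for k using that s_pos by simp_all
  have f_center: "1 + k \<in> W" "f (1 + k) = 1 + b k" if "k < m - N" for k
    using blocker[OF first[OF that]] by (simp_all add: b_def)
  have g_block: "g h div s = b (h div s)" if "h < a" for h
  proof -
    have "h div s < m - N" using that by (rule less_mult_imp_div_less)
    then show ?thesis using blocker[OF that refl] f_center[of "h div s"] by simp
  qed
  have b_less: "b k < m" if "k < m - N" for k
  proof -
    have "k * s < m * s" using first(1)[OF that] T1.Ms_le by (rule less_le_trans)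
    then show ?thesis unfolding b_def using g(1) by (simp add: less_mult_imp_div_less)
  qed
  have b_inj: "inj_on b {..<m - N}"
  proof (rule inj_onI)
    fix k k' assume k: "k \<in> {..<m - N}" "k' \<in> {..<m - N}" and "b k = b k'"
    then have "f (1 + k) = f (1 + k')" using f_center(2) by simp
    then have "1 + k = 1 + k'" by (rule inj_onD[OF inj]) (use k f_center(1) in simp_all)
    then show "k = k'" by simp
  qed
  define S where "S = {..<m} - b ` {..<m - N}"
  have b_img: "b ` {..<m - N} \<subseteq> {..<m}" using b_less by auto
  have S: "S \<subseteq> {..<m}" by (auto simp: S_def)
  have cardS: "card S = N"
    unfolding S_def using b_img card_image[OF b_inj] N_le by (simp add: card_Diff_subset finite_subset)
  have finS: "finite S" by (simp add: S_def)
  have split: "{..<m * s} = {..<a} \<union> {a..<m * s}" using T1.Ms_le by (intro ivl_disj_un_one(2)[symmetric])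
  \<comment> \<open>The blocked options have exactly as many slots as there are blocking hubs, so
    these slots are used up and the loose hubs are left with the slots of \<open>S\<close>.\<close>
  have g1: "g ` {..<a} = slots s (b ` {..<m - N})"
  proof (rule card_subset_eq)
    show "finite (slots s (b ` {..<m - N}))" by (intro finite_slots s_pos) simp
    show "g ` {..<a} \<subseteq> slots s (b ` {..<m - N})"
      using g_block by (auto simp: slots_def less_mult_imp_div_less)
    have "card (g ` {..<a}) = card {..<a}"
      by (intro card_image inj_on_subset[OF g_inj] lessThan_subset_iff[THEN iffD2] T1.Ms_le)
    then show "card (g ` {..<a}) = card (slots s (b ` {..<m - N}))"
      unfolding card_slots[OF s_pos finite_imageI[OF finite_lessThan]] card_image[OF b_inj] card_lessThan .
  qed
  have g2: "g ` {..<a} \<inter> g ` {a..<m * s} = {}"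
  proof -
    have "{..<a} \<subseteq> {..<m * s}" "{a..<m * s} \<subseteq> {..<m * s}" unfolding split by (rule Un_upper1 Un_upper2)+
    then have "g ` ({..<a} \<inter> {a..<m * s}) = g ` {..<a} \<inter> g ` {a..<m * s}"
      by (rule inj_on_image_Int[OF g_inj])
    moreover have "{..<a} \<inter> {a..<m * s} = {}" by (rule ivl_disj_int_one(2))
    ultimately show ?thesis by (simp only: image_empty)
  qed
  have g3: "g ` {..<a} \<union> g ` {a..<m * s} = {..<m * s}"
    unfolding image_Un[symmetric] split[symmetric] by (rule g_surj)
  have g4: "{..<m * s} = slots s (b ` {..<m - N}) \<union> slots s S" "slots s (b ` {..<m - N}) \<inter> slots s S = {}"
  proof -
    have bS: "{..<m} = b ` {..<m - N} \<union> S" using b_img unfolding S_def by blast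
    show "{..<m * s} = slots s (b ` {..<m - N}) \<union> slots s S"
      unfolding slots_Un[symmetric] bS[symmetric] by (rule slots_lessThan[OF s_pos, symmetric])
    show "slots s (b ` {..<m - N}) \<inter> slots s S = {}"
      by (rule slots_disjoint) (simp only: S_def Diff_disjoint)
  qed
  have "Q = R" if "A \<inter> Q = {}" "A \<union> Q = A \<union> R" "A \<inter> R = {}" for A Q R :: "nat set"
    using that by blast
  from this[OF g2 _ g4(2)[folded g1]] have g_elem: "g ` {a..<m * s} = slots s S"
    unfolding g3 by (simp only: g1 g4(1)[symmetric])
  have "(\<lambda>u. a + u) ` {..<n} = {a..<m * s}"
    unfolding a_plus_n[symmetric] lessThan_atLeast0 image_add_atLeastLessThan by (simp add: add.commute)
  then have gu: "(\<lambda>u. g (a + u)) ` {..<n} = slots s S"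
    using g_elem image_image[of g "\<lambda>u. a + u" "{..<n}"] by simp
  have gu_inj: "inj_on (\<lambda>u. g (a + u)) {..<n}"
  proof (rule inj_onI)
    fix u v assume u: "u \<in> {..<n}" "v \<in> {..<n}" and "g (a + u) = g (a + v)"
    moreover from u have "a + u < m * s" "a + v < m * s" using a_plus_n by auto
    ultimately have "a + u = a + v" by (intro inj_onD[OF g_inj, of "a + u" "a + v"]) simp_all
    then show "u = v" by simp
  qed
  \<comment> \<open>\<open>D + 2 * u \<le> D + 2 * el (g (a + u)) + 1\<close>, and parity removes
    the extra 1.\<close>
  have el_ge: "u \<le> el (g (a + u))" if "u < n" for u
  proof -
    have "a + u < m * s" using that a_plus_n by linarith
    from g(3)[OF this] show ?thesis by (simp add: leaves1_def leaves2_def)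
  qed
  \<comment> \<open>The options in \<open>S\<close> together weigh as much as all elements, so the
    inequalities \<open>el_ge\<close> add up to an equality and hold with equality one by
    one.\<close>
  have "2 * (\<Sum>u<n. el (g (a + u))) = 2 * sum el (slots s S)"
    unfolding gu[symmetric] by (simp add: sum.reindex[OF gu_inj])
  also have "\<dots> = n * (n - 1)" using sum_el[OF S] cardS by (simp add: mult_ac)
  finally have "(\<Sum>u<n. el (g (a + u))) = (\<Sum>u<n. u)" using double_sum_lessThan[of n] by linarith
  then have el_eq: "el (g (a + u)) = u" if "u < n" for u
    using el_ge that sum_mono_inv[of "\<lambda>u. u" "{..<n}" "\<lambda>u. el (g (a + u))" u] by simp
  have "inj_on el (slots s S)"
    unfolding gu[symmetric] by (rule inj_onI) (use el_eq in auto)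
  then show exact_cover unfolding exact_cover_def using S cardS by blast
qed

end

section \<open>Tiling and exact cover\<close>

text \<open>
  Cell \<open>g\<close> receives a tile \<open>t < T\<close> with colours \<open>east\<close>, \<open>south\<close>, \<open>west\<close> and \<open>north\<close>; its western
  and northern neighbours are \<open>left g\<close> and \<open>up g\<close>.
\<close>

locale tiling =
  fixes N T Q :: nat and left up :: "nat \<Rightarrow> nat"
    and east south west north :: "nat \<Rightarrow> nat \<Rightarrow> nat"
  assumes T_pos: "T > 0"
    and left: "bij_betw left {..<N} {..<N}" and up: "bij_betw up {..<N} {..<N}"
    and east_less: "\<And>g t. east g t < Q" and south_less: "\<And>g t. south g t < Q"
begin

definition solvable :: bool where
  "solvable \<longleftrightarrow> (\<exists>\<tau>. \<forall>g<N. \<tau> g < T \<and> west g (\<tau> g) = east (left g) (\<tau> (left g)) \<and>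
     north g (\<tau> g) = south (up g) (\<tau> (up g)))"

text \<open>Counts both the elements of a cell (one, and a pair per colour for two sides) and the
  elements covered by a tile before mirroring (one, and one per colour for four sides).\<close>

definition r :: nat where "r = 1 + 4 * Q"

lemma r_pos [simp]: "r > 0"
  by (simp add: r_def)

text \<open>
  The elements of cell \<open>g\<close> are \<open>g * r\<close> and, for each colour \<open>b\<close> of the eastern and of the
  southern side, a pair of elements: the cell covers one of the two according to whether its
  side has colour \<open>b\<close>, and the neighbour must cover the other one.
\<close>

definition base :: "nat \<Rightarrow> nat \<Rightarrow> nat \<Rightarrow> nat" where
  "base g t i =
    (if i < 1 then g * r
     else if i < 1 + Q then g * r + (1 + 2 * (i - 1) + (if east g t = i - 1 then 1 else 0))
     else if i < 1 + 2 * Q then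
       g * r + (1 + 2 * Q + 2 * (i - (1 + Q)) + (if south g t = i - (1 + Q) then 1 else 0))
     else if i < 1 + 3 * Q then
       left g * r + (1 + 2 * (i - (1 + 2 * Q)) + (if west g t = i - (1 + 2 * Q) then 0 else 1))
     else up g * r + (1 + 2 * Q + 2 * (i - (1 + 3 * Q)) + (if north g t = i - (1 + 3 * Q) then 0 else 1)))"

text \<open>
  Adding the mirror image of every element makes all options equally heavy.
\<close>

definition elem :: "nat \<Rightarrow> nat" where
  "elem h = (let j = h div (2 * r); i = h mod (2 * r) in
     if i < r then base (j div T) (j mod T) i
     else 2 * r * N - 1 - base (j div T) (j mod T) (i - r))"

lemma base_simps:
  "base g t 0 = g * r"
  "b < Q \<Longrightarrow> base g t (1 + b) = g * r + (1 + 2 * b + (if east g t = b then 1 else 0))"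
  "b < Q \<Longrightarrow> base g t (1 + Q + b) = g * r + (1 + 2 * Q + 2 * b + (if south g t = b then 1 else 0))"
  "b < Q \<Longrightarrow> base g t (1 + 2 * Q + b) = left g * r + (1 + 2 * b + (if west g t = b then 0 else 1))"
  "b < Q \<Longrightarrow> base g t (1 + 3 * Q + b) = up g * r + (1 + 2 * Q + 2 * b + (if north g t = b then 0 else 1))"
  by (simp_all add: base_def)

lemma base_cases:
  assumes "i < r"
  obtains "i = 0" | b where "b < Q" "i = 1 + b" | b where "b < Q" "i = 1 + Q + b"
    | b where "b < Q" "i = 1 + 2 * Q + b" | b where "b < Q" "i = 1 + 3 * Q + b"
proof -
  consider "i < 1" | "1 \<le> i" "i < 1 + Q" | "1 + Q \<le> i" "i < 1 + 2 * Q"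
    | "1 + 2 * Q \<le> i" "i < 1 + 3 * Q" | "1 + 3 * Q \<le> i" by linarith
  then show thesis
  proof cases
    case 1
    then show thesis using that(1) by simp
  next
    case 2
    then show thesis using that(2)[of "i - 1"] by simp
  next
    case 3
    then show thesis using that(3)[of "i - (1 + Q)"] by simp
  next
    case 4
    then show thesis using that(4)[of "i - (1 + 2 * Q)"] by simp
  next
    case 5
    then show thesis using that(5)[of "i - (1 + 3 * Q)"] assms by (simp add: r_def)
  qed
qed

lemma left_less: "g < N \<Longrightarrow> left g < N" and up_less: "g < N \<Longrightarrow> up g < N"
  using bij_betwE[OF left] bij_betwE[OF up] by simp_all

text \<open>Offset 0 arises at position 0 only, so among the options before mirroring,
  \<open>g * r\<close> comes from a tile of cell \<open>g\<close>.\<close>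

lemma base_offset:
  assumes "g < N" "i < r"
  obtains g' q where "base g t i = g' * r + q" "g' < N" "q < r" "i = 0 \<Longrightarrow> g' = g \<and> q = 0" "i \<noteq> 0 \<Longrightarrow> q \<noteq> 0"
  using assms(2)
proof (cases rule: base_cases)
  case 1
  then show thesis using that[of g 0] assms by (simp add: base_simps)
next
  case (2 b)
  then show thesis using that[OF base_simps(2)[OF 2(1), of g t, folded 2(2)]] assms by (auto simp: r_def split: if_splits)
next
  case (3 b)
  then show thesis using that[OF base_simps(3)[OF 3(1), of g t, folded 3(2)]] assms by (auto simp: r_def split: if_splits)
next
  case (4 b)
  then show thesis using that[OF base_simps(4)[OF 4(1), of g t, folded 4(2)]] assms left_less
    by (auto simp: r_def split: if_splits)
next
  case (5 b)
  then show thesis using that[OF base_simps(5)[OF 5(1), of g t, folded 5(2)]] assms up_less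
    by (auto simp: r_def split: if_splits)
qed

lemma flat_less: "g < N \<Longrightarrow> q < r \<Longrightarrow> g * r + q < N * r"
  by (metis Suc_leI add.commute less_le_trans mult_Suc mult_le_mono1 nat_add_left_cancel_less)

lemma base_less: "g < N \<Longrightarrow> i < r \<Longrightarrow> base g t i < N * r"
  by (rule base_offset[of g i t]) (simp_all add: flat_less)

lemma elem_simps:
  assumes "t < T"
  shows "i < r \<Longrightarrow> elem ((g * T + t) * (2 * r) + i) = base g t i"
    and "i < r \<Longrightarrow> elem ((g * T + t) * (2 * r) + (r + i)) = 2 * r * N - 1 - base g t i"
proof -
  have "((g * T + t) * (2 * r) + k) div (2 * r) = g * T + t" "((g * T + t) * (2 * r) + k) mod (2 * r) = k"
    if "k < 2 * r" for k
    using that by simp_all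
  moreover have "(g * T + t) div T = g" "(g * T + t) mod T = t" using assms by simp_all
  ultimately show "i < r \<Longrightarrow> elem ((g * T + t) * (2 * r) + i) = base g t i"
    and "i < r \<Longrightarrow> elem ((g * T + t) * (2 * r) + (r + i)) = 2 * r * N - 1 - base g t i"
    unfolding elem_def Let_def by simp_all
qed

lemma option_cell:
  assumes "j < N * T"
  shows "j div T < N" "j mod T < T" "j = (j div T) * T + j mod T"
  using assms T_pos by (simp_all add: less_mult_imp_div_less)

lemma elem_less:
  assumes "h < N * T * (2 * r)"
  shows "elem h < 2 * r * N"
proof -
  let ?j = "h div (2 * r)" and ?i = "h mod (2 * r)"
  have "?j < N * T" using assms by (rule less_mult_imp_div_less)
  then have "?j div T < N" by (rule less_mult_imp_div_less)
  moreover from this have "2 * r * N > 0" by (cases N) simp_all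
  ultimately show ?thesis
    using base_less[of "?j div T" ?i "?j mod T"] unfolding elem_def Let_def by (auto simp: mult_ac)
qed

lemma elem_balanced:
  assumes "j < N * T"
  shows "2 * (\<Sum>h=j * (2 * r)..<j * (2 * r) + 2 * r. elem h) = 2 * r * (2 * r * N - 1)"
proof -
  define g t where "g = j div T" and "t = j mod T"
  have j: "g < N" "t < T" "j = g * T + t" using option_cell[OF assms] by (simp_all add: g_def t_def)
  let ?f = "\<lambda>i. elem (j * (2 * r) + i)"
  have "(\<Sum>h=j * (2 * r)..<j * (2 * r) + 2 * r. elem h) = (\<Sum>i<r + r. ?f i)"
    using sum.shift_bounds_nat_ivl[of elem 0 "j * (2 * r)" "2 * r"]
    by (simp add: lessThan_atLeast0 add.commute mult_2)
  also have "\<dots> = (\<Sum>i<r. ?f i) + (\<Sum>i<r. ?f (r + i))" by (rule sum_lessThan_split)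
  also have "\<dots> = (\<Sum>i<r. ?f i + ?f (r + i))" by (rule sum.distrib[symmetric])
  also have "\<dots> = (\<Sum>i<r. 2 * r * N - 1)"
  proof (rule sum.cong[OF refl])
    fix i assume "i \<in> {..<r}"
    then have i: "i < r" by simp
    have "base g t i < N * r" using base_less[OF j(1) i] .
    then have "base g t i \<le> 2 * r * N - 1" by (simp add: mult.commute)
    then show "?f i + ?f (r + i) = 2 * r * N - 1"
      unfolding j(3) elem_simps(1)[OF j(2) i] elem_simps(2)[OF j(2) i] by (rule le_add_diff_inverse)
  qed
  also have "\<dots> = r * (2 * r * N - 1)" by simp
  finally show ?thesis by (simp only: mult.assoc)
qed

sublocale cover_system "N * T" "2 * r" N elem
proof
  show "2 \<le> 2 * r" using r_pos by linarith
  show "N \<le> N * T" using T_pos by (cases T) simp_all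
qed (fact elem_less elem_balanced)+

text \<open>It suffices to cover every element: a surjection between finite sets of equal size is
  injective.\<close>

lemma solvable_imp_exact_cover:
  assumes solvable
  shows exact_cover
proof -
  obtain \<tau> where t: "\<And>g. g < N \<Longrightarrow> \<tau> g < T"
    and w: "\<And>g. g < N \<Longrightarrow> west g (\<tau> g) = east (left g) (\<tau> (left g))"
    and n: "\<And>g. g < N \<Longrightarrow> north g (\<tau> g) = south (up g) (\<tau> (up g))"
    using assms unfolding solvable_def by blast
  define S where "S = (\<lambda>g. g * T + \<tau> g) ` {..<N}"
  have inj: "inj_on (\<lambda>g. g * T + \<tau> g) {..<N}"
  proof (rule inj_on_inverseI[of _ "\<lambda>j. j div T"])
    fix g assume "g \<in> {..<N}"
    then show "(g * T + \<tau> g) div T = g" using t[of g] by simp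
  qed
  have S: "S \<subseteq> {..<N * T}"
  proof
    fix j assume "j \<in> S"
    then obtain g where g: "g < N" "j = g * T + \<tau> g" by (auto simp: S_def)
    then have "g * T + \<tau> g < (g + 1) * T" using t by simp
    also have "\<dots> \<le> N * T" using g by (intro mult_le_mono1) simp
    finally show "j \<in> {..<N * T}" using g by simp
  qed
  have cardS: "card S = N" unfolding S_def using card_image[OF inj] by simp
  have finS: "finite S" by (simp add: S_def)
  have base_surj: "\<exists>g i. g < N \<and> i < r \<and> base g (\<tau> g) i = x" if "x < N * r" for x
  proof -
    define g q where "g = x div r" and "q = x mod r"
    have x: "g < N" "q < r" "x = g * r + q" using that by (simp_all add: g_def q_def less_mult_imp_div_less)
    \<comment> \<open>\<open>gw\<close> and \<open>gn\<close> are the cells whose western and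
      northern neighbour is \<open>g\<close>. Their tiles cover the element of each pair that the
      tile of \<open>g\<close> leaves open.\<close>
    obtain gw where gw: "gw < N" "left gw = g" using left x(1) by (metis bij_betw_imp_surj_on imageE lessThan_iff)
    obtain gn where gn: "gn < N" "up gn = g" using up x(1) by (metis bij_betw_imp_surj_on imageE lessThan_iff)
    consider "q = 0" | b v where "b < Q" "v < 2" "q = 1 + 2 * b + v" | b v where "b < Q" "v < 2" "q = 1 + 2 * Q + 2 * b + v"
    proof -
      consider "q = 0" | "1 \<le> q" "q < 1 + 2 * Q" | "1 + 2 * Q \<le> q" by linarith
      then show thesis
      proof cases
        case 2
        then show thesis using that(2)[of "(q - 1) div 2" "(q - 1) mod 2"] by simp
      next
        case 3
        then show thesis using that(3)[of "(q - (1 + 2 * Q)) div 2" "(q - (1 + 2 * Q)) mod 2"] x(2) by (simp add: r_def)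
      qed (use that(1) in simp)
    qed
    then show ?thesis
    proof cases
      case 1
      then show ?thesis using x by (intro exI[of _ g] exI[of _ 0]) (simp add: base_simps)
    next
      case (2 b v)
      show ?thesis
      proof (cases "v = (if east g (\<tau> g) = b then 1 else 0)")
        case True
        then have "base g (\<tau> g) (1 + b) = x" using 2 x by (simp only: base_simps)
        then show ?thesis using 2(1) x(1) by (intro exI[of _ g] exI[of _ "1 + b"]) (simp add: r_def)
      next
        case False
        then have "v = (if west gw (\<tau> gw) = b then 0 else 1)" using 2(2) w[OF gw(1)] gw(2) by (auto split: if_splits)
        then have "base gw (\<tau> gw) (1 + 2 * Q + b) = x" using 2 x gw by (simp only: base_simps)
        then show ?thesis using 2(1) gw(1) by (intro exI[of _ gw] exI[of _ "1 + 2 * Q + b"]) (simp add: r_def)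
      qed
    next
      case (3 b v)
      show ?thesis
      proof (cases "v = (if south g (\<tau> g) = b then 1 else 0)")
        case True
        then have "base g (\<tau> g) (1 + Q + b) = x" using 3 x by (simp only: base_simps)
        then show ?thesis using 3(1) x(1) by (intro exI[of _ g] exI[of _ "1 + Q + b"]) (simp add: r_def)
      next
        case False
        then have "v = (if north gn (\<tau> gn) = b then 0 else 1)" using 3(2) n[OF gn(1)] gn(2) by (auto split: if_splits)
        then have "base gn (\<tau> gn) (1 + 3 * Q + b) = x" using 3 x gn by (simp only: base_simps)
        then show ?thesis using 3(1) gn(1) by (intro exI[of _ gn] exI[of _ "1 + 3 * Q + b"]) (simp add: r_def)
      qed
    qed
  qed
  have in_slots: "(g * T + \<tau> g) * (2 * r) + k \<in> slots (2 * r) S" if "g < N" "k < 2 * r" for g k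
  proof -
    have "((g * T + \<tau> g) * (2 * r) + k) div (2 * r) = g * T + \<tau> g"
      using that(2) by (intro div_nat_eqI) simp_all
    then show ?thesis using that(1) by (simp add: slots_def S_def)
  qed
  have "{..<2 * r * N} \<subseteq> elem ` slots (2 * r) S"
  proof
    fix x assume "x \<in> {..<2 * r * N}"
    then have x: "x < 2 * r * N" by simp
    show "x \<in> elem ` slots (2 * r) S"
    proof (cases "x < N * r")
      case True
      then obtain g i where gi: "g < N" "i < r" "base g (\<tau> g) i = x" using base_surj by blast
      then have "elem ((g * T + \<tau> g) * (2 * r) + i) = x" using elem_simps(1)[OF t] by simp
      then show ?thesis using in_slots[of g i] gi by (metis image_eqI less_le_trans mult_2 le_add1)
    next
      case False
      then have "2 * r * N - 1 - x < N * r" using x by (simp add: mult.commute)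
      then obtain g i where gi: "g < N" "i < r" "base g (\<tau> g) i = 2 * r * N - 1 - x" using base_surj by blast
      then have "elem ((g * T + \<tau> g) * (2 * r) + (r + i)) = x" using elem_simps(2)[OF t] x by simp
      moreover have "r + i < 2 * r" using gi(2) by simp
      ultimately show ?thesis using in_slots[OF gi(1)] by (metis image_eqI)
    qed
  qed
  moreover have "finite (slots (2 * r) S)" "card (slots (2 * r) S) = 2 * r * N"
    using finS cardS by (simp_all add: finite_slots card_slots)
  ultimately have "card (elem ` slots (2 * r) S) = card (slots (2 * r) S)"
    by (metis card_image_le card_lessThan card_mono finite_imageI le_antisym)
  then have "inj_on elem (slots (2 * r) S)"
    using \<open>finite (slots (2 * r) S)\<close> by (rule eq_card_imp_inj_on[rotated])
  then show ?thesis unfolding exact_cover_def using S cardS by blast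
qed

lemma exact_cover_imp_solvable:
  assumes exact_cover
  shows solvable
proof -
  obtain S where S: "S \<subseteq> {..<N * T}" "card S = N" and inj: "inj_on elem (slots (2 * r) S)"
    using assms unfolding exact_cover_def by blast
  have finS: "finite S" using S(1) by (rule finite_subset) simp
  have div_h: "h div (2 * r) < N * T" if "h \<in> slots (2 * r) S" for h
    using that S(1) by (auto simp: slots_def)
  have "elem ` slots (2 * r) S \<subseteq> {..<2 * r * N}"
  proof (rule image_subsetI)
    fix h assume "h \<in> slots (2 * r) S"
    then have "h < N * T * (2 * r)" using div_h[of h] by (simp add: div_less_iff_less_mult)
    then show "elem h \<in> {..<2 * r * N}" using elem_less by simp
  qed
  moreover have "card (elem ` slots (2 * r) S) = 2 * r * N"
    using card_image[OF inj] card_slots[OF _ finS, of "2 * r"] S(2) by simp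
  ultimately have surj: "elem ` slots (2 * r) S = {..<2 * r * N}" by (intro card_subset_eq) simp_all
  \<comment> \<open>The element \<open>g * r\<close> is covered by some slot. Mirrored elements are
    at least \<open>N * r\<close>, so the slot is position 0 of a tile of cell
    \<open>g\<close>.\<close>
  have "\<exists>t<T. g * T + t \<in> S" if g: "g < N" for g
  proof -
    have "g * r < N * r" using g by simp
    also have "\<dots> \<le> 2 * r * N" by simp
    finally have "g * r \<in> elem ` slots (2 * r) S" using surj by simp
    then obtain h where h: "h \<in> slots (2 * r) S" "elem h = g * r" by auto
    define j i where "j = h div (2 * r)" and "i = h mod (2 * r)"
    have j: "j \<in> S" using h(1) by (simp add: slots_def j_def)
    have jN: "j div T < N" "j mod T < T" "j = (j div T) * T + j mod T"
      using option_cell[of j] j S(1) by auto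
    have i: "i < 2 * r" by (simp add: i_def)
    have el: "elem h = (if i < r then base (j div T) (j mod T) i else 2 * r * N - 1 - base (j div T) (j mod T) (i - r))"
      by (simp add: elem_def Let_def j_def i_def)
    have "i < r"
    proof (rule ccontr)
      assume "\<not> i < r"
      then have "base (j div T) (j mod T) (i - r) < N * r" using i jN by (intro base_less) auto
      then have "N * r \<le> elem h" using el \<open>\<not> i < r\<close> by (simp add: mult.commute)
      then show False using h(2) \<open>g * r < N * r\<close> by simp
    qed
    obtain g' q where q: "base (j div T) (j mod T) i = g' * r + q" "q < r"
      "i = 0 \<Longrightarrow> g' = j div T \<and> q = 0" "i \<noteq> 0 \<Longrightarrow> q \<noteq> 0"
      by (rule base_offset[OF jN(1) \<open>i < r\<close>, of "j mod T"]) (rule that)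
    have eq: "g' * r + q = g * r" using el h(2) q(1) \<open>i < r\<close> by simp
    have "q = (g' * r + q) mod r" using q(2) by simp
    also have "\<dots> = 0" unfolding eq by simp
    finally have "i = 0" using q(4) by blast
    then have "g = j div T" using q(3) eq r_pos by (auto simp del: r_pos)
    then show ?thesis using jN j by metis
  qed
  then obtain \<tau> where t: "\<And>g. g < N \<Longrightarrow> \<tau> g < T" "\<And>g. g < N \<Longrightarrow> g * T + \<tau> g \<in> S" by metis
  let ?h = "\<lambda>g i. (g * T + \<tau> g) * (2 * r) + i"
  have slot: "?h g i \<in> slots (2 * r) S" if "g < N" "i < r" for g i
  proof -
    have "?h g i div (2 * r) = g * T + \<tau> g" using that(2) by (intro div_nat_eqI) simp_all
    then show ?thesis using t(2)[OF that(1)] by (simp add: slots_def)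
  qed
  have diff: "base g (\<tau> g) i \<noteq> base g' (\<tau> g') i'" if "g < N" "g' < N" "i < r" "i' < r" "i \<noteq> i'" for g g' i i'
  proof
    assume "base g (\<tau> g) i = base g' (\<tau> g') i'"
    then have "elem (?h g i) = elem (?h g' i')"
      using elem_simps(1)[OF t(1)] that by simp
    then have "?h g i = ?h g' i'" using inj slot that by (auto dest: inj_onD)
    then have "?h g i mod (2 * r) = ?h g' i' mod (2 * r)" by (rule arg_cong)
    then show False using that by simp
  qed
  have "west g (\<tau> g) = east (left g) (\<tau> (left g))" if g: "g < N" for g
  proof -
    let ?b = "east (left g) (\<tau> (left g))"
    have b: "?b < Q" by (rule east_less)
    \<comment> \<open>The left neighbour takes the upper element of the pair for its own colour
      \<open>?b\<close>. The tile at \<open>g\<close> must then take the lower one, which happens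
      only if its western colour is \<open>?b\<close>.\<close>
    have "base (left g) (\<tau> (left g)) (1 + ?b) \<noteq> base g (\<tau> g) (1 + 2 * Q + ?b)"
      using g left_less[OF g] b by (intro diff) (simp_all add: r_def)
    then show ?thesis unfolding base_simps(2)[OF b] base_simps(4)[OF b] by (simp split: if_splits)
  qed
  moreover have "north g (\<tau> g) = south (up g) (\<tau> (up g))" if g: "g < N" for g
  proof -
    let ?b = "south (up g) (\<tau> (up g))"
    have b: "?b < Q" by (rule south_less)
    have "base (up g) (\<tau> (up g)) (1 + Q + ?b) \<noteq> base g (\<tau> g) (1 + 3 * Q + ?b)"
      using g up_less[OF g] b by (intro diff) (simp_all add: r_def)
    then show ?thesis unfolding base_simps(3)[OF b] base_simps(5)[OF b] by (simp split: if_splits)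
  qed
  ultimately show ?thesis unfolding solvable_def using t(1) by blast
qed

end

section \<open>Tilings that describe computations\<close>

text \<open>
  Vertical colours \<open>Cell q ss hs\<close> describe one tape position at one time: the state and, for every
  tape, the symbol and whether the head is here. Horizontal colours \<open>Row q as hl hr\<close> carry the state
  and the scanned symbols along a row, and the head flags of the two adjacent positions. Row 0
  describes the initial configuration; there \<open>Flag\<close> tells whether the certificate has ended.
\<close>

datatype colour = Flag bool | Row nat "nat list" "bool list" "bool list" | Cell nat "nat list" "bool list"

record tile =
  east :: colour
  south :: colour
  west :: colour
  north :: colour

text \<open>A halted configuration performs an idle step, so all steps of the diagram have the same
  form.\<close>

definition tm_action :: "tm \<Rightarrow> nat \<Rightarrow> nat list \<Rightarrow> nat \<times> (nat \<times> direction) list" where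
  "tm_action M q as = (if q = halt_state M then (q, map (\<lambda>a. (a, Stay)) as) else delta M q as)"

text \<open>\<open>hl\<close>, \<open>hs\<close>, \<open>hr\<close> are the head flags at the left,
  own and right position. A head that moves right arrives from the left, hence \<open>hl\<close> for
  \<open>MoveR\<close>.\<close>

definition step_tile :: "tm \<Rightarrow> nat \<Rightarrow> nat list \<Rightarrow> nat list \<Rightarrow> bool list \<Rightarrow> bool list \<Rightarrow> bool list \<Rightarrow> tile" where
  "step_tile M q as ss hl hs hr = (let bs = snd (tm_action M q as) in
     \<lparr>east = Row q as hs hr,
      south = Cell (fst (tm_action M q as))
        (map (\<lambda>i. if hs ! i then fst (bs ! i) else ss ! i) [0..<num_tapes M])
        (map (\<lambda>i. case snd (bs ! i) of MoveL \<Rightarrow> hr ! i | Stay \<Rightarrow> hs ! i | MoveR \<Rightarrow> hl ! i) [0..<num_tapes M]),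
      west = Row q as hl hs,
      north = Cell q ss hs\<rparr>)"

definition symbol_vectors :: "tm \<Rightarrow> nat list set" where
  "symbol_vectors M = {as. length as = num_tapes M \<and> (\<forall>a\<in>set as. a < num_syms M)}"

definition flag_vectors :: "tm \<Rightarrow> bool list set" where
  "flag_vectors M = {hs. length hs = num_tapes M}"

definition step_tiles :: "tm \<Rightarrow> tile set" where
  "step_tiles M = {step_tile M q as ss hl hs hr | q as ss hl hs hr.
     q < num_states M \<and> as \<in> symbol_vectors M \<and> ss \<in> symbol_vectors M \<and>
     hl \<in> flag_vectors M \<and> hs \<in> flag_vectors M \<and> hr \<in> flag_vectors M \<and>
     (\<forall>i<num_tapes M. hs ! i \<longrightarrow> ss ! i = as ! i)}"

text \<open>Within the certificate (kind 3) a blank raises the flag that is passed east, which keeps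
  the certificate contiguous. All heads start at position 0, hence the replicated
  \<open>b\<close>.\<close>

definition init_tile :: "tm \<Rightarrow> nat \<Rightarrow> bool \<Rightarrow> nat \<Rightarrow> bool \<Rightarrow> nat \<Rightarrow> nat list \<Rightarrow> bool list \<Rightarrow> tile" where
  "init_tile M kind b a w q ss hs =
     \<lparr>east = Flag (kind = 3 \<and> a = 0),
      south = Cell (start_state M) (a # replicate (num_tapes M - 1) 0) (replicate (num_tapes M) b),
      west = Flag w,
      north = Cell q ss hs\<rparr>"

text \<open>
  The input symbol is \<open>kind\<close>, or free if \<open>kind = 3\<close>. The northern side of row 0 shows the final
  configuration, which is inspected at position 0 (where \<open>b\<close> holds).
\<close>

definition init_tiles :: "tm \<Rightarrow> nat \<Rightarrow> bool \<Rightarrow> tile set" where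
  "init_tiles M kind b = {init_tile M kind b a w q ss hs | a w q ss hs.
     q < num_states M \<and> ss \<in> symbol_vectors M \<and> hs \<in> flag_vectors M \<and> a < 3 \<and>
     (if kind = 3 then w \<longrightarrow> a = 0 else a = kind) \<and> (b \<longrightarrow> ss ! (num_tapes M - 1) = 2)}"

text \<open>Classes below 8 combine the four kinds of input symbol with the test for position
  0.\<close>

definition class_tiles :: "tm \<Rightarrow> nat \<Rightarrow> tile set" where
  "class_tiles M c = (if c < 8 then init_tiles M (c mod 4) (4 \<le> c) else step_tiles M)"

lemma finite_vectors: "finite (symbol_vectors M)" "finite (flag_vectors M)"
proof -
  have "symbol_vectors M = {as. set as \<subseteq> {..<num_syms M} \<and> length as = num_tapes M}"
    by (auto simp: symbol_vectors_def)
  then show "finite (symbol_vectors M)" by (simp add: finite_lists_length_eq)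
  have "flag_vectors M = {hs. set hs \<subseteq> UNIV \<and> length hs = num_tapes M}" by (auto simp: flag_vectors_def)
  then show "finite (flag_vectors M)" by (simp only: finite_lists_length_eq finite)
qed

lemma finite_class_tiles: "finite (class_tiles M c)"
proof -
  let ?S = "symbol_vectors M" and ?F = "flag_vectors M"
  have s1: "step_tiles M \<subseteq> (\<lambda>(q, as, ss, hl, hs, hr). step_tile M q as ss hl hs hr) `
      ({..<num_states M} \<times> ?S \<times> ?S \<times> ?F \<times> ?F \<times> ?F)"
  proof
    fix t assume "t \<in> step_tiles M"
    then obtain q as ss hl hs hr where "t = step_tile M q as ss hl hs hr" "q < num_states M" "as \<in> ?S" "ss \<in> ?S"
      "hl \<in> ?F" "hs \<in> ?F" "hr \<in> ?F" unfolding step_tiles_def by blast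
    then show "t \<in> (\<lambda>(q, as, ss, hl, hs, hr). step_tile M q as ss hl hs hr) `
      ({..<num_states M} \<times> ?S \<times> ?S \<times> ?F \<times> ?F \<times> ?F)"
      by (intro image_eqI[of _ _ "(q, as, ss, hl, hs, hr)"]) simp_all
  qed
  have s2: "init_tiles M k b \<subseteq> (\<lambda>(a, w, q, ss, hs). init_tile M k b a w q ss hs) `
      ({..<3} \<times> UNIV \<times> {..<num_states M} \<times> ?S \<times> ?F)" for k b
  proof
    fix t assume "t \<in> init_tiles M k b"
    then obtain a w q ss hs where "t = init_tile M k b a w q ss hs" "q < num_states M" "ss \<in> ?S" "hs \<in> ?F" "a < 3"
      unfolding init_tiles_def by blast
    then show "t \<in> (\<lambda>(a, w, q, ss, hs). init_tile M k b a w q ss hs) `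
      ({..<3} \<times> UNIV \<times> {..<num_states M} \<times> ?S \<times> ?F)"
      by (intro image_eqI[of _ _ "(a, w, q, ss, hs)"]) simp_all
  qed
  have "finite (step_tiles M)" by (rule finite_subset[OF s1]) (simp add: finite_vectors)
  moreover have "finite (init_tiles M k b)" for k b
    by (rule finite_subset[OF s2]) (simp add: finite_vectors)
  ultimately show ?thesis unfolding class_tiles_def by simp
qed

lemma init_tilesI:
  assumes "q < num_states M" "ss \<in> symbol_vectors M" "hs \<in> flag_vectors M" "a < 3"
    "if k = 3 then w \<longrightarrow> a = 0 else a = k" "b \<longrightarrow> ss ! (num_tapes M - 1) = 2"
  shows "init_tile M k b a w q ss hs \<in> init_tiles M k b"
  using assms unfolding init_tiles_def by blast

text \<open>Nonempty classes can be enumerated, with repetitions, over a common index range. The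
  final symbols of the witness are all 2 so that it passes the inspection at position 0.\<close>

lemma class_tiles_nonempty:
  assumes "wf_tm M"
  shows "class_tiles M c \<noteq> {}"
proof -
  let ?z = "replicate (num_tapes M) 0 :: nat list" and ?f = "replicate (num_tapes M) False"
  have v: "start_state M < num_states M" "?z \<in> symbol_vectors M" "?f \<in> flag_vectors M"
    "replicate (num_tapes M) 2 \<in> symbol_vectors M" "num_tapes M \<ge> 1"
    using assms by (auto simp: wf_tm_def symbol_vectors_def flag_vectors_def)
  have "step_tile M (start_state M) ?z ?z ?f ?f ?f \<in> step_tiles M"
    using v unfolding step_tiles_def by blast
  moreover have "init_tile M k b (if k = 3 then 0 else k) False (start_state M) (replicate (num_tapes M) 2) ?f
      \<in> init_tiles M k b" if "k < 4" for k b
    by (rule init_tilesI) (use v that in auto)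
  from this[of "c mod 4" "4 \<le> c"] have "init_tiles M (c mod 4) (4 \<le> c) \<noteq> {}" by auto
  ultimately show ?thesis unfolding class_tiles_def by auto
qed

section \<open>Space-time diagrams on a torus\<close>

locale tableau =
  fixes M :: tm and x :: "bool list" and P T :: nat
  assumes wf: "wf_tm M"
begin

definition input_bound :: nat where "input_bound = 2 * length x + 2 + P"
text \<open>The window from \<open>-T\<close> to \<open>T + input_bound + 1\<close> contains the
  input and every position that a head reaches within \<open>T\<close> steps.\<close>

definition width :: nat where "width = 2 * T + input_bound + 2"

text \<open>The tape symbols of \<open>string_pair x y\<close>: doubled bits of \<open>x\<close>,
  the separator 1, 2, free symbols for the certificate, and blanks.\<close>

definition kind :: "nat \<Rightarrow> nat" where
  "kind c =
    (if c < 2 * length x then (if x ! (c div 2) then 2 else 1)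
     else if c = 2 * length x then 1
     else if c = 2 * length x + 1 then 2
     else if c < input_bound then 3
     else 0)"

definition cell_class :: "nat \<Rightarrow> nat \<Rightarrow> nat" where
  "cell_class r c = (if r = 0 then (if c = 0 then 4 else 0) + kind c else 8)"

definition left_of :: "nat \<Rightarrow> nat" where "left_of c = (c + width - 1) mod width"
definition right_of :: "nat \<Rightarrow> nat" where "right_of c = (c + 1) mod width"

definition is_tiling :: "(nat \<Rightarrow> nat \<Rightarrow> tile) \<Rightarrow> bool" where
  "is_tiling \<tau> \<longleftrightarrow> (\<forall>r\<le>T. \<forall>c<width. \<tau> r c \<in> class_tiles M (cell_class r c) \<and>
     west (\<tau> r c) = east (\<tau> r (left_of c)) \<and>
     north (\<tau> r c) = south (\<tau> (if r = 0 then T else r - 1) c))"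

lemma width_bounds: "width \<ge> 2" "input_bound + 2 * T + 2 = width"
  by (simp_all add: width_def)

lemma left_of_eq: "c < width \<Longrightarrow> left_of c = (if c = 0 then width - 1 else c - 1)"
  by (cases c) (simp_all add: left_of_def)

lemma left_right: "c < width \<Longrightarrow> left_of (right_of c) = c" "c < width \<Longrightarrow> right_of (left_of c) = c"
  "c < width \<Longrightarrow> left_of c < width" "c < width \<Longrightarrow> right_of c < width"
proof -
  assume c: "c < width"
  note l = left_of_eq
  have r: "right_of c = (if c + 1 = width then 0 else c + 1)" if "c < width" for c
    using that by (auto simp: right_of_def)
  show "left_of c < width" "right_of c < width" using c by (auto simp: l r)
  show "left_of (right_of c) = c" "right_of (left_of c) = c"
    using c width_bounds(1) by (auto simp: l r)
qed

text \<open>Column \<open>c\<close> holds the tape position congruent to \<open>c\<close> in the window from \<open>-T\<close> to \<open>width - T - 1\<close>.\<close>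

definition position :: "nat \<Rightarrow> int" where
  "position c = (if c + T < width then int c else int c - int width)"

lemma position_mod: "c < width \<Longrightarrow> position c mod int width = int c"
proof -
  assume c: "c < width"
  have "(int c - int width) mod int width = int c mod int width" by (simp add: mod_diff_eq[symmetric])
  then show ?thesis using c by (auto simp: position_def)
qed

text \<open>Flags compare head positions modulo \<open>width\<close>, whereas symbols are read at
  actual positions. Both views agree because \<open>position c\<close> and \<open>h\<close> lie in
  one window of length \<open>width\<close>.\<close>

lemma position_eq_iff:
  assumes "c < width" "\<bar>h\<bar> \<le> int T"
  shows "position c = h \<longleftrightarrow> h mod int width = int c"
proof
  assume "h mod int width = int c"
  then have "position c mod int width = h mod int width" using position_mod[OF assms(1)] by simp
  then obtain j where j: "position c - h = int width * j" by (auto simp: mod_eq_dvd_iff)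
  have b: "position c - h < int width" "- int width < position c - h"
    using assms width_bounds(2) unfolding position_def by (auto split: if_splits)
  have "j = 0"
  proof (rule ccontr)
    assume "j \<noteq> 0"
    then have "j \<ge> 1 \<or> j \<le> -1" by linarith
    then have "int width * j \<ge> int width \<or> int width * j \<le> - int width"
      using mult_left_mono[of 1 j "int width"] mult_left_mono[of j "-1" "int width"] by auto
    then show False using b j by linarith
  qed
  then show "position c = h" using j by simp
qed (use position_mod[OF assms(1)] in auto)

text \<open>Residues make the shift to a neighbouring column uniform across the seam.\<close>

definition heads :: "tape list \<Rightarrow> nat \<Rightarrow> bool list" where
  "heads ts c = map (\<lambda>t. fst t mod int width = int c) ts"
definition symbols :: "tape list \<Rightarrow> nat \<Rightarrow> nat list" where
  "symbols ts c = map (\<lambda>t. snd t (position c)) ts"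
definition cell_colour :: "config \<Rightarrow> nat \<Rightarrow> colour" where
  "cell_colour cf c = Cell (fst cf) (symbols (snd cf) c) (heads (snd cf) c)"

definition proper :: "nat \<Rightarrow> config \<Rightarrow> bool" where
  "proper t cf \<longleftrightarrow> fst cf < num_states M \<and> length (snd cf) = num_tapes M \<and>
     (\<forall>tp\<in>set (snd cf). \<bar>fst tp\<bar> \<le> int t \<and> (\<forall>z. snd tp z < num_syms M))"

lemma read_tape_eq: "read_tape tp = snd tp (fst tp)"
  by (cases tp) simp

lemma proper_vectors:
  assumes "proper t cf"
  shows "map read_tape (snd cf) \<in> symbol_vectors M" "symbols (snd cf) c \<in> symbol_vectors M"
    "heads (snd cf) c \<in> flag_vectors M"
  using assms by (auto simp: proper_def symbol_vectors_def flag_vectors_def symbols_def heads_def read_tape_eq)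

lemma tm_action_wf:
  assumes "q < num_states M" "as \<in> symbol_vectors M"
  shows "fst (tm_action M q as) < num_states M" "length (snd (tm_action M q as)) = num_tapes M"
    "\<And>b. b \<in> set (snd (tm_action M q as)) \<Longrightarrow> fst b < num_syms M"
proof -
  have *: "fst (delta M q as) < num_states M \<and> length (snd (delta M q as)) = num_tapes M \<and>
      (\<forall>(b, d)\<in>set (snd (delta M q as)). b < num_syms M)"
    using wf assms unfolding wf_tm_def symbol_vectors_def by (simp add: case_prod_beta)
  show "fst (tm_action M q as) < num_states M" "length (snd (tm_action M q as)) = num_tapes M"
    using * assms by (simp_all add: tm_action_def symbol_vectors_def)
  show "fst b < num_syms M" if "b \<in> set (snd (tm_action M q as))" for b
  proof (cases "q = halt_state M")
    case True
    then show ?thesis using that assms(2) by (auto simp: tm_action_def symbol_vectors_def)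
  next
    case False
    then show ?thesis using that * by (auto simp: tm_action_def)
  qed
qed

lemma tm_step_action:
  assumes "proper t cf"
  shows "tm_step M cf = (fst (tm_action M (fst cf) (map read_tape (snd cf))),
     map2 act_tape (snd (tm_action M (fst cf) (map read_tape (snd cf)))) (snd cf))"
proof -
  obtain q ts where cf: "cf = (q, ts)" by (cases cf)
  have stay: "map2 act_tape (map (\<lambda>a. (a, Stay)) (map read_tape ts)) ts = ts" for ts
    by (induction ts) auto
  show ?thesis unfolding cf tm_action_def using stay[of ts] by (auto split: prod.split)
qed

lemma act_tape_eq:
  "act_tape b tp = (fst tp + (case snd b of MoveL \<Rightarrow> -1 | Stay \<Rightarrow> 0 | MoveR \<Rightarrow> 1), (snd tp)(fst tp := fst b))"
  by (cases b; cases tp) simp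

lemma proper_step:
  assumes "proper t cf"
  shows "proper (Suc t) (tm_step M cf)"
proof -
  let ?a = "tm_action M (fst cf) (map read_tape (snd cf))"
  have q: "fst cf < num_states M" and len: "length (snd cf) = num_tapes M" using assms by (auto simp: proper_def)
  note w = tm_action_wf[OF q proper_vectors(1)[OF assms]]
  have "\<bar>fst tp\<bar> \<le> int (Suc t) \<and> (\<forall>z. snd tp z < num_syms M)"
    if tp: "tp \<in> set (map2 act_tape (snd ?a) (snd cf))" for tp
  proof -
    obtain z where z: "z \<in> set (zip (snd ?a) (snd cf))" "tp = act_tape (fst z) (snd z)"
      using tp unfolding set_map case_prod_beta by (elim imageE)
    define b tp' where "b = fst z" and "tp' = snd z"
    have b: "b \<in> set (snd ?a)" "tp' \<in> set (snd cf)" "tp = act_tape b tp'"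
      using z set_zip_leftD[of b tp' "snd ?a" "snd cf"] set_zip_rightD[of b tp' "snd ?a" "snd cf"]
      by (simp_all add: b_def tp'_def)
    have "\<bar>fst tp'\<bar> \<le> int t" "\<forall>z. snd tp' z < num_syms M" using assms b(2) by (auto simp: proper_def)
    then show ?thesis using w(3)[OF b(1)] unfolding b(3) act_tape_eq by (auto split: direction.split)
  qed
  then show ?thesis
    unfolding tm_step_action[OF assms] proper_def using w len by simp
qed

lemma mod_shift:
  assumes "c < width"
  shows "(h + 1) mod int width = int c \<longleftrightarrow> h mod int width = int (left_of c)"
    and "(h - 1) mod int width = int c \<longleftrightarrow> h mod int width = int (right_of c)"
proof -
  have W: "int width > 0" using assms by simp
  have r: "int (right_of c) = (int c + 1) mod int width" for c by (simp add: right_of_def zmod_int add.commute)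
  have l: "int (left_of c) = (int c - 1) mod int width" for c
  proof -
    have "int (left_of c) = (int c - 1 + int width) mod int width"
      using width_bounds(1) by (simp add: left_of_def zmod_int of_nat_diff algebra_simps)
    then show ?thesis by simp
  qed
  have 1: "h mod int width = (int c - 1) mod int width" if "(h + 1) mod int width = int c" for h c
    by (metis add_diff_cancel_right' mod_diff_left_eq that)
  have 2: "h mod int width = (int c + 1) mod int width" if "(h - 1) mod int width = int c" for h c
    by (metis diff_add_cancel mod_add_left_eq that)
  have c: "int c mod int width = int c" using assms by simp
  show "(h + 1) mod int width = int c \<longleftrightarrow> h mod int width = int (left_of c)"
  proof
    assume "h mod int width = int (left_of c)"
    then have "(h + 1) mod int width = ((int c - 1) + 1) mod int width"
      unfolding l by (metis mod_add_left_eq)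
    then show "(h + 1) mod int width = int c" using c by simp
  qed (use 1 l in simp)
  show "(h - 1) mod int width = int c \<longleftrightarrow> h mod int width = int (right_of c)"
  proof
    assume "h mod int width = int (right_of c)"
    then have "(h - 1) mod int width = ((int c + 1) - 1) mod int width"
      unfolding r by (metis mod_diff_left_eq)
    then show "(h - 1) mod int width = int c" using c by simp
  qed (use 2 r in simp)
qed

text \<open>The southern side is computed from three adjacent columns and the scanned symbols. That
  it is the next configuration rests on \<open>position_eq_iff\<close> for the written symbols and
  on \<open>mod_shift\<close> for the heads.\<close>

lemma step_tile_run:
  assumes "proper t cf" "t \<le> T" "c < width"
  shows "step_tile M (fst cf) (map read_tape (snd cf)) (symbols (snd cf) c)
      (heads (snd cf) (left_of c)) (heads (snd cf) c) (heads (snd cf) (right_of c)) =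
    \<lparr>east = Row (fst cf) (map read_tape (snd cf)) (heads (snd cf) c) (heads (snd cf) (right_of c)),
     south = cell_colour (tm_step M cf) c,
     west = Row (fst cf) (map read_tape (snd cf)) (heads (snd cf) (left_of c)) (heads (snd cf) c),
     north = cell_colour cf c\<rparr>" (is ?eq)
    and "\<forall>i<num_tapes M. heads (snd cf) c ! i \<longrightarrow> symbols (snd cf) c ! i = map read_tape (snd cf) ! i" (is ?ok)
proof -
  let ?ts = "snd cf"
  let ?a = "tm_action M (fst cf) (map read_tape ?ts)"
  have q: "fst cf < num_states M" and len: "length ?ts = num_tapes M" using assms(1) by (auto simp: proper_def)
  note w = tm_action_wf[OF q proper_vectors(1)[OF assms(1)]]
  have h: "\<bar>fst (?ts ! i)\<bar> \<le> int T" if "i < num_tapes M" for i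
  proof -
    have "?ts ! i \<in> set ?ts" using that len by simp
    then have "\<bar>fst (?ts ! i)\<bar> \<le> int t" using assms(1) unfolding proper_def by blast
    then show ?thesis using assms(2) by simp
  qed
  have pos: "position c = fst (?ts ! i) \<longleftrightarrow> fst (?ts ! i) mod int width = int c" if "i < num_tapes M" for i
    using position_eq_iff[OF assms(3) h[OF that]] .
  show ?ok
  proof (intro allI impI)
    fix i assume i: "i < num_tapes M" "heads (snd cf) c ! i"
    then have "position c = fst (?ts ! i)" using pos len by (simp add: heads_def)
    then show "symbols (snd cf) c ! i = map read_tape (snd cf) ! i"
      using i len by (simp add: symbols_def read_tape_eq)
  qed
  have "symbols (map2 act_tape (snd ?a) ?ts) c =
      map (\<lambda>i. if heads ?ts c ! i then fst (snd ?a ! i) else symbols ?ts c ! i) [0..<num_tapes M]"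
    using len w(2) pos by (auto simp: list_eq_iff_nth_eq symbols_def heads_def act_tape_eq)
  moreover have "heads (map2 act_tape (snd ?a) ?ts) c =
     map (\<lambda>i. case snd (snd ?a ! i) of MoveL \<Rightarrow> heads ?ts (right_of c) ! i | Stay \<Rightarrow> heads ?ts c ! i
        | MoveR \<Rightarrow> heads ?ts (left_of c) ! i) [0..<num_tapes M]"
  proof (rule nth_equalityI)
    fix i assume "i < length (heads (map2 act_tape (snd ?a) ?ts) c)"
    then have i: "i < num_tapes M" using len w(2) by (simp add: heads_def)
    then show "heads (map2 act_tape (snd ?a) ?ts) c ! i =
      map (\<lambda>i. case snd (snd ?a ! i) of MoveL \<Rightarrow> heads ?ts (right_of c) ! i | Stay \<Rightarrow> heads ?ts c ! i
        | MoveR \<Rightarrow> heads ?ts (left_of c) ! i) [0..<num_tapes M] ! i"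
      using len w(2) mod_shift[OF assms(3), of "fst (?ts ! i)"]
      by (cases "snd (snd ?a ! i)") (simp_all add: heads_def act_tape_eq)
  qed (use len w(2) in \<open>simp add: heads_def\<close>)
  ultimately show ?eq
    unfolding step_tile_def Let_def cell_colour_def tm_step_action[OF assms(1)] by simp
qed

definition run :: "bool list \<Rightarrow> nat \<Rightarrow> config" where
  "run u t = (tm_step M ^^ t) (init_config M u)"

lemma proper_run: "proper t (run u t)"
proof (induction t)
  case 0
  have "string_contents v z < 3" for v z by (simp add: string_contents_def)
  then have "string_contents v z < num_syms M" for v z
    using wf unfolding wf_tm_def by (meson less_le_trans)
  then show ?case using wf by (auto simp: run_def proper_def init_config_def wf_tm_def)
next
  case (Suc t)
  then show ?case using proper_step by (simp add: run_def)
qed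

text \<open>A decider outputs a single bit, at position 0 of the last tape, where symbol 2 encodes
  True.\<close>

definition accepts :: "bool list \<Rightarrow> bool" where
  "accepts u \<longleftrightarrow> snd (last (snd (run u T))) 0 = 2"

definition input_symbol :: "bool list \<Rightarrow> nat \<Rightarrow> nat" where
  "input_symbol u c = string_contents u (position c)"

lemma input_symbol_eq:
  assumes "length u \<le> input_bound" "c < width"
  shows "input_symbol u c = (if c < length u then (if u ! c then 2 else 1) else 0)"
  using assms width_bounds(2) by (auto simp: input_symbol_def string_contents_def position_def)

lemma initial_colour:
  assumes "c < width"
  shows "cell_colour (run u 0) c =
    Cell (start_state M) (input_symbol u c # replicate (num_tapes M - 1) 0) (replicate (num_tapes M) (c = 0))"
proof -
  have "num_tapes M \<ge> 1" using wf by (simp add: wf_tm_def)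
  then obtain k where k: "num_tapes M = Suc k" by (cases "num_tapes M") auto
  show ?thesis
    by (auto simp: cell_colour_def run_def init_config_def symbols_def heads_def input_symbol_def k
       string_contents_def map_replicate_const)
qed

lemma last_symbol:
  "symbols (snd (run u T)) 0 ! (num_tapes M - 1) = 2 \<longleftrightarrow> accepts u"
proof -
  have len: "length (snd (run u T)) = num_tapes M" using proper_run by (simp add: proper_def)
  moreover have "num_tapes M \<ge> 1" using wf by (simp add: wf_tm_def)
  moreover have "position 0 = 0" using width_bounds(2) by (simp add: position_def)
  moreover from calculation have "snd (run u T) \<noteq> []" by auto
  ultimately show ?thesis by (simp add: symbols_def accepts_def last_conv_nth)
qed

lemma pair_nth:
  "length (string_pair x y) = 2 * length x + 2 + length y"
  "c < 2 * length x \<Longrightarrow> string_pair x y ! c = x ! (c div 2)"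
  "string_pair x y ! (2 * length x) = False"
  "string_pair x y ! (2 * length x + 1) = True"
  "string_pair x y ! (2 * length x + 2 + j) = y ! j"
proof -
  have len: "length (concat (map (\<lambda>b. [b, b]) x)) = 2 * length x" by (induction x) auto
  have nth: "c < 2 * length x \<Longrightarrow> concat (map (\<lambda>b. [b, b]) x) ! c = x ! (c div 2)" for c
  proof (induction x arbitrary: c)
    case (Cons b x)
    then show ?case by (cases c; cases "c - 1") (auto simp: nth_Cons')
  qed simp
  show "length (string_pair x y) = 2 * length x + 2 + length y" using len by (simp add: string_pair_def)
  show "c < 2 * length x \<Longrightarrow> string_pair x y ! c = x ! (c div 2)"
    using len nth by (simp add: string_pair_def nth_append)
  show "string_pair x y ! (2 * length x) = False" "string_pair x y ! (2 * length x + 1) = True"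
    "string_pair x y ! (2 * length x + 2 + j) = y ! j"
    using len by (simp_all add: string_pair_def nth_append)
qed

section \<open>Accepting runs and tilings\<close>

lemma accepts_imp_tiling:
  assumes y: "length y \<le> P" and acc: "accepts (string_pair x y)"
  shows "\<exists>\<tau>. is_tiling \<tau>"
proof -
  let ?u = "string_pair x y"
  have len: "length ?u \<le> input_bound" using y by (simp add: pair_nth input_bound_def)
  \<comment> \<open>The flag that column \<open>c\<close> sends east.\<close>
  define e where "e c \<longleftrightarrow> kind c = 3 \<and> input_symbol ?u c = 0" for c
  \<comment> \<open>Row \<open>r > 0\<close> performs step \<open>r\<close>, so its southern side is
    the configuration after \<open>r\<close> steps. Row 0 starts the run in the south and shows its
    end in the north.\<close>
  define \<tau> where "\<tau> r c =
    (if r = 0 then \<lparr>east = Flag (e c), south = cell_colour (run ?u 0) c, west = Flag (e (left_of c)), north = cell_colour (run ?u T) c\<rparr>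
     else let cf = run ?u (r - 1) in
       step_tile M (fst cf) (map read_tape (snd cf)) (symbols (snd cf) c)
         (heads (snd cf) (left_of c)) (heads (snd cf) c) (heads (snd cf) (right_of c)))" for r c
  have step: "\<tau> (Suc t) c = \<lparr>east = Row (fst (run ?u t)) (map read_tape (snd (run ?u t))) (heads (snd (run ?u t)) c) (heads (snd (run ?u t)) (right_of c)),
     south = cell_colour (run ?u (Suc t)) c,
     west = Row (fst (run ?u t)) (map read_tape (snd (run ?u t))) (heads (snd (run ?u t)) (left_of c)) (heads (snd (run ?u t)) c),
     north = cell_colour (run ?u t) c\<rparr>" if "t < T" "c < width" for t c
    using step_tile_run(1)[OF proper_run[of t ?u] _ that(2)] that(1) by (simp add: \<tau>_def Let_def run_def)
  have south: "south (\<tau> r c) = cell_colour (run ?u r) c" if "r \<le> T" "c < width" for r c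
    using that step[of "r - 1" c] by (cases r) (simp_all add: \<tau>_def)
  have sym: "input_symbol ?u c = kind c" if c: "c < width" and k: "kind c \<noteq> 3" for c
  proof -
    consider "c < 2 * length x" | "c = 2 * length x" | "c = 2 * length x + 1" | "c \<ge> input_bound"
      using k unfolding kind_def by (auto split: if_splits)
    then show ?thesis
      using input_symbol_eq[OF len c] len pair_nth(1-4)[where y = y]
      by cases (auto simp: kind_def input_bound_def)
  qed
  have kind3: "kind c = 3 \<longleftrightarrow> 2 * length x + 2 \<le> c \<and> c < input_bound" for c
    by (auto simp: kind_def)
  have ended: "input_symbol ?u c = 0" if "c < width" "kind c = 3" "e (left_of c)" for c
  proof -
    have c0: "c \<noteq> 0" using that(2) by (auto simp: kind3)
    then have "left_of c = c - 1" using that(1) by (simp add: left_of_eq)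
    then have "kind (c - 1) = 3" "input_symbol ?u (c - 1) = 0" using that(3) by (auto simp: e_def)
    moreover have "c - 1 < width" using that(1) by linarith
    ultimately have "length ?u \<le> c - 1"
      using input_symbol_eq[OF len, of "c - 1"] by (cases "c - 1 < length ?u") (simp_all split: if_splits)
    then show ?thesis using input_symbol_eq[OF len that(1)] by simp
  qed
  have tiles: "\<tau> r c \<in> class_tiles M (cell_class r c)" if "r \<le> T" "c < width" for r c
  proof (cases r)
    case 0
    have k: "kind c < 4" by (simp add: kind_def)
    have cls: "class_tiles M (cell_class r c) = init_tiles M (kind c) (c = 0)"
      using 0 k by (auto simp: class_tiles_def cell_class_def)
    have "\<tau> r c = init_tile M (kind c) (c = 0) (input_symbol ?u c) (e (left_of c))
        (fst (run ?u T)) (symbols (snd (run ?u T)) c) (heads (snd (run ?u T)) c)"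
      using 0 initial_colour[OF that(2), of ?u] by (simp add: \<tau>_def init_tile_def e_def cell_colour_def[of "run ?u T"])
    moreover have "fst (run ?u T) < num_states M" using proper_run[of T ?u] by (simp add: proper_def)
    moreover have "input_symbol ?u c < 3" by (simp add: input_symbol_def string_contents_def)
    moreover have "if kind c = 3 then e (left_of c) \<longrightarrow> input_symbol ?u c = 0 else input_symbol ?u c = kind c"
      using sym[OF that(2)] ended[OF that(2)] by simp
    moreover have "c = 0 \<longrightarrow> symbols (snd (run ?u T)) c ! (num_tapes M - 1) = 2" using last_symbol acc by simp
    ultimately show ?thesis
      unfolding cls init_tiles_def using proper_vectors[OF proper_run] by blast
  next
    case (Suc t)
    have cls: "class_tiles M (cell_class r c) = step_tiles M" by (simp add: class_tiles_def cell_class_def Suc)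
    have "fst (run ?u t) < num_states M" using proper_run[of t ?u] by (simp add: proper_def)
    moreover have "t \<le> T" using that Suc by simp
    moreover have "\<tau> r c = step_tile M (fst (run ?u t)) (map read_tape (snd (run ?u t))) (symbols (snd (run ?u t)) c)
         (heads (snd (run ?u t)) (left_of c)) (heads (snd (run ?u t)) c) (heads (snd (run ?u t)) (right_of c))"
      by (simp add: \<tau>_def Suc Let_def)
    ultimately show ?thesis
      unfolding cls step_tiles_def
      using step_tile_run(2)[OF proper_run[of t ?u] _ that(2)] proper_vectors[OF proper_run] by blast
  qed
  have "is_tiling \<tau>"
    unfolding is_tiling_def
  proof (intro allI impI conjI)
    fix r c assume rc: "r \<le> T" "c < width"
    show "\<tau> r c \<in> class_tiles M (cell_class r c)" by (rule tiles[OF rc])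
    note lr = left_right[OF rc(2)]
    show "west (\<tau> r c) = east (\<tau> r (left_of c))"
    proof (cases r)
      case 0
      then show ?thesis by (simp add: \<tau>_def)
    next
      case (Suc t)
      then show ?thesis using rc step[of t c] step[of t "left_of c"] lr by simp
    qed
    show "north (\<tau> r c) = south (\<tau> (if r = 0 then T else r - 1) c)"
    proof (cases r)
      case 0
      then show ?thesis using south[of T c] rc by (simp add: \<tau>_def)
    next
      case (Suc t)
      then show ?thesis using rc step[of t c] south[of t c] by simp
    qed
  qed
  then show ?thesis by blast
qed

lemma tiling_imp_accepts:
  assumes "is_tiling \<tau>"
  shows "\<exists>y. length y \<le> P \<and> accepts (string_pair x y)"
proof -
  have mem: "\<tau> r c \<in> class_tiles M (cell_class r c)"
    and west: "west (\<tau> r c) = east (\<tau> r (left_of c))"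
    and north: "north (\<tau> r c) = south (\<tau> (if r = 0 then T else r - 1) c)" if "r \<le> T" "c < width" for r c
    using assms that unfolding is_tiling_def by blast+
  have k4: "kind c < 4" for c by (simp add: kind_def)
  have "\<tau> 0 c \<in> init_tiles M (kind c) (c = 0)" if "c < width" for c
    using mem[OF le0 that] k4[of c] by (auto simp: class_tiles_def cell_class_def split: if_splits)
  moreover define R where "R c a w q ss hs \<longleftrightarrow> \<tau> 0 c = init_tile M (kind c) (c = 0) a w q ss hs \<and>
      (if kind c = 3 then w \<longrightarrow> a = 0 else a = kind c) \<and> (c = 0 \<longrightarrow> ss ! (num_tapes M - 1) = 2) \<and> a < 3" for c a w q ss hs
  ultimately have "\<exists>a w q ss hs. R c a w q ss hs" if "c < width" for c
    using that unfolding init_tiles_def by blast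
  then obtain a w q0 ss0 hs0 where R: "\<And>c. c < width \<Longrightarrow> R c (a c) (w c) (q0 c) (ss0 c) (hs0 c)"
    by metis
  have row0: "\<tau> 0 c = init_tile M (kind c) (c = 0) (a c) (w c) (q0 c) (ss0 c) (hs0 c)"
    and a: "if kind c = 3 then w c \<longrightarrow> a c = 0 else a c = kind c"
    and fin: "c = 0 \<longrightarrow> ss0 c ! (num_tapes M - 1) = 2" and a3: "a c < 3" if "c < width" for c
    using R[OF that] unfolding R_def by blast+
  let ?s = "2 * length x + 2"
  have kind3: "kind c = 3 \<longleftrightarrow> ?s \<le> c \<and> c < input_bound" for c
    by (auto simp: kind_def)
  have ended: "a (?s + Suc j) = 0" if "Suc j < P" "a (?s + j) = 0" for j
  proof -
    let ?c = "?s + Suc j"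
    have c: "?c < width" "?s + j < width" "kind ?c = 3" "kind (?s + j) = 3"
      using that(1) width_bounds(2) by (simp_all add: kind3 input_bound_def)
    have "left_of ?c = ?s + j" using left_of_eq[OF c(1)] by simp
    then have "w ?c" using west[OF le0 c(1)] row0[OF c(1)] row0[OF c(2)] c(4) that(2) by (simp add: init_tile_def)
    then show ?thesis using a[OF c(1)] c(3) by simp
  qed
  \<comment> \<open>The certificate ends at the first blank or fills all \<open>P\<close>
    cells.\<close>
  define l where "l = (LEAST j. j = P \<or> a (?s + j) = 0)"
  have l: "l = P \<or> a (?s + l) = 0" unfolding l_def by (rule LeastI[of _ P]) simp
  have l_min: "j \<noteq> P \<and> a (?s + j) \<noteq> 0" if "j < l" for j
    using not_less_Least[of j "\<lambda>j. j = P \<or> a (?s + j) = 0"] that unfolding l_def by blast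
  have lP: "l \<le> P" unfolding l_def by (rule Least_le) simp
  have after: "a (?s + j) = 0" if "l \<le> j" "j < P" for j
    using that
  proof (induction j rule: dec_induct)
    case base
    then show ?case using l by simp
  next
    case (step j)
    then show ?case using ended[of j] by simp
  qed
  define y where "y = map (\<lambda>j. a (?s + j) = 2) [0..<l]"
  let ?u = "string_pair x y"
  have ylen: "length y = l" by (simp add: y_def)
  have len: "length ?u = ?s + l" by (simp add: pair_nth ylen)
  then have len_le: "length ?u \<le> input_bound" using lP by (simp add: input_bound_def)
  have a_eq: "a c = input_symbol ?u c" if c: "c < width" for c
  proof -
    consider "c < 2 * length x" | "c = 2 * length x" | "c = 2 * length x + 1"
      | "?s \<le> c" "c < input_bound" | "c \<ge> input_bound" by linarith
    then show ?thesis
    proof cases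
      case 4
      define j where "j = c - ?s"
      have 4: "c = ?s + j" "j < P" using 4 by (auto simp: j_def input_bound_def)
      show ?thesis
      proof (cases "j < l")
        case True
        then have "a c \<noteq> 0" "a c < 3" using l_min 4 a3[OF c] by auto
        moreover have "?u ! c = (a c = 2)" using True pair_nth(5)[where y = y and j = j] 4(1) by (simp add: y_def)
        ultimately show ?thesis using input_symbol_eq[OF len_le c] True 4(1) len by auto
      next
        case False
        then show ?thesis using after[of j] 4 input_symbol_eq[OF len_le c] len by simp
      qed
    qed (use a[OF c] input_symbol_eq[OF len_le c] len len_le pair_nth(1-4)[where y = y] in \<open>auto simp: kind_def input_bound_def\<close>)
  qed
  have south: "\<forall>c<width. south (\<tau> t c) = cell_colour (run ?u t) c" if "t \<le> T" for t
    using that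
  proof (induction t)
    case 0
    then show ?case using row0 initial_colour a_eq by (simp add: init_tile_def)
  next
    case (Suc t)
    let ?cf = "run ?u t"
    let ?ts = "snd ?cf"
    have prp: "proper t ?cf" by (rule proper_run)
    have tT: "t \<le> T" "Suc t \<le> T" using Suc.prems by simp_all
    have IH: "south (\<tau> t c) = cell_colour ?cf c" if "c < width" for c using Suc.IH tT that by simp
    have mem_step: "\<tau> (Suc t) c \<in> step_tiles M" if "c < width" for c
      using mem[OF tT(2) that] by (simp add: class_tiles_def cell_class_def)
    define R where "R c q as ss hl hs hr \<longleftrightarrow> \<tau> (Suc t) c = step_tile M q as ss hl hs hr \<and>
        as \<in> symbol_vectors M \<and> (\<forall>i<num_tapes M. hs ! i \<longrightarrow> ss ! i = as ! i)" for c q as ss hl hs hr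
    have "\<exists>q as ss hl hs hr. R c q as ss hl hs hr" if "c < width" for c
      using mem_step[OF that] unfolding step_tiles_def R_def mem_Collect_eq by (elim exE conjE) (intro exI conjI)
    then obtain q as ss hl hs hr where R: "\<And>c. c < width \<Longrightarrow> R c (q c) (as c) (ss c) (hl c) (hs c) (hr c)"
      by metis
    have tile: "\<tau> (Suc t) c = step_tile M (q c) (as c) (ss c) (hl c) (hs c) (hr c)"
      and as: "as c \<in> symbol_vectors M"
      and scan: "\<forall>i<num_tapes M. hs c ! i \<longrightarrow> ss c ! i = as c ! i" if "c < width" for c
      using R[OF that] unfolding R_def by blast+
    have cell: "q c = fst ?cf" "ss c = symbols ?ts c" "hs c = heads ?ts c" if "c < width" for c
      using north[OF tT(2) that] IH[OF that] tile[OF that] by (simp_all add: step_tile_def Let_def cell_colour_def)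
    have row: "as c = as (left_of c)" "hl c = hs (left_of c)" "hr (left_of c) = hs c" if "c < width" for c
      using west[OF tT(2) that] tile[OF that] tile[OF left_right(3)[OF that]]
      by (simp_all add: step_tile_def Let_def)
    \<comment> \<open>The scanned symbols are part of the horizontal colours, hence constant along
      the row.\<close>
    have as0: "as c = as 0" if "c < width" for c
      using that
    proof (induction c)
      case (Suc c)
      have "left_of (Suc c) = c" using left_of_eq[OF Suc.prems] by simp
      then show ?case using row(1)[OF Suc.prems] Suc by simp
    qed simp
    have w0: "0 < width" using width_bounds by simp
    have len_ts: "length ?ts = num_tapes M" using prp by (simp add: proper_def)
    \<comment> \<open>Every head is in some column, and there the tile ties the guessed symbol to
      the one on the tape.\<close>
    have scanned: "as 0 = map read_tape ?ts"
    proof (rule nth_equalityI)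
      show "length (as 0) = length (map read_tape ?ts)" using as[OF w0] len_ts by (simp add: symbol_vectors_def)
      fix i assume "i < length (as 0)"
      then have i: "i < num_tapes M" using as[OF w0] by (simp add: symbol_vectors_def)
      let ?h = "fst (?ts ! i)"
      define c where "c = nat (?h mod int width)"
      have c: "c < width" "?h mod int width = int c" using w0 by (simp_all add: c_def nat_less_iff)
      have "?ts ! i \<in> set ?ts" using i len_ts by simp
      then have "\<bar>?h\<bar> \<le> int t" using prp unfolding proper_def by blast
      then have pos: "position c = ?h" using position_eq_iff[OF c(1), of ?h] c(2) tT by simp
      have "hs c ! i" using cell(3)[OF c(1)] c(2) i len_ts by (simp add: heads_def)
      then have "as c ! i = symbols ?ts c ! i" using scan[OF c(1)] i cell(2)[OF c(1)] by simp
      also have "\<dots> = read_tape (?ts ! i)" using i len_ts pos by (simp add: symbols_def read_tape_eq)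
      finally show "as 0 ! i = map read_tape ?ts ! i" using as0[OF c(1)] i len_ts by simp
    qed
    show ?case
    proof (intro allI impI)
      fix c assume c: "c < width"
      note lr = left_right[OF c]
      have "hl c = heads ?ts (left_of c)" using row(2)[OF c] cell(3)[OF lr(3)] by simp
      moreover have "hr c = heads ?ts (right_of c)"
        using row(3)[OF lr(4)] cell(3)[OF lr(4)] unfolding lr(1) by simp
      ultimately have "\<tau> (Suc t) c = step_tile M (fst ?cf) (map read_tape ?ts) (symbols ?ts c)
          (heads ?ts (left_of c)) (heads ?ts c) (heads ?ts (right_of c))"
        using tile[OF c] cell[OF c] as0[OF c] scanned by simp
      then show "south (\<tau> (Suc t) c) = cell_colour (run ?u (Suc t)) c"
        using step_tile_run(1)[OF prp tT(1) c] by (simp add: run_def)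
    qed
  qed
  have w0: "0 < width" using width_bounds by simp
  \<comment> \<open>Across the seam, the last row meets the inspecting tile of column 0.\<close>
  have "cell_colour (run ?u T) 0 = north (\<tau> 0 0)" using north[OF le0 w0] south[OF order_refl] w0 by simp
  also have "\<dots> = Cell (q0 0) (ss0 0) (hs0 0)" using row0[OF w0] by (simp add: init_tile_def)
  finally have "symbols (snd (run ?u T)) 0 ! (num_tapes M - 1) = 2" using fin[OF w0] by (simp add: cell_colour_def)
  then have "accepts ?u" using last_symbol by blast
  then show ?thesis using lP ylen by blast
qed

end

section \<open>Register programs and their compilation\<close>

datatype test = NonZero nat | InputLeft
datatype basic = Inc nat | Dec nat | InR | InL | Get nat | Out nat
datatype com = Basic basic | Seq com com | While test com

text \<open>Register contents, position of the input head, and the output printed so far.\<close>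

type_synonym cstate = "(nat \<Rightarrow> nat) \<times> int \<times> bool list"

fun test_holds :: "bool list \<Rightarrow> test \<Rightarrow> cstate \<Rightarrow> bool" where
  "test_holds x (NonZero r) (f, p, w) \<longleftrightarrow> f r \<noteq> 0"
| "test_holds x InputLeft (f, p, w) \<longleftrightarrow> string_contents x p \<noteq> 0"

fun do_basic :: "bool list \<Rightarrow> basic \<Rightarrow> cstate \<Rightarrow> cstate" where
  "do_basic x (Inc r) (f, p, w) = (f(r := f r + 1), p, w)"
| "do_basic x (Dec r) (f, p, w) = (f(r := f r - 1), p, w)"
| "do_basic x InR (f, p, w) = (f, p + 1, w)"
| "do_basic x InL (f, p, w) = (f, p - 1, w)"
| "do_basic x (Get r) (f, p, w) = (if string_contents x p = 2 then f(r := f r + 1) else f, p, w)"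
| "do_basic x (Out r) (f, p, w) = (f, p, w @ [f r \<noteq> 0])"

text \<open>The count is that of the compiled code: a failed test is one instruction, and each loop
  round adds the test and the jump back.\<close>

inductive big :: "bool list \<Rightarrow> com \<Rightarrow> cstate \<Rightarrow> nat \<Rightarrow> cstate \<Rightarrow> bool" for x where
  big_Basic: "big x (Basic b) s 1 (do_basic x b s)"
| big_Seq: "big x c1 s t1 s' \<Longrightarrow> big x c2 s' t2 s'' \<Longrightarrow> big x (Seq c1 c2) s (t1 + t2) s''"
| big_WhileF: "\<not> test_holds x b s \<Longrightarrow> big x (While b c) s 1 s"
| big_WhileT: "test_holds x b s \<Longrightarrow> big x c s t1 s' \<Longrightarrow> big x (While b c) s' t2 s'' \<Longrightarrow>
    big x (While b c) s (t1 + t2 + 2) s''"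

datatype instr = Do basic | JmpUnless test nat | Jmp nat

fun comp_size :: "com \<Rightarrow> nat" where
  "comp_size (Basic b) = 1"
| "comp_size (Seq c d) = comp_size c + comp_size d"
| "comp_size (While b c) = comp_size c + 2"

fun comp :: "com \<Rightarrow> nat \<Rightarrow> instr list" where
  "comp (Basic b) a = [Do b]"
| "comp (Seq c d) a = comp c a @ comp d (a + comp_size c)"
| "comp (While b c) a = JmpUnless b (a + comp_size c + 2) # comp c (a + 1) @ [Jmp a]"

lemma length_comp [simp]: "length (comp c a) = comp_size c"
  by (induction c arbitrary: a) auto

text \<open>Clamped jump targets keep the counter at most \<open>length P\<close>, the halting state
  of the machine.\<close>

fun instr_step :: "bool list \<Rightarrow> instr list \<Rightarrow> nat \<times> cstate \<Rightarrow> nat \<times> cstate" where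
  "instr_step x P (pc, s) = (if pc < length P then
     (case P ! pc of
        Do b \<Rightarrow> (pc + 1, do_basic x b s)
      | JmpUnless b a \<Rightarrow> (if test_holds x b s then pc + 1 else min a (length P), s)
      | Jmp a \<Rightarrow> (min a (length P), s))
     else (pc, s))"

text \<open>Code is generated for its absolute address, so the surrounding program
  \<open>P1\<close>, \<open>P2\<close> is generalized in the induction.\<close>

lemma comp_correct:
  assumes "big x c s t s'" "P = P1 @ comp c (length P1) @ P2"
  shows "(instr_step x P ^^ t) (length P1, s) = (length P1 + comp_size c, s')"
  using assms
proof (induction arbitrary: P1 P2 rule: big.induct)
  case (big_Basic b s)
  then show ?case by simp
next
  case (big_Seq c1 s t1 s' c2 t2 s'')
  have 1: "(instr_step x P ^^ t1) (length P1, s) = (length P1 + comp_size c1, s')"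
    using big_Seq.IH(1)[of P1 "comp c2 (length P1 + comp_size c1) @ P2"] big_Seq.prems by simp
  have 2: "(instr_step x P ^^ t2) (length P1 + comp_size c1, s') =
      (length P1 + comp_size c1 + comp_size c2, s'')"
    using big_Seq.IH(2)[of "P1 @ comp c1 (length P1)" P2] big_Seq.prems by simp
  have "instr_step x P ^^ (t1 + t2) = (instr_step x P ^^ t2) \<circ> (instr_step x P ^^ t1)"
    by (metis add.commute funpow_add)
  then show ?case using 1 2 by simp
next
  case (big_WhileF b s c)
  then show ?case by (simp add: nth_append)
next
  case (big_WhileT b s c t1 s' t2 s'')
  let ?f = "instr_step x P" and ?a = "length P1"
  have len: "length P = ?a + comp_size c + 2 + length P2" using big_WhileT.prems by simp
  have P: "P = P1 @ JmpUnless b (?a + comp_size c + 2) # comp c (?a + 1) @ Jmp ?a # P2"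
    using big_WhileT.prems by simp
  have 0: "?f (?a, s) = (?a + 1, s)" using big_WhileT.hyps(1) len P by (simp add: nth_append)
  have 1: "(?f ^^ t1) (?a + 1, s) = (?a + 1 + comp_size c, s')"
    using big_WhileT.IH(1)[of "P1 @ [JmpUnless b (?a + comp_size c + 2)]" "Jmp ?a # P2"] P
    by simp
  have "P ! (?a + 1 + comp_size c) = Jmp ?a" using P by (simp add: nth_append)
  then have 2: "?f (?a + 1 + comp_size c, s') = (?a, s')" using len by simp
  have 3: "(?f ^^ t2) (?a, s') = (?a + comp_size c + 2, s'')"
    using big_WhileT.IH(2)[of P1 P2] big_WhileT.prems by simp
  have "?f ^^ (t1 + t2 + 2) = (?f ^^ t2) \<circ> ?f \<circ> (?f ^^ t1) \<circ> ?f"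
    by (simp add: add.commute[of t1] funpow_add comp_assoc funpow_swap1 fun_eq_iff)
  then show ?case using 0 1 2 3 by simp
qed

fun test_reg :: "test \<Rightarrow> nat" where
  "test_reg (NonZero r) = r" | "test_reg InputLeft = 0"
fun basic_reg :: "basic \<Rightarrow> nat" where
  "basic_reg (Inc r) = r" | "basic_reg (Dec r) = r" | "basic_reg InR = 0" | "basic_reg InL = 0"
| "basic_reg (Get r) = r" | "basic_reg (Out r) = r"
fun instr_reg :: "instr \<Rightarrow> nat" where
  "instr_reg (Do b) = basic_reg b" | "instr_reg (JmpUnless b a) = test_reg b"
| "instr_reg (Jmp a) = 0"

text \<open>
  Tape 0 is the input, tape \<open>r + 1\<close> holds register \<open>r\<close> as the distance of its head from a cell
  marked 1, and tape \<open>k + 1\<close> is the output.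
\<close>

fun sym_test :: "test \<Rightarrow> nat list \<Rightarrow> bool" where
  "sym_test (NonZero r) as \<longleftrightarrow> as ! (r + 1) \<noteq> 1"
| "sym_test InputLeft as \<longleftrightarrow> as ! 0 \<noteq> 0"

fun basic_act :: "nat \<Rightarrow> basic \<Rightarrow> nat list \<Rightarrow> nat \<Rightarrow> nat \<times> direction" where
  "basic_act k (Inc r) as i = (as ! i, if i = r + 1 then MoveR else Stay)"
| "basic_act k (Dec r) as i = (as ! i, if i = r + 1 \<and> as ! i \<noteq> 1 then MoveL else Stay)"
| "basic_act k InR as i = (as ! i, if i = 0 then MoveR else Stay)"
| "basic_act k InL as i = (as ! i, if i = 0 then MoveL else Stay)"
| "basic_act k (Get r) as i = (as ! i, if i = r + 1 \<and> as ! 0 = 2 then MoveR else Stay)"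
| "basic_act k (Out r) as i =
     (if i = k + 1 then (if as ! (r + 1) = 1 then 1 else 2, MoveR) else (as ! i, Stay))"

text \<open>Instructions are the states below \<open>length P\<close>. The last branch serves the
  start state: it marks the origin of every register tape and enters instruction 0.\<close>

definition prog_delta :: "instr list \<Rightarrow> nat \<Rightarrow> nat \<Rightarrow> nat list \<Rightarrow> nat \<times> (nat \<times> direction) list" where
  "prog_delta P k q as =
    (if q < length P then
       (case P ! q of
          Do b \<Rightarrow> (q + 1, map (basic_act k b as) [0..<k + 2])
        | JmpUnless b a \<Rightarrow> (if sym_test b as then q + 1 else min a (length P), map (\<lambda>i. (as ! i, Stay)) [0..<k + 2])
        | Jmp a \<Rightarrow> (min a (length P), map (\<lambda>i. (as ! i, Stay)) [0..<k + 2]))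
     else (0, map (\<lambda>i. (if i = 0 \<or> i = k + 1 then as ! i else 1, Stay)) [0..<k + 2]))"

definition prog_tm :: "instr list \<Rightarrow> nat \<Rightarrow> tm" where
  "prog_tm P k = \<lparr>num_tapes = k + 2, num_syms = 3, num_states = length P + 2,
     start_state = length P + 1, halt_state = length P, delta = prog_delta P k\<rparr>"

lemma wf_prog_tm: "wf_tm (prog_tm P k)"
proof -
  have nth: "as ! i < 3" if "length as = k + 2" "\<forall>a\<in>set as. a < 3" "i < k + 2" for as :: "nat list" and i
    using that by auto
  have "fst (basic_act k b as i) < 3" if "length as = k + 2" "\<forall>a\<in>set as. a < 3" "i < k + 2" for b as i
    using nth[OF that] by (cases b) auto
  then have *: "\<forall>z\<in>set (map (basic_act k b as) [0..<k + 2]). fst z < 3"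
    if "length as = k + 2" "\<forall>a\<in>set as. a < 3" for b as
    using that by (auto simp del: upt_Suc)
  show ?thesis
    unfolding wf_tm_def prog_tm_def
    using nth * by (auto simp: prog_delta_def case_prod_beta simp del: upt_Suc split: instr.split)
qed

definition reg_mark :: "int \<Rightarrow> nat" where
  "reg_mark = (\<lambda>_. 0)(0 := 1)"

definition prog_config :: "bool list \<Rightarrow> nat \<Rightarrow> nat \<times> cstate \<Rightarrow> config" where
  "prog_config x k = (\<lambda>(pc, f, p, w). (pc,
     map (\<lambda>i. if i = 0 then (p, string_contents x)
              else if i = k + 1 then (int (length w), string_contents w)
              else (int (f (i - 1)), reg_mark)) [0..<k + 2]))"

lemma string_contents_append:
  "(string_contents w)(int (length w) := (if b then 2 else 1)) = string_contents (w @ [b])"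
  by (rule ext) (auto simp: string_contents_def nth_append)

lemma map2_map_map: "map2 f (map g xs) (map h xs) = map (\<lambda>i. f (g i) (h i)) xs"
  by (simp add: zip_map_map zip_same_conv_map)

text \<open>Machine and program run in lockstep. Untouched cells are rewritten with their own
  symbol, and a zero register is recognized by the mark under its head.\<close>

lemma prog_step:
  assumes "\<forall>i\<in>set P. instr_reg i < k" "pc < length P"
  shows "tm_step (prog_tm P k) (prog_config x k (pc, s)) = prog_config x k (instr_step x P (pc, s))"
proof -
  obtain f p w where s: "s = (f, p, w)" by (cases s)
  let ?tp = "\<lambda>f p w i. if i = 0 then (p, string_contents x)
              else if i = k + 1 then (int (length w), string_contents w)
              else (int (f (i - 1)), reg_mark)"
  let ?as = "map (\<lambda>i. read_tape (?tp f p w i)) [0..<k + 2]"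
  have reg: "instr_reg (P ! pc) < k" using assms by simp
  have as: "?as ! i = read_tape (?tp f p w i)" if "i < k + 2" for i
    using that by (simp del: upt_Suc)
  have [simp]: "h + 0 = h" for h :: int by simp
  have rm: "reg_mark (int n) = (if n = 0 then 1 else 0)" for n by (simp add: reg_mark_def)
  have act: "act_tape (basic_act k b ?as i) (?tp f p w i) =
      (case do_basic x b s of (f', p', w') \<Rightarrow> ?tp f' p' w' i)" if b: "basic_reg b < k" and i: "i < k + 2" for b i
  proof -
    define as where "as = ?as"
    have sc: "string_contents w (int (length w)) = 0" by (simp add: string_contents_def)
    have a0: "as ! 0 = string_contents x p" using as[of 0] by (simp add: as_def del: upt_Suc)
    have ar: "as ! Suc r = (if f r = 0 then 1 else 0)" if "r < k" for r
      using as[of "r + 1"] that by (simp add: as_def rm del: upt_Suc)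
    have ak: "as ! Suc k = 0" using as[of "k + 1"] sc by (simp add: as_def del: upt_Suc)
    have blank: "(string_contents w)(int (length w) := 0) = string_contents w" using sc by (auto simp: fun_eq_iff)
    consider "i = 0" | "i = Suc k" | r where "i = Suc r" "r < k"
      using i by (cases i) (auto simp: less_Suc_eq)
    then have "act_tape (basic_act k b as i) (?tp f p w i) =
      (case do_basic x b s of (f', p', w') \<Rightarrow> ?tp f' p' w' i)"
    proof cases
      case 1
      then show ?thesis using a0 b by (cases b) (simp_all add: s)
    next
      case 2
      then show ?thesis using a0 ak ar[of "basic_reg b"] b blank
        by (cases b) (simp_all add: s string_contents_append[symmetric])
    next
      case (3 r)
      have "(reg_mark(int (f r) := (if f r = 0 then 1 else 0))) = reg_mark" by (auto simp: reg_mark_def)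
      then show ?thesis using 3 a0 ar[of r] ar[of "basic_reg b"] b
        by (cases b; cases "f r = 0") (auto simp: s)
    qed
    then show ?thesis by (simp only: as_def)
  qed
  have stay: "act_tape (?as ! i, Stay) (?tp f p w i) = ?tp f p w i" if "i < k + 2" for i
  proof -
    obtain h c where "?tp f p w i = (h, c)" by (cases "?tp f p w i")
    then show ?thesis using as[OF that] by (simp del: upt_Suc)
  qed
  have tst: "sym_test b ?as = test_holds x b s" if "test_reg b < k" for b
    using that as[of 0] as[of "test_reg b + 1"] by (cases b) (auto simp: s rm simp del: upt_Suc)
  have cfg: "prog_config x k (pc', f', p', w') = (pc', map (?tp f' p' w') [0..<k + 2])" for pc' f' p' w'
    by (simp add: prog_config_def del: upt_Suc)
  have read: "map read_tape (map (?tp f p w) [0..<k + 2]) = ?as" by (simp del: upt_Suc)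
  show ?thesis
  proof (cases "P ! pc")
    case (Do b)
    obtain f' p' w' where d: "do_basic x b s = (f', p', w')" by (cases "do_basic x b s")
    have "map (\<lambda>i. act_tape (basic_act k b ?as i) (?tp f p w i)) [0..<k + 2] = map (?tp f' p' w') [0..<k + 2]"
      by (intro map_cong refl) (use act reg Do d in \<open>simp del: upt_Suc\<close>)
    then have "tm_step (prog_tm P k) (prog_config x k (pc, s)) = (pc + 1, map (?tp f' p' w') [0..<k + 2])"
      using assms Do
      by (simp only: s cfg tm_step.simps read map2_map_map prog_tm_def tm.simps prog_delta_def instr.case if_True prod.case)
         simp
    then show ?thesis using Do d assms s by (simp add: cfg del: upt_Suc)
  next
    case (JmpUnless b a)
    have "map (\<lambda>i. act_tape (?as ! i, Stay) (?tp f p w i)) [0..<k + 2] = map (?tp f p w) [0..<k + 2]"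
      by (intro map_cong refl) (use stay in \<open>simp del: upt_Suc\<close>)
    then have "tm_step (prog_tm P k) (prog_config x k (pc, s)) =
      (if test_holds x b s then pc + 1 else min a (length P), map (?tp f p w) [0..<k + 2])"
      using assms JmpUnless tst reg
      by (simp only: s cfg tm_step.simps read map2_map_map prog_tm_def tm.simps prog_delta_def instr.case if_True prod.case)
         (simp del: upt_Suc)
    then show ?thesis using JmpUnless assms s by (simp add: cfg del: upt_Suc)
  next
    case (Jmp a)
    have "map (\<lambda>i. act_tape (?as ! i, Stay) (?tp f p w i)) [0..<k + 2] = map (?tp f p w) [0..<k + 2]"
      by (intro map_cong refl) (use stay in \<open>simp del: upt_Suc\<close>)
    then have "tm_step (prog_tm P k) (prog_config x k (pc, s)) =
      (min a (length P), map (?tp f p w) [0..<k + 2])"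
      using assms Jmp reg
      by (simp only: s cfg tm_step.simps read map2_map_map prog_tm_def tm.simps prog_delta_def instr.case if_True prod.case)
         (simp del: upt_Suc)
    then show ?thesis using Jmp assms s by (simp add: cfg del: upt_Suc)
  qed
qed

lemma prog_start: "tm_step (prog_tm P k) (init_config (prog_tm P k) x) = prog_config x k (0, \<lambda>_. 0, 0, [])"
proof -
  let ?ts = "\<lambda>i. if i = 0 then (0 :: int, string_contents x) else (0, string_contents [])"
  have init: "init_config (prog_tm P k) x = (length P + 1, map ?ts [0..<k + 2])"
    unfolding init_config_def prog_tm_def
    by (auto simp: list_eq_iff_nth_eq nth_Cons' simp del: upt_Suc)
  let ?as = "map read_tape (map ?ts [0..<k + 2])"
  have blank: "string_contents [] = (\<lambda>_. 0)" by (simp add: string_contents_def fun_eq_iff)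
  have "tm_step (prog_tm P k) (length P + 1, map ?ts [0..<k + 2]) = (0, map (\<lambda>i. act_tape
      (if i = 0 \<or> i = k + 1 then ?as ! i else 1, Stay) (?ts i)) [0..<k + 2])"
    by (simp add: prog_tm_def prog_delta_def map2_map_map del: upt_Suc)
  also have "\<dots> = prog_config x k (0, \<lambda>_. 0, 0, [])"
    unfolding prog_config_def prod.case prod.inject
    by (intro conjI refl map_cong) (auto simp: reg_mark_def blank simp del: upt_Suc)
  finally show ?thesis unfolding init .
qed

lemma tm_halt_stays: "fst c = halt_state M \<Longrightarrow> (tm_step M ^^ t) c = c"
  by (induction t) (cases c; simp)+

lemma computes_within_mono:
  assumes "computes_within M t x y" "t \<le> t'"
  shows "computes_within M t' x y"
proof -
  have "(tm_step M ^^ t') (init_config M x) = (tm_step M ^^ (t' - t)) ((tm_step M ^^ t) (init_config M x))"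
    using assms(2) by (metis comp_apply funpow_add le_add_diff_inverse2)
  then show ?thesis
    using assms(1) tm_halt_stays[of "(tm_step M ^^ t) (init_config M x)" M "t' - t"]
    by (auto simp: computes_within_def split: prod.splits)
qed

lemma poly_time_com:
  fixes p :: "nat poly"
  assumes "\<And>x. \<exists>t \<le> poly p (length x). \<exists>r h. big x c (\<lambda>_. 0, 0, []) t (r, h, f x)"
  shows "poly_time f"
proof -
  define P where "P = comp c 0"
  define k where "k = Max (insert 0 (instr_reg ` set P)) + 1"
  have k: "\<forall>i\<in>set P. instr_reg i < k" unfolding k_def by (auto simp: less_Suc_eq_le)
  have len: "length P = comp_size c" by (simp add: P_def)
  have sim: "(tm_step (prog_tm P k) ^^ t) (prog_config x k (0, s)) =
      prog_config x k ((instr_step x P ^^ t) (0, s)) \<and> fst ((instr_step x P ^^ t) (0, s)) \<le> length P" for x t s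
  proof (induction t)
    case (Suc t)
    obtain pc s' where e: "(instr_step x P ^^ t) (0, s) = (pc, s')"
      by (cases "(instr_step x P ^^ t) (0, s)")
    show ?case
    proof (cases "pc < length P")
      case True
      then show ?thesis using Suc e prog_step[OF k True, of x s'] by (auto split: instr.split)
    next
      case False
      then have "pc = halt_state (prog_tm P k)" using Suc e by (simp add: prog_tm_def)
      then show ?thesis using Suc e False by (simp add: prog_config_def split: prod.split)
    qed
  qed simp
  \<comment> \<open>The additional step is the one that sets the marks.\<close>
  have "computes_within (prog_tm P k) (poly (p + 1) (length x)) x (f x)" for x
  proof -
    obtain t r h where t: "t \<le> poly p (length x)" and "big x c (\<lambda>_. 0, 0, []) t (r, h, f x)"
      using assms by blast
    then have "(instr_step x P ^^ t) (0, \<lambda>_. 0, 0, []) = (length P, r, h, f x)"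
      using comp_correct[of x c _ t _ P "[]" "[]"] by (simp add: P_def)
    then have "(tm_step (prog_tm P k) ^^ Suc t) (init_config (prog_tm P k) x) = prog_config x k (length P, r, h, f x)"
      unfolding funpow_Suc_right by (simp only: o_apply prog_start sim)
    then have "computes_within (prog_tm P k) (Suc t) x (f x)"
      by (simp add: computes_within_def prog_config_def prog_tm_def)
    then show ?thesis by (rule computes_within_mono) (use t in simp)
  qed
  then show ?thesis unfolding poly_time_def using wf_prog_tm by blast
qed

section \<open>Rules for bounding running times\<close>

definition runs :: "bool list \<Rightarrow> com \<Rightarrow> cstate \<Rightarrow> nat \<Rightarrow> cstate \<Rightarrow> bool" where
  "runs x c s b s' \<longleftrightarrow> (\<exists>t\<le>b. big x c s t s')"

notation Seq (infixr ";;" 60)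

lemma runs_Basic: "do_basic x b s = s' \<Longrightarrow> runs x (Basic b) s 1 s'"
  unfolding runs_def using big_Basic by blast

lemma runs_Seq:
  assumes "runs x c1 s b1 s'" "runs x c2 s' b2 s''"
  shows "runs x (c1 ;; c2) s (b1 + b2) s''"
  using assms unfolding runs_def by (meson add_mono big_Seq)

lemma runs_cong:
  assumes "runs x c s b s'" "s' = s''" "b \<le> b'"
  shows "runs x c s b' s''"
  using assms unfolding runs_def by (meson order_trans)

text \<open>\<open>st k\<close> is the state when \<open>k\<close> more iterations are to come.\<close>

lemma runs_loop:
  assumes "\<And>k. k < m \<Longrightarrow> runs x c (st (Suc k)) b (st k)"
    and "\<And>k. k \<le> m \<Longrightarrow> test_holds x tst (st k) \<longleftrightarrow> k \<noteq> 0"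
  shows "runs x (While tst c) (st m) (m * (b + 2) + 1) (st 0)"
  using assms
proof (induction m)
  case 0
  then show ?case using big_WhileF[of x tst "st 0" c] by (auto simp: runs_def)
next
  case (Suc m)
  obtain t1 where t1: "t1 \<le> b" "big x c (st (Suc m)) t1 (st m)"
    using Suc.prems(1)[of m] by (auto simp: runs_def)
  have "runs x (While tst c) (st m) (m * (b + 2) + 1) (st 0)" using Suc by simp
  then obtain t2 where t2: "t2 \<le> m * (b + 2) + 1" "big x (While tst c) (st m) t2 (st 0)"
    by (auto simp: runs_def)
  have "test_holds x tst (st (Suc m))" using Suc.prems(2)[of "Suc m"] by simp
  from big_WhileT[OF this t1(2) t2(2)] show ?case
    unfolding runs_def using t1(1) t2(1) by (intro exI[of _ "t1 + t2 + 2"]) auto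
qed

abbreviation inc :: "nat \<Rightarrow> com" where "inc r \<equiv> Basic (Inc r)"
abbreviation dec :: "nat \<Rightarrow> com" where "dec r \<equiv> Basic (Dec r)"
abbreviation while :: "nat \<Rightarrow> com \<Rightarrow> com" where "while r c \<equiv> While (NonZero r) c"

text \<open>The body sees the register already decremented. A round costs \<open>b\<close>, one
  decrement and two loop instructions.\<close>

lemma runs_countdown:
  assumes "\<And>k. k < f r \<Longrightarrow> runs x c ((fst (st (Suc k)))(r := k), snd (st (Suc k))) b (st k)"
    and "\<And>k. k \<le> f r \<Longrightarrow> fst (st k) r = k"
    and "st (f r) = (f, s)"
  shows "runs x (while r (dec r ;; c)) (f, s) (f r * (b + 3) + 1) (st 0)"
proof -
  have "runs x (dec r ;; c) (st (Suc k)) (1 + b) (st k)" if "k < f r" for k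
  proof (rule runs_Seq[OF runs_Basic assms(1)[OF that]])
    show "do_basic x (Dec r) (st (Suc k)) = ((fst (st (Suc k)))(r := k), snd (st (Suc k)))"
      using assms(2)[of "Suc k"] that by (cases "st (Suc k)") simp
  qed
  moreover have "test_holds x (NonZero r) (st k) \<longleftrightarrow> k \<noteq> 0" if "k \<le> f r" for k
    using assms(2)[OF that] by (cases "st k") auto
  ultimately have "runs x (while r (dec r ;; c)) (st (f r)) (f r * (1 + b + 2) + 1) (st 0)"
    by (rule runs_loop)
  from this[unfolded assms(3)] show ?thesis by (rule runs_cong) (simp_all add: algebra_simps)
qed

lemmas runs_straight = runs_Seq[OF runs_Basic[OF refl]] runs_Basic

definition move :: "nat \<Rightarrow> nat \<Rightarrow> com" where
  "move r d = while r (dec r ;; inc d)"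

lemma runs_move:
  assumes "r \<noteq> d"
  shows "runs x (move r d) (f, s) (4 * f r + 1) (f(r := 0, d := f d + f r), s)"
proof -
  obtain p w where s: "s = (p, w)" by (cases s)
  have "runs x (while r (dec r ;; inc d)) (f, s) (f r * (1 + 3) + 1) (f(r := 0, d := f d + f r - 0), s)"
    by (rule runs_countdown[where st = "\<lambda>k. (f(r := k, d := f d + f r - k), s)"], intro runs_straight)
      (use assms in \<open>auto simp: s fun_eq_iff\<close>)
  then show ?thesis by (simp add: move_def algebra_simps)
qed

definition clear :: "nat \<Rightarrow> com" where
  "clear r = while r (dec r)"

lemma runs_clear: "runs x (clear r) (f, s) (3 * f r + 1) (f(r := 0), s)"
proof -
  obtain p w where s: "s = (p, w)" by (cases s)
  have "runs x (clear r) (f(r := f r), s) (f r * (1 + 2) + 1) (f(r := 0), s)"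
    unfolding clear_def
    by (rule runs_loop[where st = "\<lambda>k. (f(r := k), s)"]) (rule runs_Basic, auto simp: s)
  from runs_cong[OF this refl, of "3 * f r + 1"] show ?thesis by simp
qed

text \<open>A register is read by counting it down, so its value goes both to \<open>d\<close> and
  to the scratch register \<open>e\<close>, from which it is restored.\<close>

definition copy :: "nat \<Rightarrow> nat \<Rightarrow> nat \<Rightarrow> com" where
  "copy r d e = (while r (dec r ;; inc d ;; inc e)) ;; move e r"

lemma runs_copy:
  assumes "r \<noteq> d" "r \<noteq> e" "d \<noteq> e" "f e = 0"
  shows "runs x (copy r d e) (f, s) (9 * f r + 2) (f(d := f d + f r), s)"
proof -
  obtain p w where s: "s = (p, w)" by (cases s)
  have "runs x (while r (dec r ;; inc d ;; inc e)) (f, s) (f r * (1 + 1 + 3) + 1)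
      (f(r := 0, d := f d + f r - 0, e := f r - 0), s)"
    by (rule runs_countdown[where st = "\<lambda>k. (f(r := k, d := f d + f r - k, e := f r - k), s)"], intro runs_straight)
      (use assms in \<open>auto simp: s fun_eq_iff\<close>)
  from runs_Seq[OF this runs_move[of e r]] assms
  have "runs x (copy r d e) (f, s) (f r * 5 + 1 + (4 * f r + 1))
     (f(r := 0, d := f d + f r, e := 0, r := f r), s)"
    by (simp add: copy_def fun_upd_twist[of e r] fun_upd_twist[of e d])
  then show ?thesis
    by (rule runs_cong) (use assms in \<open>auto simp: fun_eq_iff\<close>)
qed

section \<open>Polynomially bounded functions\<close>

text \<open>The second argument is the index of a printing loop.\<close>

definition pbounded :: "(bool list \<Rightarrow> nat \<Rightarrow> nat) \<Rightarrow> bool" where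
  "pbounded T \<longleftrightarrow> (\<exists>p :: nat poly. \<forall>x i. T x i \<le> poly p (length x + i))"

lemma poly_nat_mono: "m \<le> n \<Longrightarrow> poly (p :: nat poly) m \<le> poly p n"
  by (induction p) (auto intro: mult_mono add_mono)

lemma pbounded_const: "pbounded (\<lambda>x i. c)"
  unfolding pbounded_def by (rule exI[of _ "[:c:]"]) simp

lemma pbounded_add: "pbounded F \<Longrightarrow> pbounded G \<Longrightarrow> pbounded (\<lambda>x i. F x i + G x i)"
  unfolding pbounded_def
proof (elim exE)
  fix p q :: "nat poly"
  assume "\<forall>x i. F x i \<le> poly p (length x + i)" "\<forall>x i. G x i \<le> poly q (length x + i)"
  then have "\<forall>x i. F x i + G x i \<le> poly (p + q) (length x + i)" by (simp add: add_mono)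
  then show "\<exists>p :: nat poly. \<forall>x i. F x i + G x i \<le> poly p (length x + i)" ..
qed

lemma pbounded_mult: "pbounded F \<Longrightarrow> pbounded G \<Longrightarrow> pbounded (\<lambda>x i. F x i * G x i)"
  unfolding pbounded_def
proof (elim exE)
  fix p q :: "nat poly"
  assume "\<forall>x i. F x i \<le> poly p (length x + i)" "\<forall>x i. G x i \<le> poly q (length x + i)"
  then have "\<forall>x i. F x i * G x i \<le> poly (p * q) (length x + i)" by (simp add: mult_mono)
  then show "\<exists>p :: nat poly. \<forall>x i. F x i * G x i \<le> poly p (length x + i)" ..
qed

lemma pbounded_mono: "pbounded F \<Longrightarrow> (\<And>x i. G x i \<le> F x i) \<Longrightarrow> pbounded G"
  unfolding pbounded_def by (meson order_trans)

lemmas pbounded_intros = pbounded_const pbounded_add pbounded_mult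

lemma pbounded_length: "pbounded (\<lambda>x i. length x)" and pbounded_index: "pbounded (\<lambda>x i. i)"
  unfolding pbounded_def by (rule exI[of _ "[:0, 1:]"], simp)+

section \<open>Arithmetic functions\<close>

text \<open>Register 0 keeps the input length and register 1 the loop index. Registers from
  \<open>d\<close> on are free, while those between may hold operands.\<close>

definition at_rest :: "bool list \<Rightarrow> nat \<Rightarrow> nat \<Rightarrow> (nat \<Rightarrow> nat) \<Rightarrow> bool" where
  "at_rest x i d f \<longleftrightarrow> f 0 = length x \<and> f 1 = i \<and> (\<forall>r\<ge>d. f r = 0)"

text \<open>Registers count in unary, so values as well as running times must be polynomially
  bounded. Code is provided for every \<open>d\<close>, which lets an operation place its operands
  in consecutive registers.\<close>

definition realizable :: "(bool list \<Rightarrow> nat \<Rightarrow> nat) \<Rightarrow> bool" where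
  "realizable F \<longleftrightarrow> pbounded F \<and> (\<forall>d\<ge>2. \<exists>c T. pbounded T \<and>
     (\<forall>x i f w. at_rest x i d f \<longrightarrow> runs x c (f, 0, w) (T x i) (f(d := F x i), 0, w)))"

lemma realizableI:
  assumes "pbounded F"
    and "\<And>d. d \<ge> 2 \<Longrightarrow> \<exists>c T. pbounded T \<and>
     (\<forall>x i f w. at_rest x i d f \<longrightarrow> runs x c (f, 0, w) (T x i) (f(d := F x i), 0, w))"
  shows "realizable F"
  using assms by (auto simp: realizable_def)

lemma codeI:
  assumes "\<And>x i f w. at_rest x i d f \<Longrightarrow> runs x c (f, 0, w) (T x i) (f(d := F x i), 0, w)" "pbounded T"
  shows "\<exists>c T. pbounded T \<and>
     (\<forall>x i f w. at_rest x i d f \<longrightarrow> runs x c (f, 0, w) (T x i) (f(d := F x i), 0, w))"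
  using assms by (intro exI[of _ c] exI[of _ T]) simp

lemma at_rest_upd: "at_rest x i d f \<Longrightarrow> d' \<ge> d \<Longrightarrow> d \<ge> 2 \<Longrightarrow> at_rest x i (Suc d') (f(d' := v))"
  by (auto simp: at_rest_def)
lemma at_rest_mono: "at_rest x i d f \<Longrightarrow> d' \<ge> d \<Longrightarrow> at_rest x i d' f"
  by (auto simp: at_rest_def)

lemma realizable_code:
  assumes "realizable F" "d \<ge> 2"
  obtains T c where "pbounded T"
    "\<And>x i f w. at_rest x i d f \<Longrightarrow> runs x c (f, 0, w) (T x i) (f(d := F x i), 0, w)"
  using assms unfolding realizable_def by blast

lemma realizable_const: "realizable (\<lambda>x i. n)"
proof (rule realizableI)
  fix d :: nat assume "d \<ge> 2"
  show "\<exists>c T. pbounded T \<and>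
     (\<forall>x i f w. at_rest x i d f \<longrightarrow> runs x c (f, 0, w) (T x i) (f(d := n), 0, w))"
  proof (induction n)
    case 0
    have "runs x (clear d) (f, 0, w) 1 (f(d := 0), 0, w)" if "at_rest x i d f" for x i f w
      using runs_clear[of x d f "(0, w)"] that by (simp add: at_rest_def)
    then show ?case by (intro exI[of _ "clear d"] exI[of _ "\<lambda>x i. 1"]) (auto intro: pbounded_const  simp del: fun_upd_apply)
  next
    case (Suc n)
    then obtain c T where "pbounded T"
      and c: "\<And>x i f w. at_rest x i d f \<Longrightarrow> runs x c (f, 0, w) (T x i) (f(d := n), 0, w)"
      by blast
    have "pbounded (\<lambda>x i. T x i + 1)" by (intro pbounded_intros \<open>pbounded T\<close>)
    moreover have "runs x (c ;; inc d) (f, 0, w) (T x i + 1) (f(d := Suc n), 0, w)" if "at_rest x i d f" for x i f w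
      by (rule runs_Seq[OF c[OF that] runs_Basic]) simp
    ultimately show ?case by (intro codeI)
  qed
qed (rule pbounded_const)

lemma realizable_reg:
  assumes "pbounded F" "r < 2" "\<And>x i d f. at_rest x i d f \<Longrightarrow> f r = F x i"
  shows "realizable F"
proof (rule realizableI[OF assms(1)])
  fix d :: nat assume d: "d \<ge> 2"
  then have d1: "Suc d \<ge> 2" "Suc (Suc d) \<ge> 2" by simp_all
  have "runs x (copy r d (d + 1)) (f, 0, w) (9 * F x i + 2) (f(d := F x i), 0, w)" if "at_rest x i d f" for x i f w
    using runs_copy[of r d "d + 1" f x "(0, w)"] assms(2) assms(3)[OF that] that d by (simp add: at_rest_def)
  moreover have "pbounded (\<lambda>x i. 9 * F x i + 2)" by (intro pbounded_intros assms(1))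
  ultimately show "\<exists>c T. pbounded T \<and>
     (\<forall>x i f w. at_rest x i d f \<longrightarrow> runs x c (f, 0, w) (T x i) (f(d := F x i), 0, w))" by (rule codeI)
qed

lemma realizable_add:
  assumes "realizable F" "realizable G"
  shows "realizable (\<lambda>x i. F x i + G x i)"
proof (rule realizableI)
  have b: "pbounded F" "pbounded G" using assms by (auto simp: realizable_def)
  then show "pbounded (\<lambda>x i. F x i + G x i)" by (rule pbounded_add)
  fix d :: nat assume d: "d \<ge> 2"
  then have d1: "Suc d \<ge> 2" "Suc (Suc d) \<ge> 2" by simp_all
  obtain c1 T1 where 1: "pbounded T1"
    "\<And>x i f w. at_rest x i d f \<Longrightarrow> runs x c1 (f, 0, w) (T1 x i) (f(d := F x i), 0, w)"
    by (rule realizable_code[OF assms(1) d]) (rule that)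
  obtain c2 T2 where 2: "pbounded T2"
    "\<And>x i f w. at_rest x i (Suc d) f \<Longrightarrow> runs x c2 (f, 0, w) (T2 x i) (f(Suc d := G x i), 0, w)"
    by (rule realizable_code[OF assms(2) d1(1)]) (rule that)
  have "runs x (c1 ;; c2 ;; move (Suc d) d) (f, 0, w) (T1 x i + (T2 x i + (4 * G x i + 1))) (f(d := F x i + G x i), 0, w)"
    if a: "at_rest x i d f" for x i f w
    by (rule runs_cong[OF runs_Seq[OF 1(2)[OF a] runs_Seq[OF 2(2)[OF at_rest_upd[OF a]] runs_move]]])
       (use a d in \<open>auto simp: at_rest_def fun_eq_iff\<close>)
  moreover have "pbounded (\<lambda>x i. T1 x i + (T2 x i + (4 * G x i + 1)))" by (intro pbounded_intros b 1 2)
  ultimately show "\<exists>c T. pbounded T \<and>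
     (\<forall>x i f w. at_rest x i d f \<longrightarrow> runs x c (f, 0, w) (T x i) (f(d := F x i + G x i), 0, w))" by (rule codeI)
qed

lemma realizable_diff:
  assumes "realizable F" "realizable G"
  shows "realizable (\<lambda>x i. F x i - G x i)"
proof (rule realizableI)
  have b: "pbounded F" "pbounded G" using assms by (auto simp: realizable_def)
  then show "pbounded (\<lambda>x i. F x i - G x i)" using pbounded_mono[OF b(1)] by simp
  fix d :: nat assume d: "d \<ge> 2"
  then have d1: "Suc d \<ge> 2" "Suc (Suc d) \<ge> 2" by simp_all
  obtain c1 T1 where 1: "pbounded T1"
    "\<And>x i f w. at_rest x i d f \<Longrightarrow> runs x c1 (f, 0, w) (T1 x i) (f(d := F x i), 0, w)"
    by (rule realizable_code[OF assms(1) d]) (rule that)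
  obtain c2 T2 where 2: "pbounded T2"
    "\<And>x i f w. at_rest x i (Suc d) f \<Longrightarrow> runs x c2 (f, 0, w) (T2 x i) (f(Suc d := G x i), 0, w)"
    by (rule realizable_code[OF assms(2) d1(1)]) (rule that)
  let ?l = "while (Suc d) (dec (Suc d) ;; dec d)"
  have l: "runs x ?l (f, s) (f (Suc d) * (1 + 3) + 1) (f(Suc d := 0, d := f d - (f (Suc d) - 0)), s)" for x f s
    by (rule runs_countdown[where st = "\<lambda>k. (f(Suc d := k, d := f d - (f (Suc d) - k)), s)"], intro runs_straight)
      (cases s; auto simp: fun_eq_iff)+
  have "runs x (c1 ;; c2 ;; ?l) (f, 0, w) (T1 x i + (T2 x i + (4 * G x i + 1))) (f(d := F x i - G x i), 0, w)"
    if a: "at_rest x i d f" for x i f w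
    by (rule runs_cong[OF runs_Seq[OF 1(2)[OF a] runs_Seq[OF 2(2)[OF at_rest_upd[OF a]] l]]])
       (use a d in \<open>auto simp: at_rest_def fun_eq_iff\<close>)
  moreover have "pbounded (\<lambda>x i. T1 x i + (T2 x i + (4 * G x i + 1)))" by (intro pbounded_intros b 1 2)
  ultimately show "\<exists>c T. pbounded T \<and>
     (\<forall>x i f w. at_rest x i d f \<longrightarrow> runs x c (f, 0, w) (T x i) (f(d := F x i - G x i), 0, w))" by (rule codeI)
qed

lemma realizable_mult:
  assumes "realizable F" "realizable G"
  shows "realizable (\<lambda>x i. F x i * G x i)"
proof (rule realizableI)
  have b: "pbounded F" "pbounded G" using assms by (auto simp: realizable_def)
  then show "pbounded (\<lambda>x i. F x i * G x i)" by (rule pbounded_mult)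
  fix d :: nat assume d: "d \<ge> 2"
  then have d1: "Suc d \<ge> 2" "Suc (Suc d) \<ge> 2" by simp_all
  obtain c1 T1 where 1: "pbounded T1"
    "\<And>x i f w. at_rest x i (Suc d) f \<Longrightarrow> runs x c1 (f, 0, w) (T1 x i) (f(Suc d := F x i), 0, w)"
    by (rule realizable_code[OF assms(1) d1(1)]) (rule that)
  obtain c2 T2 where 2: "pbounded T2"
    "\<And>x i f w. at_rest x i (Suc (Suc d)) f \<Longrightarrow> runs x c2 (f, 0, w) (T2 x i) (f(Suc (Suc d) := G x i), 0, w)"
    by (rule realizable_code[OF assms(2) d1(2)]) (rule that)
  let ?l = "while (Suc d) (dec (Suc d) ;; copy (Suc (Suc d)) d (Suc (Suc (Suc d))))"
  let ?g = "\<lambda>f. (f :: nat \<Rightarrow> nat) (Suc (Suc d))"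
  have l: "runs x ?l (f, s) (f (Suc d) * (9 * ?g f + 2 + 3) + 1) (f(Suc d := 0, d := f d + (f (Suc d) - 0) * ?g f), s)"
    if "f (Suc (Suc (Suc d))) = 0" for x f s
    by (rule runs_countdown[where st = "\<lambda>k. (f(Suc d := k, d := f d + (f (Suc d) - k) * ?g f), s)"])
      (use that in \<open>auto simp: fun_eq_iff Suc_diff_Suc[symmetric] intro!: runs_cong[OF runs_copy]\<close>)
  have "runs x (c1 ;; c2 ;; ?l ;; clear (Suc (Suc d))) (f, 0, w)
     (T1 x i + (T2 x i + ((F x i * (9 * G x i + 2 + 3) + 1) + (3 * G x i + 1)))) (f(d := F x i * G x i), 0, w)"
    if a: "at_rest x i d f" for x i f w
  proof -
    have a1: "at_rest x i (Suc d) f" using at_rest_mono[OF a] by simp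
    have a2: "at_rest x i (Suc (Suc d)) (f(Suc d := F x i))" using at_rest_upd[OF a1] d by simp
    show ?thesis
    by (rule runs_cong[OF runs_Seq[OF 1(2)[OF a1] runs_Seq[OF 2(2)[OF a2] runs_Seq[OF l runs_clear]]]])
       (use a d in \<open>auto simp: at_rest_def fun_eq_iff\<close>)
  qed
  moreover have "pbounded (\<lambda>x i. T1 x i + (T2 x i + ((F x i * (9 * G x i + 2 + 3) + 1) + (3 * G x i + 1))))"
    by (intro pbounded_intros b 1 2)
  ultimately show "\<exists>c T. pbounded T \<and>
     (\<forall>x i f w. at_rest x i d f \<longrightarrow> runs x c (f, 0, w) (T x i) (f(d := F x i * G x i), 0, w))" by (rule codeI)
qed

text \<open>Subtracting \<open>g\<close> with truncation until zero is reached takes the ceiling of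
  \<open>a / g\<close> rounds, so this is the division that a loop computes directly.\<close>

definition div_ceil :: "nat \<Rightarrow> nat \<Rightarrow> nat" where
  "div_ceil a g = (a + g - 1) div g"

lemma div_ceil_le:
  assumes "g > 0" shows "div_ceil a g \<le> a"
proof (cases a)
  case (Suc b)
  have "(b + g) div g \<le> b + 1" using assms by (simp add: div_le_dividend)
  then show ?thesis by (simp add: Suc div_ceil_def)
qed (use assms in \<open>simp add: div_ceil_def\<close>)

lemma div_ceil_rounds:
  assumes "g > 0" "k \<le> div_ceil a g"
  shows "a - (div_ceil a g - k) * g > 0 \<longleftrightarrow> k \<noteq> 0"
proof -
  let ?K = "div_ceil a g"
  have 1: "?K * g \<le> a + g - 1" by (simp add: div_ceil_def)
  have 2: "a + g - 1 < (?K + 1) * g"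
    unfolding div_ceil_def using assms(1) by (metis Suc_eq_plus1 dividend_less_div_times mult.commute mult_Suc)
  show ?thesis
  proof (cases k)
    case 0
    then show ?thesis using 2 assms(1) by simp
  next
    case (Suc k')
    then have "(?K - k) * g + g \<le> ?K * g"
      using assms(2) by (metis Suc_diff_Suc Suc_le_lessD diff_le_self mult_Suc add.commute mult_le_mono1)
    then show ?thesis using 1 Suc assms(1) by simp
  qed
qed

lemma realizable_div_ceil:
  assumes "realizable F" "realizable G" "\<And>x i. G x i > 0"
  shows "realizable (\<lambda>x i. div_ceil (F x i) (G x i))"
proof (rule realizableI)
  have b: "pbounded F" "pbounded G" using assms by (auto simp: realizable_def)
  show "pbounded (\<lambda>x i. div_ceil (F x i) (G x i))"
    by (rule pbounded_mono[OF b(1) div_ceil_le[OF assms(3)]])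
  fix d :: nat assume d: "d \<ge> 2"
  then have d1: "Suc d \<ge> 2" "Suc (Suc d) \<ge> 2" by simp_all
  let ?a = "Suc d" and ?g = "Suc (Suc d)" and ?h = "Suc (Suc (Suc d))"
  obtain c1 T1 where 1: "pbounded T1"
    "\<And>x i f w. at_rest x i ?a f \<Longrightarrow> runs x c1 (f, 0, w) (T1 x i) (f(?a := F x i), 0, w)"
    by (rule realizable_code[OF assms(1) d1(1)]) (rule that)
  obtain c2 T2 where 2: "pbounded T2"
    "\<And>x i f w. at_rest x i ?g f \<Longrightarrow> runs x c2 (f, 0, w) (T2 x i) (f(?g := G x i), 0, w)"
    by (rule realizable_code[OF assms(2) d1(2)]) (rule that)
  let ?sub = "while ?g (dec ?g ;; inc ?h ;; dec ?a)"
  let ?body = "inc d ;; ?sub ;; move ?h ?g"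
  have sub: "runs x ?sub (f, s) (f ?g * (1 + 1 + 3) + 1) (f(?g := 0, ?h := f ?h + f ?g - 0, ?a := f ?a - (f ?g - 0)), s)" for x f s
    by (rule runs_countdown[where st = "\<lambda>k. (f(?g := k, ?h := f ?h + f ?g - k, ?a := f ?a - (f ?g - k)), s)"], intro runs_straight)
      (cases s; auto simp: fun_eq_iff)+
  have body: "runs x ?body (f, s) (9 * f ?g + 3) (f(d := f d + 1, ?a := f ?a - f ?g), s)"
    if "f ?h = 0" for x f s
    by (rule runs_cong[OF runs_Seq[OF runs_Basic[OF refl] runs_Seq[OF _ runs_move]]], cases s)
      (use that in \<open>auto simp: fun_eq_iff intro!: runs_cong[OF sub]\<close>)
  have l: "runs x (while ?a ?body) (f, s) (div_ceil (f ?a) (f ?g) * (9 * f ?g + 3 + 2) + 1) (f(d := div_ceil (f ?a) (f ?g), ?a := 0), s)"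
    if z: "f ?h = 0" "f d = 0" and g: "f ?g > 0" for x f s
  proof -
    let ?K = "div_ceil (f ?a) (f ?g)"
    let ?st = "\<lambda>k. (f(d := ?K - k, ?a := f ?a - (?K - k) * f ?g), s)"
    have "runs x (while ?a ?body) (?st ?K) (?K * (9 * f ?g + 3 + 2) + 1) (?st 0)"
    proof (rule runs_loop)
      fix k assume "k < ?K"
      then have k: "?K - k = Suc (?K - Suc k)" by simp
      show "runs x ?body (?st (Suc k)) (9 * f ?g + 3) (?st k)"
        by (rule runs_cong[OF body]) (use z in \<open>auto simp: k fun_eq_iff\<close>)
    next
      fix k assume "k \<le> ?K"
      then show "test_holds x (NonZero ?a) (?st k) = (k \<noteq> 0)"
        using div_ceil_rounds[OF g, of k "f ?a"] by (cases s) (simp add: not_le)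
    qed
    moreover have "?st ?K = (f, s)" using z by (auto simp: fun_eq_iff)
    ultimately show ?thesis
      by (simp only:) (rule runs_cong, use div_ceil_rounds[OF g, of 0 "f ?a"] in \<open>auto simp: fun_eq_iff\<close>)
  qed
  have "runs x (c1 ;; c2 ;; while ?a ?body ;; clear ?g) (f, 0, w)
     (T1 x i + (T2 x i + ((F x i * (9 * G x i + 5) + 1) + (3 * G x i + 1)))) (f(d := div_ceil (F x i) (G x i)), 0, w)"
    if a: "at_rest x i d f" for x i f w
  proof -
    have a1: "at_rest x i (Suc d) f" using at_rest_mono[OF a] by simp
    have a2: "at_rest x i (Suc (Suc d)) (f(Suc d := F x i))" using at_rest_upd[OF a1] d by simp
    have "div_ceil (F x i) (G x i) * (9 * G x i + 3 + 2) \<le> F x i * (9 * G x i + 5)"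
      using mult_le_mono1[OF div_ceil_le[OF assms(3), of "F x i" x i], of "9 * G x i + 5"] by (simp add: add.commute)
    then show ?thesis
    by (intro runs_cong[OF runs_Seq[OF 1(2)[OF a1] runs_Seq[OF 2(2)[OF a2] runs_Seq[OF l runs_clear]]]])
       (use a d assms(3) in \<open>auto simp: at_rest_def fun_eq_iff\<close>)
  qed
  moreover have "pbounded (\<lambda>x i. T1 x i + (T2 x i + ((F x i * (9 * G x i + 5) + 1) + (3 * G x i + 1))))"
    by (intro pbounded_intros b 1 2)
  ultimately show "\<exists>c T. pbounded T \<and>
     (\<forall>x i f w. at_rest x i d f \<longrightarrow> runs x c (f, 0, w) (T x i) (f(d := div_ceil (F x i) (G x i)), 0, w))" by (rule codeI)
qed

definition input_bit :: "bool list \<Rightarrow> nat \<Rightarrow> nat" where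
  "input_bit x j = (if j < length x \<and> x ! j then 1 else 0)"

text \<open>The head walks to the requested position, where a blank beyond the input counts as 0,
  and returns by the number of steps kept in a second register.\<close>

lemma realizable_input:
  assumes "realizable F"
  shows "realizable (\<lambda>x i. input_bit x (F x i))"
proof (rule realizableI)
  have b: "pbounded F" using assms by (auto simp: realizable_def)
  show "pbounded (\<lambda>x i. input_bit x (F x i))"
    by (rule pbounded_mono[OF pbounded_const[of 1]]) (simp add: input_bit_def)
  fix d :: nat assume d: "d \<ge> 2"
  then have d1: "Suc d \<ge> 2" "Suc (Suc d) \<ge> 2" by simp_all
  let ?e = "Suc d"
  obtain c T where 1: "pbounded T"
    "\<And>x i f w. at_rest x i d f \<Longrightarrow> runs x c (f, 0, w) (T x i) (f(d := F x i), 0, w)"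
    by (rule realizable_code[OF assms d]) (rule that)
  let ?right = "while d (dec d ;; inc ?e ;; Basic InR)" and ?left = "while ?e (dec ?e ;; Basic InL)"
  have right: "runs x ?right (f, 0, w) (f d * (1 + 1 + 3) + 1) (f(d := 0, ?e := f d - 0), int (f d - 0), w)"
    if "f ?e = 0" for x f w
    by (rule runs_countdown[where st = "\<lambda>k. (f(d := k, ?e := f d - k), int (f d - k), w)"], intro runs_straight)
      (use that in \<open>auto simp: fun_eq_iff\<close>)
  have left: "runs x ?left (f, int (f ?e), w) (f ?e * (1 + 3) + 1) (f(?e := 0), int 0, w)" for x f w
    by (rule runs_countdown[where st = "\<lambda>k. (f(?e := k), int k, w)"], intro runs_straight)
      (auto simp: fun_eq_iff)
  have get: "runs x (Basic (Get d)) (f, int j, w) 1 (f(d := f d + input_bit x j), int j, w)" for x f j w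
    by (rule runs_Basic) (auto simp: input_bit_def string_contents_def)
  have "runs x (c ;; ?right ;; Basic (Get d) ;; ?left) (f, 0, w)
     (T x i + ((5 * F x i + 1) + (1 + (4 * F x i + 1)))) (f(d := input_bit x (F x i)), 0, w)"
    if a: "at_rest x i d f" for x i f w
  proof -
    have f: "f d = 0" "f ?e = 0" using a by (auto simp: at_rest_def)
    have 2: "runs x ?right (f(d := F x i), 0, w) (5 * F x i + 1) (f(d := 0, ?e := F x i), int (F x i), w)"
      by (rule runs_cong[OF right]) (use f in \<open>auto simp: fun_eq_iff\<close>)
    have 3: "runs x (Basic (Get d)) (f(d := 0, ?e := F x i), int (F x i), w) 1
      (f(d := input_bit x (F x i), ?e := F x i), int (F x i), w)"
      by (rule runs_cong[OF get]) (use f in \<open>auto simp: fun_eq_iff\<close>)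
    have 4: "runs x ?left (f(d := input_bit x (F x i), ?e := F x i), int (F x i), w) (4 * F x i + 1)
      (f(d := input_bit x (F x i)), 0, w)"
      using left[of x "f(d := input_bit x (F x i), ?e := F x i)" w] f
      by (simp add: mult.commute fun_upd_idem)
    show ?thesis by (intro runs_Seq[OF 1(2)[OF a]] runs_Seq[OF 2] runs_Seq[OF 3] 4)
  qed
  moreover have "pbounded (\<lambda>x i. T x i + ((5 * F x i + 1) + (1 + (4 * F x i + 1))))"
    by (intro pbounded_intros b 1)
  ultimately show "\<exists>c T. pbounded T \<and>
     (\<forall>x i f w. at_rest x i d f \<longrightarrow> runs x c (f, 0, w) (T x i) (f(d := input_bit x (F x i)), 0, w))" by (rule codeI)
qed

text \<open>With these closure rules, polynomial time of the reduction becomes a derivation along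
  the structure of its defining terms.\<close>

inductive arith :: "(bool list \<Rightarrow> nat \<Rightarrow> nat) \<Rightarrow> bool" where
  arith_const: "arith (\<lambda>x i. n)"
| arith_length: "arith (\<lambda>x i. length x)"
| arith_index: "arith (\<lambda>x i. i)"
| arith_input: "arith F \<Longrightarrow> arith (\<lambda>x i. input_bit x (F x i))"
| arith_add: "arith F \<Longrightarrow> arith G \<Longrightarrow> arith (\<lambda>x i. F x i + G x i)"
| arith_diff: "arith F \<Longrightarrow> arith G \<Longrightarrow> arith (\<lambda>x i. F x i - G x i)"
| arith_mult: "arith F \<Longrightarrow> arith G \<Longrightarrow> arith (\<lambda>x i. F x i * G x i)"
| arith_div_ceil: "arith F \<Longrightarrow> arith G \<Longrightarrow> (\<And>x i. G x i > 0) \<Longrightarrow> arith (\<lambda>x i. div_ceil (F x i) (G x i))"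

lemma arith_realizable: "arith F \<Longrightarrow> realizable F"
proof (induction rule: arith.induct)
  case arith_length
  then show ?case by (rule realizable_reg[OF pbounded_length, of 0]) (auto simp: at_rest_def)
next
  case arith_index
  then show ?case by (rule realizable_reg[OF pbounded_index, of 1]) (auto simp: at_rest_def)
qed (blast intro: realizable_const realizable_input realizable_add realizable_diff realizable_mult realizable_div_ceil)+

lemma arith_div:
  assumes "arith F" "arith G" "\<And>x i. G x i > 0"
  shows "arith (\<lambda>x i. F x i div G x i)"
proof -
  \<comment> \<open>The floor of \<open>a / g\<close> is the ceiling of
    \<open>(a + 1 - g) / g\<close>; truncated subtraction covers \<open>a < g\<close>.\<close>
  have "a div g = div_ceil (a + 1 - g) g" if "g > 0" for a g :: nat
    using that by (cases "a + 1 \<ge> g") (simp_all add: div_ceil_def)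
  then have "(\<lambda>x i. F x i div G x i) = (\<lambda>x i. div_ceil (F x i + 1 - G x i) (G x i))"
    using assms(3) by (simp add: fun_eq_iff)
  moreover have "arith \<dots>" using assms by (intro arith.intros)
  ultimately show ?thesis by simp
qed

lemma arith_mod:
  assumes "arith F" "arith G" "\<And>x i. G x i > 0"
  shows "arith (\<lambda>x i. F x i mod G x i)"
  unfolding modulo_nat_def by (intro arith.intros arith_div assms)

lemma arith_if_less:
  assumes "arith A" "arith B" "arith F" "arith G"
  shows "arith (\<lambda>x i. if A x i < B x i then F x i else G x i)"
proof -
  \<comment> \<open>By truncation, \<open>1 - (1 - (B x i - A x i))\<close> is the indicator of
    \<open>A x i < B x i\<close>.\<close>
  have "(\<lambda>x i. if A x i < B x i then F x i else G x i) =
      (\<lambda>x i. (1 - (1 - (B x i - A x i))) * F x i + (1 - (B x i - A x i)) * G x i)"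
    by (auto simp: fun_eq_iff)
  moreover have "arith \<dots>" using assms by (intro arith.intros)
  ultimately show ?thesis by simp
qed

lemma arith_if_le:
  assumes "arith A" "arith B" "arith F" "arith G"
  shows "arith (\<lambda>x i. if A x i \<le> B x i then F x i else G x i)"
  using arith_if_less[OF assms(1) arith_add[OF assms(2) arith_const[of 1]] assms(3,4)]
  by (simp add: less_Suc_eq_le)

lemma arith_if_eq:
  assumes "arith A" "arith B" "arith F" "arith G"
  shows "arith (\<lambda>x i. if A x i = B x i then F x i else G x i)"
proof -
  have "(\<lambda>x i. if A x i = B x i then F x i else G x i) =
      (\<lambda>x i. if A x i \<le> B x i then if B x i \<le> A x i then F x i else G x i else G x i)"
    by (auto simp: fun_eq_iff)
  moreover have "arith \<dots>" using assms by (intro arith_if_le)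
  ultimately show ?thesis by simp
qed

text \<open>A lookup in a table of fixed length \<open>b\<close>; it brings in the codes of tile
  colours, which have no arithmetical description.\<close>

lemma arith_select:
  assumes "arith A" "\<And>x i. A x i < b" "\<And>k. k < b \<Longrightarrow> arith (G k)"
  shows "arith (\<lambda>x i. G (A x i) x i)"
proof -
  have "arith (\<lambda>x i. if A x i < b then G (A x i) x i else 0)" using assms(3)
  proof (induction b)
    case 0
    then show ?case by (simp add: arith_const)
  next
    case (Suc b)
    have "(\<lambda>x i. if A x i < Suc b then G (A x i) x i else 0) =
      (\<lambda>x i. if A x i = b then G b x i else (if A x i < b then G (A x i) x i else 0))"
      by (auto simp: fun_eq_iff less_Suc_eq)
    moreover have "arith \<dots>" using assms(1) Suc by (intro arith_if_eq arith_const) auto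
    ultimately show ?case by simp
  qed
  then show ?thesis using assms(2) by simp
qed

lemma arith_poly:
  assumes "arith F"
  shows "arith (\<lambda>x i. poly p (F x i))"
proof (induction p)
  case (pCons a p)
  have "arith (\<lambda>x i. a + F x i * poly p (F x i))" by (intro arith.intros assms pCons)
  then show ?case by simp
qed (simp add: arith_const)

lemma arith_if_conj:
  assumes "arith (\<lambda>x i. if c x i then if d x i then F x i else G x i else G x i)"
  shows "arith (\<lambda>x i. if c x i \<and> d x i then F x i else G x i)"
proof -
  have "(\<lambda>x i. if c x i \<and> d x i then F x i else G x i) =
      (\<lambda>x i. if c x i then if d x i then F x i else G x i else G x i)"
    by (auto simp: fun_eq_iff)
  then show ?thesis using assms by simp
qed

lemmas arith_rules = arith.intros arith_div arith_mod arith_if_less arith_if_le arith_if_eq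
  arith_if_conj arith_poly

section \<open>Printing\<close>

definition printable :: "(bool list \<Rightarrow> nat \<Rightarrow> bool list) \<Rightarrow> bool" where
  "printable g \<longleftrightarrow> (\<forall>d\<ge>2. \<exists>c T. pbounded T \<and>
     (\<forall>x i f w. at_rest x i d f \<longrightarrow> runs x c (f, 0, w) (T x i) (f, 0, w @ g x i)))"

lemma printableI:
  assumes "\<And>d x i f w. d \<ge> 2 \<Longrightarrow> at_rest x i d f \<Longrightarrow> runs x (c d) (f, 0, w) (T d x i) (f, 0, w @ g x i)"
    and "\<And>d. pbounded (T d)"
  shows "printable g"
  unfolding printable_def
proof (intro allI impI)
  fix d :: nat assume "d \<ge> 2"
  then show "\<exists>c T. pbounded T \<and>
     (\<forall>x i f w. at_rest x i d f \<longrightarrow> runs x c (f, 0, w) (T x i) (f, 0, w @ g x i))"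
    using assms by (intro exI[of _ "c d"] exI[of _ "T d"]) auto
qed

lemma printable_code:
  assumes "printable g" "d \<ge> 2"
  obtains T c where "pbounded T"
    "\<And>x i f w. at_rest x i d f \<Longrightarrow> runs x c (f, 0, w) (T x i) (f, 0, w @ g x i)"
  using assms unfolding printable_def by blast

lemma printable_append:
  assumes "printable g" "printable h"
  shows "printable (\<lambda>x i. g x i @ h x i)"
  unfolding printable_def
proof (intro allI impI)
  fix d :: nat assume d: "d \<ge> 2"
  obtain T1 c1 where 1: "pbounded T1"
    "\<And>x i f w. at_rest x i d f \<Longrightarrow> runs x c1 (f, 0, w) (T1 x i) (f, 0, w @ g x i)"
    by (rule printable_code[OF assms(1) d]) (rule that)
  obtain T2 c2 where 2: "pbounded T2"
    "\<And>x i f w. at_rest x i d f \<Longrightarrow> runs x c2 (f, 0, w) (T2 x i) (f, 0, w @ h x i)"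
    by (rule printable_code[OF assms(2) d]) (rule that)
  have "runs x (c1 ;; c2) (f, 0, w) (T1 x i + T2 x i) (f, 0, w @ g x i @ h x i)" if a: "at_rest x i d f" for x i f w
    using runs_Seq[OF 1(2)[OF a, of w] 2(2)[OF a]] by simp
  moreover have "pbounded (\<lambda>x i. T1 x i + T2 x i)" by (intro pbounded_intros 1 2)
  ultimately show "\<exists>c T. pbounded T \<and>
     (\<forall>x i f w. at_rest x i d f \<longrightarrow> runs x c (f, 0, w) (T x i) (f, 0, w @ g x i @ h x i))"
    by (intro exI[of _ "c1 ;; c2"] exI[of _ "\<lambda>x i. T1 x i + T2 x i"]) simp
qed

definition out_bit :: "nat \<Rightarrow> bool \<Rightarrow> com" where
  "out_bit d b = (if b then inc d ;; Basic (Out d) ;; dec d else Basic (Out d))"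

lemma runs_out_bit: "f d = 0 \<Longrightarrow> runs x (out_bit d b) (f, p, w) 3 (f, p, w @ [b])"
proof (cases b)
  case True
  assume f: "f d = 0"
  have "runs x (inc d ;; Basic (Out d) ;; dec d) (f, p, w) (1 + (1 + 1)) (f, p, w @ [b])"
    by (intro runs_straight) (use f True in \<open>auto simp: fun_eq_iff\<close>)
  then show ?thesis using True by (simp add: out_bit_def numeral_3_eq_3)
next
  case False
  assume f: "f d = 0"
  show ?thesis unfolding out_bit_def using f False by (auto intro!: runs_cong[OF runs_Basic[OF refl]])
qed

lemma printable_bits: "printable (\<lambda>x i. bs)"
proof (induction bs)
  case Nil
  show ?case
    by (rule printableI[where c = clear and T = "\<lambda>d x i. 1"])
      (auto simp: at_rest_def pbounded_const fun_upd_idem intro!: runs_cong[OF runs_clear])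
next
  case (Cons b bs)
  have "printable (\<lambda>x i. [b])"
    by (rule printableI[where c = "\<lambda>d. out_bit d b" and T = "\<lambda>d x i. 3"])
      (auto simp: at_rest_def pbounded_const intro!: runs_out_bit)
  from printable_append[OF this Cons] show ?case by simp
qed

text \<open>Register \<open>d\<close> is split into \<open>d + 1\<close> and \<open>d + 2\<close>, whose rounded halves yield the parity.\<close>

definition halve :: "nat \<Rightarrow> com" where
  "halve d = (while d (dec d ;; inc (d + 1) ;; inc (d + 2))) ;; dec (d + 2) ;;
     while (d + 1) (dec (d + 1) ;; dec (d + 1) ;; inc d) ;;
     while (d + 2) (dec (d + 2) ;; dec (d + 2) ;; inc (d + 3)) ;;
     while (d + 3) (dec (d + 3) ;; dec d ;; inc (d + 1))"

text \<open>Decrement stops at zero, so an odd value takes a last round with one effective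
  decrement: the number of rounds is half of \<open>f r\<close>, rounded up.\<close>

lemma runs_half:
  assumes "r \<noteq> e"
  shows "runs x (while r (dec r ;; dec r ;; inc e)) (f, s) (5 * f r + 1) (f(r := 0, e := f e + (f r + 1) div 2), s)"
proof -
  obtain p w where s: "s = (p, w)" by (cases s)
  define K where "K = (f r + 1) div 2"
  have K: "f r \<le> 2 * K" "2 * K \<le> f r + 1" "K \<le> f r" by (auto simp: K_def)
  let ?st = "\<lambda>k. (f(r := f r - 2 * (K - k), e := f e + (K - k)), s)"
  have "runs x (while r (dec r ;; dec r ;; inc e)) (?st K) (K * (1 + (1 + 1) + 2) + 1) (?st 0)"
  proof (rule runs_loop)
    fix k assume "k < K"
    then have k: "K - k = Suc (K - Suc k)" by simp
    show "runs x (dec r ;; dec r ;; inc e) (?st (Suc k)) (1 + (1 + 1)) (?st k)"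
      unfolding k s by (intro runs_straight) (use assms in \<open>auto simp: fun_eq_iff\<close>)
  next
    fix k assume "k \<le> K"
    then show "test_holds x (NonZero r) (?st k) = (k \<noteq> 0)" using assms K by (auto simp: s)
  qed
  moreover have "?st K = (f, s)" using assms by simp
  ultimately show ?thesis
    using K(1,3) unfolding K_def by (simp only:) (erule runs_cong, auto simp: fun_eq_iff K_def)
qed

text \<open>The rounded-up halves of \<open>v\<close> and \<open>v - 1\<close> differ by the parity
  of \<open>v\<close>, and the second is \<open>v div 2\<close>.\<close>

lemma runs_halve:
  assumes "f (d + 1) = 0" "f (d + 2) = 0" "f (d + 3) = 0"
  shows "runs x (halve d) (f, s) (30 * f d + 30) (f(d := f d mod 2, d + 1 := f d div 2), s)"
proof -
  let ?v = "f d"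
  let ?f1 = "f(d := 0, d + 1 := ?v, d + 2 := ?v)"
  let ?f2 = "f(d := 0, d + 1 := ?v, d + 2 := ?v - 1)"
  let ?f3 = "f(d := (?v + 1) div 2, d + 2 := ?v - 1)"
  let ?f4 = "f(d := (?v + 1) div 2, d + 3 := ?v div 2)"
  have ceil: "(?v - Suc 0 + 1) div 2 = ?v div 2" by (cases ?v) auto
  have 1: "runs x (while d (dec d ;; inc (d + 1) ;; inc (d + 2))) (f, s) (5 * ?v + 1) (?f1, s)"
  proof -
    have "runs x (while d (dec d ;; inc (d + 1) ;; inc (d + 2))) (f, s) (?v * ((1 + 1) + 3) + 1)
        (f(d := 0, d + 1 := ?v - 0, d + 2 := ?v - 0), s)"
      by (rule runs_countdown[where st = "\<lambda>k. (f(d := k, d + 1 := ?v - k, d + 2 := ?v - k), s)"], intro runs_straight)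
        (cases s; use assms in \<open>auto simp: fun_eq_iff\<close>)+
    then show ?thesis by (simp add: mult.commute)
  qed
  have 2: "runs x (dec (d + 2)) (?f1, s) 1 (?f2, s)"
    by (rule runs_Basic) (cases s; auto simp: fun_eq_iff)
  have 3: "runs x (while (d + 1) (dec (d + 1) ;; dec (d + 1) ;; inc d)) (?f2, s) (5 * ?v + 1) (?f3, s)"
    by (rule runs_cong[OF runs_half]) (use assms in \<open>auto simp: fun_eq_iff\<close>)
  have 4: "runs x (while (d + 2) (dec (d + 2) ;; dec (d + 2) ;; inc (d + 3))) (?f3, s) (5 * ?v + 1) (?f4, s)"
    by (rule runs_cong[OF runs_half]) (use assms ceil in \<open>auto simp: fun_eq_iff\<close>)
  have 5: "runs x (while (d + 3) (dec (d + 3) ;; dec d ;; inc (d + 1))) (?f4, s) (5 * ?v + 1)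
      (f(d := ?v mod 2, d + 1 := ?v div 2), s)"
  proof -
    have "runs x (while (d + 3) (dec (d + 3) ;; dec d ;; inc (d + 1))) (?f4, s) (?f4 (d + 3) * ((1 + 1) + 3) + 1)
        (f(d := (?v + 1) div 2 - (?v div 2 - 0), d + 3 := 0, d + 1 := ?v div 2 - 0), s)"
      by (rule runs_countdown[where st = "\<lambda>k. (f(d := (?v + 1) div 2 - (?v div 2 - k), d + 3 := k, d + 1 := ?v div 2 - k), s)"], intro runs_straight)
        (cases s; use assms in \<open>auto simp: fun_eq_iff\<close>)+
    moreover have "(?v + 1) div 2 - ?v div 2 = ?v mod 2" by (cases "even ?v") (auto elim!: evenE oddE)
    ultimately show ?thesis
      by (elim runs_cong) (use assms in \<open>auto simp: fun_eq_iff\<close>)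
  qed
  show ?thesis unfolding halve_def
    by (rule runs_cong[OF runs_Seq[OF 1 runs_Seq[OF 2 runs_Seq[OF 3 runs_Seq[OF 4 5]]]]]) auto
qed

definition print_digits :: "nat \<Rightarrow> com" where
  "print_digits d = while d (out_bit (d + 1) True ;; halve d ;; Basic (Out d) ;; dec d ;; move (d + 1) d)"

text \<open>\<open>V\<close> bounds the cost of every round, as the value only shrinks;
  \<open>v\<close> itself is a generous bound on the number of rounds.\<close>

lemma runs_print_digits:
  assumes "f (d + 1) = 0" "f (d + 2) = 0" "f (d + 3) = 0" "v \<le> V"
  shows "runs x (print_digits d) (f(d := v), p, w) (v * (40 * V + 42) + 1)
     (f(d := 0), p, w @ concat (map (\<lambda>b. [True, b]) (bits v)))"
  using assms(4)
proof (induction v arbitrary: w rule: less_induct)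
  case (less v)
  let ?body = "out_bit (d + 1) True ;; halve d ;; Basic (Out d) ;; dec d ;; move (d + 1) d"
  show ?case
  proof (cases "v = 0")
    case True
    have "big x (print_digits d) (f(d := 0), p, w) 1 (f(d := 0), p, w)"
      unfolding print_digits_def by (rule big_WhileF) simp
    then show ?thesis using True unfolding runs_def by (intro exI[of _ 1]) (simp add: bits.simps)
  next
    case False
    let ?f2 = "f(d := v mod 2, d + 1 := v div 2)"
    have 1: "runs x (out_bit (d + 1) True) (f(d := v), p, w) 3 (f(d := v), p, w @ [True])"
      by (rule runs_out_bit) (use assms in simp)
    have 2: "runs x (halve d) (f(d := v), p, w @ [True]) (30 * V + 30) (?f2, p, w @ [True])"
      by (rule runs_cong[OF runs_halve]) (use assms less.prems in \<open>auto simp: fun_eq_iff\<close>)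
    have 3: "runs x (Basic (Out d)) (?f2, p, w @ [True]) 1 (?f2, p, w @ [True, odd v])"
      by (rule runs_Basic) (auto simp: odd_iff_mod_2_eq_one)
    have 4: "runs x (dec d) (?f2, p, w @ [True, odd v]) 1 (?f2(d := 0), p, w @ [True, odd v])"
      by (rule runs_Basic) (auto simp: fun_eq_iff)
    have 5: "runs x (move (d + 1) d) (?f2(d := 0), p, w @ [True, odd v]) (4 * V + 1)
        (f(d := v div 2), p, w @ [True, odd v])"
      by (rule runs_cong[OF runs_move]) (use assms less.prems in \<open>auto simp: fun_eq_iff div_le_dividend[THEN order_trans]\<close>)
    have "runs x ?body (f(d := v), p, w) (40 * V + 40) (f(d := v div 2), p, w @ [True, odd v])"
      by (rule runs_cong[OF runs_Seq[OF 1 runs_Seq[OF 2 runs_Seq[OF 3 runs_Seq[OF 4 5]]]] refl]) simp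
    then obtain t1 where t1: "t1 \<le> 40 * V + 40"
      "big x ?body (f(d := v), p, w) t1 (f(d := v div 2), p, w @ [True, odd v])" by (auto simp: runs_def)
    have "runs x (print_digits d) (f(d := v div 2), p, w @ [True, odd v]) (v div 2 * (40 * V + 42) + 1)
     (f(d := 0), p, (w @ [True, odd v]) @ concat (map (\<lambda>b. [True, b]) (bits (v div 2))))"
      by (rule less.IH) (use False less.prems in \<open>auto simp: div_le_dividend[THEN order_trans]\<close>)
    then obtain t2 where t2: "t2 \<le> v div 2 * (40 * V + 42) + 1"
      "big x (print_digits d) (f(d := v div 2), p, w @ [True, odd v]) t2
     (f(d := 0), p, w @ concat (map (\<lambda>b. [True, b]) (bits v)))"
      using False by (auto simp: runs_def bits.simps[of v])
    have "big x (print_digits d) (f(d := v), p, w) (t1 + t2 + 2) (f(d := 0), p, w @ concat (map (\<lambda>b. [True, b]) (bits v)))"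
      using t2(2) unfolding print_digits_def by (intro big_WhileT[OF _ t1(2)]) (use False in auto)
    moreover have "t1 + t2 + 2 \<le> v * (40 * V + 42) + 1"
    proof -
      have "v div 2 + 1 \<le> v" using False by simp
      then have "(v div 2 + 1) * (40 * V + 42) \<le> v * (40 * V + 42)" by (rule mult_le_mono1)
      then show ?thesis using t1 t2 by (simp add: algebra_simps)
    qed
    ultimately show ?thesis unfolding runs_def by blast
  qed
qed

lemma printable_nat:
  assumes "arith F"
  shows "printable (\<lambda>x i. encode_nat (F x i))"
  unfolding printable_def
proof (intro allI impI)
  fix d :: nat assume d: "d \<ge> 2"
  have r: "realizable F" using assms by (rule arith_realizable)
  then have F: "pbounded F" by (simp add: realizable_def)
  obtain T c where 1: "pbounded T"
    "\<And>x i f w. at_rest x i d f \<Longrightarrow> runs x c (f, 0, w) (T x i) (f(d := F x i), 0, w)"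
    by (rule realizable_code[OF r d]) (rule that)
  let ?T = "\<lambda>x i. T x i + ((F x i * (40 * F x i + 42) + 1) + 3)"
  have "runs x (c ;; print_digits d ;; out_bit d False) (f, 0, w) (?T x i) (f, 0, w @ encode_nat (F x i))"
    if a: "at_rest x i d f" for x i f w
    by (rule runs_cong[OF runs_Seq[OF 1(2)[OF a] runs_Seq[OF runs_print_digits[OF _ _ _ order_refl] runs_out_bit]]])
       (use a in \<open>auto simp: at_rest_def encode_nat_def fun_eq_iff\<close>)
  moreover have "pbounded ?T" by (intro pbounded_intros F 1)
  ultimately show "\<exists>c T. pbounded T \<and>
     (\<forall>x i f w. at_rest x i d f \<longrightarrow> runs x c (f, 0, w) (T x i) (f, 0, w @ encode_nat (F x i)))"
    by (intro exI[of _ "c ;; print_digits d ;; out_bit d False"] exI[of _ ?T]) simp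
qed

section \<open>Programs\<close>

text \<open>Flat loops suffice, since an instance is a sequence of numbers and of lists over
  vertices and edges.\<close>

inductive printing_prog :: "(bool list \<Rightarrow> bool list) \<Rightarrow> bool" where
  prog_loop: "arith B \<Longrightarrow> printable g \<Longrightarrow> printing_prog (\<lambda>x. concat (map (g x) [0..<B x 0]))"
| prog_append: "printing_prog f \<Longrightarrow> printing_prog g \<Longrightarrow> printing_prog (\<lambda>x. f x @ g x)"

lemma prog_print:
  assumes "printable g"
  shows "printing_prog (\<lambda>x. g x 0)"
  using prog_loop[OF arith_const[of 1] assms] by simp

lemma printing_prog_code:
  assumes "printing_prog F"
  shows "\<exists>c (p :: nat poly). \<forall>x f w. at_rest x 0 2 f \<longrightarrow> f 1 = 0 \<longrightarrow>
    runs x c (f, 0, w) (poly p (length x)) (f, 0, w @ F x)"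
  using assms
proof induction
  case (prog_loop B g)
  have rB: "realizable B" using prog_loop(1) by (rule arith_realizable)
  then have B: "pbounded B" by (simp add: realizable_def)
  obtain T1 c1 where 1: "pbounded T1"
    "\<And>x i f w. at_rest x i 2 f \<Longrightarrow> runs x c1 (f, 0, w) (T1 x i) (f(2 := B x i), 0, w)"
    by (rule realizable_code[OF rB order_refl]) (rule that)
  obtain T2 c2 where 2: "pbounded T2"
    "\<And>x i f w. at_rest x i 3 f \<Longrightarrow> runs x c2 (f, 0, w) (T2 x i) (f, 0, w @ g x i)"
    by (rule printable_code[OF prog_loop(2), of 3]) (simp, rule that)
  obtain pB p1 p2 :: "nat poly" where p: "\<And>x i. B x i \<le> poly pB (length x + i)"
    "\<And>x i. T1 x i \<le> poly p1 (length x + i)" "\<And>x i. T2 x i \<le> poly p2 (length x + i)"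
    using B 1(1) 2(1) unfolding pbounded_def by metis
  \<comment> \<open>Loop indices stay below \<open>B x 0\<close>, so composing the bounds makes the
    cost of a round polynomial in the input length alone.\<close>
  define q where "q = pcompose p2 ([:0, 1:] + pB)"
  have q: "T2 x i \<le> poly q (length x)" if "i \<le> B x 0" for x i
  proof -
    have "length x + i \<le> length x + poly pB (length x)" using that p(1)[of x 0] by simp
    from poly_nat_mono[OF this, of p2] show ?thesis
      using p(3)[of x i] by (simp add: q_def poly_pcompose)
  qed
  \<comment> \<open>Register 2 counts the remaining rounds and register 1 the index, so the body
    works from register 3 on.\<close>
  let ?l = "while 2 (dec 2 ;; c2 ;; inc 1)"
  have "runs x (c1 ;; ?l ;; clear 1) (f, 0, w)
     (poly (p1 + ((pB * (q + 1 + 3) + 1) + (3 * pB + 1))) (length x)) (f, 0, w @ concat (map (g x) [0..<B x 0]))"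
    if a: "at_rest x 0 2 f" and f1: "f 1 = 0" for x f w
  proof -
    let ?b = "B x 0"
    have f: "f 0 = length x" "f 2 = 0" "\<And>r. r > 2 \<Longrightarrow> f r = 0" using a by (auto simp: at_rest_def)
    have l: "runs x ?l (f(2 := ?b), 0, w) ((f(2 := ?b)) 2 * (poly q (length x) + 1 + 3) + 1)
        (f(2 := 0, 1 := ?b - 0), 0, w @ concat (map (g x) [0..<?b - 0]))"
    proof (rule runs_countdown[where st = "\<lambda>k. (f(2 := k, 1 := ?b - k), 0, w @ concat (map (g x) [0..<?b - k]))"])
      fix k assume k: "k < (f(2 := ?b)) 2"
      let ?f' = "f(2 := k, 1 := ?b - Suc k)"
      have a': "at_rest x (?b - Suc k) 3 ?f'" using f by (auto simp: at_rest_def)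
      have "runs x c2 (?f', 0, w @ concat (map (g x) [0..<?b - Suc k])) (poly q (length x))
          (?f', 0, (w @ concat (map (g x) [0..<?b - Suc k])) @ g x (?b - Suc k))"
        by (rule runs_cong[OF 2(2)[OF a'] refl q]) simp
      moreover have "?b - k = Suc (?b - Suc k)" using k by simp
      then have "(w @ concat (map (g x) [0..<?b - Suc k])) @ g x (?b - Suc k) = w @ concat (map (g x) [0..<?b - k])"
        by simp
      ultimately have 3: "runs x c2 (?f', 0, w @ concat (map (g x) [0..<?b - Suc k])) (poly q (length x))
          (?f', 0, w @ concat (map (g x) [0..<?b - k]))" by simp
      have 4: "runs x (inc 1) (?f', 0, w @ concat (map (g x) [0..<?b - k])) 1
         (f(2 := k, 1 := ?b - k), 0, w @ concat (map (g x) [0..<?b - k]))"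
        by (rule runs_Basic) (use k in \<open>auto simp: fun_eq_iff\<close>)
      show "runs x (c2 ;; inc 1) ((fst (f(2 := Suc k, 1 := ?b - Suc k), 0 :: int, w @ concat (map (g x) [0..<?b - Suc k])))(2 := k),
            snd (f(2 := Suc k, 1 := ?b - Suc k), 0, w @ concat (map (g x) [0..<?b - Suc k])))
         (poly q (length x) + 1) (f(2 := k, 1 := ?b - k), 0, w @ concat (map (g x) [0..<?b - k]))"
        by (rule runs_cong[OF _ refl order_refl], subst prod.sel, subst prod.sel)
           (rule runs_Seq[OF _ 4], use 3 in \<open>simp add: fun_upd_twist[of "Suc 0" 2]\<close>)
    qed (use f1 in \<open>auto simp: fun_eq_iff\<close>)
    have b: "T1 x 0 \<le> poly p1 (length x)" "?b \<le> poly pB (length x)" using p(1,2)[of x 0] by auto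
    have "runs x (c1 ;; ?l ;; clear 1) (f, 0, w) (T1 x 0 + ((?b * (poly q (length x) + 1 + 3) + 1) + (3 * ?b + 1)))
       (f, 0, w @ concat (map (g x) [0..<?b]))"
      by (rule runs_cong[OF runs_Seq[OF 1(2)[OF a] runs_Seq[OF l runs_clear]]])
        (use f f1 in \<open>auto simp: fun_eq_iff\<close>)
    then show ?thesis
      by (rule runs_cong) (use b in \<open>auto intro!: add_mono mult_le_mono\<close>)
  qed
  then show ?case by blast
next
  case (prog_append f g)
  then obtain c1 c2 and p1 p2 :: "nat poly" where
    1: "\<And>x f' w. at_rest x 0 2 f' \<Longrightarrow> f' 1 = 0 \<Longrightarrow> runs x c1 (f', 0, w) (poly p1 (length x)) (f', 0, w @ f x)"
    and 2: "\<And>x f' w. at_rest x 0 2 f' \<Longrightarrow> f' 1 = 0 \<Longrightarrow> runs x c2 (f', 0, w) (poly p2 (length x)) (f', 0, w @ g x)"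
    by blast
  have "runs x (c1 ;; c2) (f', 0, w) (poly (p1 + p2) (length x)) (f', 0, w @ f x @ g x)"
    if "at_rest x 0 2 f'" "f' 1 = 0" for x f' w
    using runs_Seq[OF 1[OF that, of w] 2[OF that]] by simp
  then show ?case by blast
qed

theorem printing_prog_poly_time:
  assumes "printing_prog F"
  shows "poly_time F"
proof -
  obtain c and p :: "nat poly" where c: "\<And>x f w. at_rest x 0 2 f \<Longrightarrow> f 1 = 0 \<Longrightarrow>
    runs x c (f, 0, w) (poly p (length x)) (f, 0, w @ F x)"
    using printing_prog_code[OF assms] by blast
  let ?z = "\<lambda>_ :: nat. 0 :: nat"
  \<comment> \<open>The input is measured once into register 0; register 1 counts along to bring the
    head back.\<close>
  let ?right = "While InputLeft (inc 0 ;; inc 1 ;; Basic InR)" and ?left = "while 1 (dec 1 ;; Basic InL)"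
  have "runs x (?right ;; ?left ;; c) (?z, 0, []) (poly ([:1, 5:] + ([:1, 4:] + p)) (length x)) (?z(0 := length x), 0, F x)" for x
  proof -
    let ?n = "length x"
    have 1: "runs x ?right (?z(0 := ?n - ?n, 1 := ?n - ?n), int (?n - ?n), []) (?n * ((1 + (1 + 1)) + 2) + 1)
        (?z(0 := ?n - 0, 1 := ?n - 0), int (?n - 0), [])"
      by (rule runs_loop[where st = "\<lambda>k. (?z(0 := ?n - k, 1 := ?n - k), int (?n - k), [])"], intro runs_straight)
        (auto simp: fun_eq_iff string_contents_def)
    have 2: "runs x ?left (?z(0 := ?n, 1 := ?n), int ?n, []) (?n * (1 + 3) + 1) (?z(0 := ?n, 1 := 0), int 0, [])"
    proof -
      let ?f = "?z(0 := ?n, 1 := ?n)"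
      have "runs x ?left (?f, int ?n, []) (?f 1 * (1 + 3) + 1) (?z(0 := ?n, 1 := 0), int 0, [])"
        by (rule runs_countdown[where st = "\<lambda>k. (?z(0 := ?n, 1 := k), int k, [])"], intro runs_straight)
          (auto simp: fun_eq_iff)
      then show ?thesis by simp
    qed
    have 3: "runs x c (?z(0 := ?n), 0, []) (poly p ?n) (?z(0 := ?n), 0, [] @ F x)"
      by (rule c) (auto simp: at_rest_def)
    have r1: "runs x ?right (?z, 0, []) (5 * ?n + 1) (?z(0 := ?n, 1 := ?n), int ?n, [])"
      using runs_cong[OF 1 refl, of "5 * ?n + 1"] by (simp add: fun_upd_idem)
    have r2: "runs x ?left (?z(0 := ?n, 1 := ?n), int ?n, []) (4 * ?n + 1) (?z(0 := ?n), 0, [])"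
      by (rule runs_cong[OF 2]) (auto simp: fun_eq_iff)
    show ?thesis
      by (rule runs_cong[OF runs_Seq[OF r1 runs_Seq[OF r2 3]]]) (auto simp: algebra_simps)
  qed
  then show ?thesis
    unfolding runs_def
    by (intro poly_time_com[where c = "?right ;; ?left ;; c" and p = "[:1, 5:] + ([:1, 4:] + p)"]) blast
qed

section \<open>Unique parsing of encoded instances\<close>

lemma bits_inject: "bits m = bits n \<Longrightarrow> m = n"
proof (induction m arbitrary: n rule: less_induct)
  case (less m)
  show ?case
  proof (cases "m = 0 \<or> n = 0")
    case True
    then show ?thesis using less.prems by (auto simp: bits.simps[of m] bits.simps[of n] split: if_splits)
  next
    case False
    then have "odd m = odd n" "bits (m div 2) = bits (n div 2)"
      using less.prems by (simp_all add: bits.simps[of m] bits.simps[of n])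
    then have "m div 2 = n div 2" "m mod 2 = n mod 2" using less.IH[of "m div 2"] False
      by (simp_all add: odd_iff_mod_2_eq_one) (metis not_mod2_eq_Suc_0_eq_0)
    then show ?thesis by (metis div_mult_mod_eq)
  qed
qed

definition prefix_free :: "('a \<Rightarrow> bool list) \<Rightarrow> bool" where
  "prefix_free enc \<longleftrightarrow> (\<forall>a b s t. enc a @ s = enc b @ t \<longrightarrow> a = b \<and> s = t)"

lemma prefix_freeD:
  assumes "prefix_free enc" "enc a @ s = enc b @ t"
  shows "a = b" "s = t"
  using assms unfolding prefix_free_def by blast+

lemma prefix_free_nat: "prefix_free encode_nat"
  unfolding prefix_free_def
proof (intro allI impI)
  fix m n and s t :: "bool list"
  assume eq: "encode_nat m @ s = encode_nat n @ t"
  have "bs = cs \<and> s = t"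
    if "concat (map (\<lambda>b. [True, b]) bs) @ False # s = concat (map (\<lambda>b. [True, b]) cs) @ False # t" for bs cs
    using that
  proof (induction bs arbitrary: cs)
    case Nil
    then show ?case by (cases cs) auto
  next
    case (Cons b bs)
    then show ?case by (cases cs) auto
  qed
  from this[of "bits m" "bits n"] eq have "bits m = bits n \<and> s = t" by (simp add: encode_nat_def)
  then show "m = n \<and> s = t" using bits_inject by blast
qed

lemma prefix_free_unit: "prefix_free encode_unit"
  by (simp add: prefix_free_def encode_unit_def)

text \<open>Only the start of the remaining string is extracted, because the lower bound looks at
  vertices and edges.\<close>

lemma prefix_free_labels:
  assumes "prefix_free enc" "length vs = length ws"
    "concat (map (\<lambda>v. enc (f v)) vs) @ s = concat (map (\<lambda>v. enc (g v)) ws) @ t"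
  shows "s = t"
  using assms(2,3)
proof (induction vs ws rule: list_induct2)
  case (Cons v vs w ws)
  then show ?case using prefix_freeD(2)[OF assms(1), of "f v" _ "g w"] by simp
qed simp

lemma prefix_free_edges:
  assumes "prefix_free enc" "length es = length fs"
    "concat (map (\<lambda>(u, v). encode_nat u @ encode_nat v @ enc (f {u, v})) es) @ s =
     concat (map (\<lambda>(u, v). encode_nat u @ encode_nat v @ enc (g {u, v})) fs) @ t"
  shows "es = fs \<and> s = t"
  using assms(2,3)
proof (induction es fs rule: list_induct2)
  case (Cons e es e' fs)
  obtain u v where e: "e = (u, v)" by (cases e)
  obtain u' v' where e': "e' = (u', v')" by (cases e')
  let ?A = "concat (map (\<lambda>(u, v). encode_nat u @ encode_nat v @ enc (f {u, v})) es) @ s"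
  let ?B = "concat (map (\<lambda>(u, v). encode_nat u @ encode_nat v @ enc (g {u, v})) fs) @ t"
  have 0: "encode_nat u @ encode_nat v @ enc (f {u, v}) @ ?A = encode_nat u' @ encode_nat v' @ enc (g {u', v'}) @ ?B"
    using Cons.prems by (simp add: e e')
  note 1 = prefix_freeD[OF prefix_free_nat 0]
  note 2 = prefix_freeD[OF prefix_free_nat 1(2)]
  show ?case using Cons.IH prefix_freeD(2)[OF assms(1) 2(2)] 1(1) 2(1) by (simp add: e e')
qed simp

lemma encodes_graph_parse:
  assumes "prefix_free enc" "encodes_graph enc s G" "encodes_graph enc s' G'" "s @ r = s' @ r'"
  shows "verts G = verts G' \<and> edges G = edges G' \<and> r = r'"
proof -
  obtain n es where 1: "verts G = {..<n}" "edges G = (\<lambda>(u, v). {u, v}) ` set es"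
     "s = encode_nat n @ concat (map (\<lambda>v. enc (vlab G v)) [0..<n]) @ encode_nat (length es) @
         concat (map (\<lambda>(u, v). encode_nat u @ encode_nat v @ enc (elab G {u, v})) es)"
    using assms(2) unfolding encodes_graph_def by blast
  obtain n' es' where 2: "verts G' = {..<n'}" "edges G' = (\<lambda>(u, v). {u, v}) ` set es'"
     "s' = encode_nat n' @ concat (map (\<lambda>v. enc (vlab G' v)) [0..<n']) @ encode_nat (length es') @
         concat (map (\<lambda>(u, v). encode_nat u @ encode_nat v @ enc (elab G' {u, v})) es')"
    using assms(3) unfolding encodes_graph_def by blast
  note eq = assms(4)[unfolded 1(3) 2(3) append_assoc]
  have n: "n = n'" by (rule prefix_freeD(1)[OF prefix_free_nat eq])
  note eq2 = prefix_free_labels[OF assms(1) _ prefix_freeD(2)[OF prefix_free_nat eq]]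
  have eq3: "encode_nat (length es) @ concat (map (\<lambda>(u, v). encode_nat u @ encode_nat v @ enc (elab G {u, v})) es) @ r =
      encode_nat (length es') @ concat (map (\<lambda>(u, v). encode_nat u @ encode_nat v @ enc (elab G' {u, v})) es') @ r'"
    by (rule eq2) (simp add: n)
  have "es = es' \<and> r = r'"
    by (rule prefix_free_edges[OF assms(1) prefix_freeD[OF prefix_free_nat eq3]])
  then show ?thesis using n 1 2 by simp
qed

definition graph_code :: "bool list \<Rightarrow> nat \<Rightarrow> (nat \<Rightarrow> nat) \<Rightarrow> bool list" where
  "graph_code lab n p = encode_nat n @ concat (map (\<lambda>i. lab) [0..<n]) @ encode_nat (n - 1) @
     concat (map (\<lambda>i. encode_nat (p (Suc i)) @ encode_nat (Suc i) @ lab) [0..<n - 1])"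

lemma (in parent_function) encodes_parent_graph:
  "encodes_graph enc (graph_code (enc a) n p) (parent_graph a n p)"
  unfolding encodes_graph_def
proof (intro exI conjI)
  let ?es = "map (\<lambda>i. (p (Suc i), Suc i)) [0..<n - 1]"
  show "verts (parent_graph a n p) = {..<n}" by simp
  have "inj_on (\<lambda>i. {p (Suc i), Suc i}) {0..<n - 1}"
    using parent_edge_inj by (auto simp: inj_on_def)
  then show "distinct (map (\<lambda>(u, v). {u, v}) ?es)" by (simp add: distinct_map comp_def)
  have "{1..<n} = Suc ` {0..<n - 1}" using nonempty by simp
  then show "edges (parent_graph a n p) = (\<lambda>(u, v). {u, v}) ` set ?es"
    by (simp only: parent_graph_simps parent_edges_def image_image set_map set_upt prod.case)
  show "graph_code (enc a) n p = encode_nat n @ concat (map (\<lambda>v. enc (vlab (parent_graph a n p) v)) [0..<n]) @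
      encode_nat (length ?es) @
      concat (map (\<lambda>(u, v). encode_nat u @ encode_nat v @ enc (elab (parent_graph a n p) {u, v})) ?es)"
    by (simp add: graph_code_def comp_def)
qed

text \<open>For the converse direction every decoding of the string must be considered; parsing
  shows that all of them have the same vertices, edges and budget.\<close>

lemma (in cover_system) reduction_correct:
  fixes enc :: "'l \<Rightarrow> bool list"
  assumes "prefix_free enc" "c \<in> \<Sigma>"
  defines "w \<equiv> graph_code (enc c) size par1 @ graph_code (enc c) size par2 @ encode_nat (2 * surplus)"
  shows "w \<in> tree_instances enc \<Sigma>" "w \<in> ged_problem enc \<Sigma> C_E \<longleftrightarrow> exact_cover"
proof -
  let ?G1 = "parent_graph c size par1" and ?G2 = "parent_graph c size par2"
  note enc1 = T1.encodes_parent_graph[of enc c] and enc2 = T2.encodes_parent_graph[of enc c]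
  have inst: "ged_instance enc \<Sigma> w ?G1 ?G2 (2 * surplus)"
    unfolding ged_instance_def
  proof (intro conjI exI)
    show "labeled_over \<Sigma> ?G1" "labeled_over \<Sigma> ?G2" using assms(2) by (auto simp: labeled_over_def)
  qed (rule T1.simple_parent_graph T2.simple_parent_graph enc1 enc2 | simp only: w_def)+
  then show "w \<in> tree_instances enc \<Sigma>"
    unfolding tree_instances_def mem_Collect_eq
    using T1.tree_parent_graph[of c] T2.tree_parent_graph[of c] by (intro exI conjI)
  show "w \<in> ged_problem enc \<Sigma> C_E \<longleftrightarrow> exact_cover"
  proof
    assume exact_cover
    then show "w \<in> ged_problem enc \<Sigma> C_E"
      unfolding ged_problem_def mem_Collect_eq using inst exact_cover_imp_ged[of c] by (intro exI conjI)
  next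
    assume "w \<in> ged_problem enc \<Sigma> C_E"
    then obtain G1 G2 k where G: "ged_instance enc \<Sigma> w G1 G2 k" "ged G1 G2 C_E \<le> of_nat k"
      unfolding ged_problem_def by blast
    then obtain s1 s2 where simple: "simple_graph G1" "simple_graph G2"
      and s12: "encodes_graph enc s1 G1" "encodes_graph enc s2 G2" "w = s1 @ s2 @ encode_nat k"
      unfolding ged_instance_def by blast
    have 1: "verts G1 = verts ?G1 \<and> edges G1 = edges ?G1 \<and>
        s2 @ encode_nat k = graph_code (enc c) size par2 @ encode_nat (2 * surplus)"
      by (rule encodes_graph_parse[OF assms(1) s12(1) enc1]) (use s12(3) in \<open>simp add: w_def\<close>)
    then have 2: "verts G2 = verts ?G2 \<and> edges G2 = edges ?G2 \<and> encode_nat k = encode_nat (2 * surplus)"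
      by (intro encodes_graph_parse[OF assms(1) s12(2) enc2]) simp
    then have "k = 2 * surplus" using prefix_freeD(1)[OF prefix_free_nat, of k "[]" "2 * surplus" "[]"] by simp
    then show exact_cover
      using 1 2 G(2) by (intro ged_imp_exact_cover[OF simple(1) _ _ simple(2)]) simp_all
  qed
qed

section \<open>Numeric tiles\<close>

text \<open>Repetitions are allowed so that tile classes of different sizes get the same number of
  indices.\<close>

lemma finite_enumeration:
  assumes "finite A" "A \<noteq> {}" "card A \<le> n"
  shows "\<exists>f. f ` {..<n :: nat} = A"
proof -
  obtain h where h: "bij_betw h {0..<card A} A" using ex_bij_betw_nat_finite[OF assms(1)] by blast
  have pos: "card A > 0" using assms by (simp add: card_gt_0_iff)
  have "(\<lambda>i. if i < card A then i else 0) ` {..<n} = {0..<card A}"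
  proof (intro equalityI subsetI)
    fix i assume "i \<in> {0..<card A}"
    then show "i \<in> (\<lambda>i. if i < card A then i else 0) ` {..<n}"
      using assms(3) by (intro image_eqI[of _ _ i]) simp_all
  qed (use pos in auto)
  then have "(h \<circ> (\<lambda>i. if i < card A then i else 0)) ` {..<n} = A"
    using bij_betw_imp_surj_on[OF h] by (simp only: image_comp[symmetric])
  then show ?thesis by (rule exI[where P = "\<lambda>f. f ` {..<n} = A"])
qed

lemma numeric_tiles:
  assumes "wf_tm M"
  obtains T Q :: nat and tile_of :: "nat \<Rightarrow> nat \<Rightarrow> tile" and code :: "colour \<Rightarrow> nat"
  where "T > 0" "\<And>c. c < 9 \<Longrightarrow> tile_of c ` {..<T} = class_tiles M c" "\<And>b. code b < Q"
    "\<And>c d t u. c < 9 \<Longrightarrow> d < 9 \<Longrightarrow> t \<in> class_tiles M c \<Longrightarrow> u \<in> class_tiles M d \<Longrightarrow>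
       (code (west t) = code (east u) \<longleftrightarrow> west t = east u) \<and>
       (code (north t) = code (south u) \<longleftrightarrow> north t = south u)"
proof -
  define A where "A = (\<Union>c<9. class_tiles M c)"
  have A: "finite A" unfolding A_def by (intro finite_UN_I finite_class_tiles) simp
  define T where "T = Suc (card A)"
  have le: "card (class_tiles M c) \<le> T" if "c < 9" for c
  proof -
    have "card (class_tiles M c) \<le> card A"
      by (rule card_mono[OF A]) (use that in \<open>auto simp: A_def\<close>)
    then show ?thesis by (simp add: T_def)
  qed
  have "\<exists>f. c < 9 \<longrightarrow> f ` {..<T} = class_tiles M c" for c
    using finite_enumeration[OF finite_class_tiles class_tiles_nonempty[OF assms] le] by blast
  then obtain tile_of where tile_of: "\<And>c. c < 9 \<Longrightarrow> tile_of c ` {..<T} = class_tiles M c" by metis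
  define B where "B = west ` A \<union> east ` A \<union> north ` A \<union> south ` A"
  have finB: "finite B" unfolding B_def using A by simp
  then obtain h :: "colour \<Rightarrow> nat" and n where h: "h ` B = {i. i < n}" "inj_on h B"
    using finite_imp_inj_to_nat_seg by metis
  \<comment> \<open>Tiles only have colours in \<open>B\<close>; all others share the default code
    0, for which the bound \<open>Suc n\<close> leaves room.\<close>
  define code where "code b = (if b \<in> B then h b else 0)" for b
  have less: "code b < Suc n" for b using h(1) by (auto simp: code_def image_iff less_Suc_eq)
  have inj: "code b = code b' \<longleftrightarrow> b = b'" if "b \<in> B" "b' \<in> B" for b b'
    using that h(2) by (auto simp: code_def inj_on_def)
  have colours: "west t \<in> B" "east t \<in> B" "north t \<in> B" "south t \<in> B" if "c < 9" "t \<in> class_tiles M c" for c t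
    using that by (auto simp: B_def A_def)
  show thesis
    by (rule that[of T tile_of code "Suc n"]) (use tile_of less inj colours in \<open>simp_all add: T_def\<close>)
qed

section \<open>The reduction\<close>

locale reduction =
  fixes M :: tm and p q :: "nat poly" and B Q :: nat
    and tile_of :: "nat \<Rightarrow> nat \<Rightarrow> tile" and code :: "colour \<Rightarrow> nat"
  assumes wf: "wf_tm M" and B_pos: "B > 0"
    and tile_of: "\<And>c. c < 9 \<Longrightarrow> tile_of c ` {..<B} = class_tiles M c"
    and code_less: "\<And>b. code b < Q"
    and code_eq: "\<And>c d t u. c < 9 \<Longrightarrow> d < 9 \<Longrightarrow> t \<in> class_tiles M c \<Longrightarrow> u \<in> class_tiles M d \<Longrightarrow>
       (code (west t) = code (east u) \<longleftrightarrow> west t = east u) \<and>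
       (code (north t) = code (south u) \<longleftrightarrow> north t = south u)"
begin

definition certificate_length :: "bool list \<Rightarrow> nat" where
  "certificate_length x = poly p (length x)"
text \<open>The argument of \<open>q\<close> bounds the length of \<open>string_pair x y\<close> for
  all admissible \<open>y\<close>, and \<open>q\<close> is monotone, so one time bound serves all
  certificates.\<close>

definition time :: "bool list \<Rightarrow> nat" where
  "time x = poly q (2 * length x + 2 + certificate_length x)"
definition columns :: "bool list \<Rightarrow> nat" where
  "columns x = 2 * time x + (2 * length x + 2 + certificate_length x) + 2"
definition cells :: "bool list \<Rightarrow> nat" where
  "cells x = (time x + 1) * columns x"
definition class_of :: "bool list \<Rightarrow> nat \<Rightarrow> nat" where
  "class_of x g = tableau.cell_class x (certificate_length x) (g div columns x) (g mod columns x)"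
text \<open>Cells are numbered row by row: the left neighbour is taken cyclically within the row,
  and the upper one a full row earlier, from row 0 to the last row.\<close>

definition left_cell :: "bool list \<Rightarrow> nat \<Rightarrow> nat" where
  "left_cell x g = g div columns x * columns x + (g mod columns x + columns x - 1) mod columns x"
definition up_cell :: "bool list \<Rightarrow> nat \<Rightarrow> nat" where
  "up_cell x g = (if g < columns x then g + time x * columns x else g - columns x)"
definition side :: "(tile \<Rightarrow> colour) \<Rightarrow> bool list \<Rightarrow> nat \<Rightarrow> nat \<Rightarrow> nat" where
  "side f x g t = code (f (tile_of (class_of x g) t))"

lemma tableau: "tableau M"
  by unfold_locales (rule wf)

lemma columns_pos: "columns x > 0"
  by (simp add: columns_def)

lemma width_eq: "tableau.width x (certificate_length x) (time x) = columns x"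
proof -
  interpret TB: tableau M x "certificate_length x" "time x" by (rule tableau)
  show ?thesis by (simp add: columns_def TB.width_def TB.input_bound_def)
qed

lemma cell_class_less: "tableau.cell_class x P r c < 9"
proof -
  interpret TB: tableau M x P 0 by (rule tableau)
  have "TB.kind c < 4" for c by (simp add: TB.kind_def)
  from this[of c] show ?thesis unfolding TB.cell_class_def by (cases "r = 0"; cases "c = 0") simp_all
qed

lemma class_of_less: "class_of x g < 9"
  by (simp add: class_of_def cell_class_less)

lemma cell_coordinates:
  assumes "c < columns x"
  shows "(r * columns x + c) div columns x = r" "(r * columns x + c) mod columns x = c"
    "r \<le> time x \<Longrightarrow> r * columns x + c < cells x"
proof -
  show "r * columns x + c < cells x" if "r \<le> time x"
  proof -
    have "r * columns x + c < (r + 1) * columns x" using assms by simp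
    also have "\<dots> \<le> cells x" unfolding cells_def using that by (intro mult_le_mono1) simp
    finally show ?thesis .
  qed
qed (use assms in simp_all)

lemma cell_row: "g < cells x \<Longrightarrow> g div columns x \<le> time x"
  using less_mult_imp_div_less[of g "time x + 1" "columns x"] by (simp add: cells_def)

lemma left_cell_bij: "bij_betw (left_cell x) {..<cells x} {..<cells x}"
proof -
  interpret tableau M x "certificate_length x" "time x" by (rule tableau)
  define right where "right g = g div columns x * columns x + right_of (g mod columns x)" for g
  have l: "left_cell x g = g div columns x * columns x + left_of (g mod columns x)" for g
    by (simp add: left_cell_def left_of_def width_eq)
  have m: "g mod columns x < width" for g using columns_pos by (simp add: width_eq)
  note lr = left_right[OF m, unfolded width_eq]
  show ?thesis
  proof (rule bij_betw_byWitness[of _ right])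
    show "\<forall>g\<in>{..<cells x}. right (left_cell x g) = g"
      by (simp add: l right_def cell_coordinates lr)
    show "\<forall>g\<in>{..<cells x}. left_cell x (right g) = g"
      by (simp add: l right_def cell_coordinates lr)
    show "left_cell x ` {..<cells x} \<subseteq> {..<cells x}" "right ` {..<cells x} \<subseteq> {..<cells x}"
      using cell_row by (auto simp: l right_def intro!: cell_coordinates(3) lr)
  qed
qed

lemma up_cell_bij: "bij_betw (up_cell x) {..<cells x} {..<cells x}"
proof -
  define down where "down g = (if g < time x * columns x then g + columns x else g - time x * columns x)" for g
  have N: "cells x = time x * columns x + columns x" by (simp add: cells_def)
  show ?thesis
    by (rule bij_betw_byWitness[of _ down]) (auto simp: up_cell_def down_def N)
qed

lemma tiling: "tiling (cells x) B Q (left_cell x) (up_cell x) (side east x) (side south x)"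
  by unfold_locales (simp_all add: B_pos left_cell_bij up_cell_bij side_def code_less)

abbreviation solvable_at :: "bool list \<Rightarrow> bool" where
  "solvable_at x \<equiv> tiling.solvable (cells x) B (left_cell x) (up_cell x) (side east x) (side south x)
     (side west x) (side north x)"

lemma solvable_iff_tiling:
  "solvable_at x \<longleftrightarrow> (\<exists>\<tau>. tableau.is_tiling M x (certificate_length x) (time x) \<tau>)"
proof -
  interpret TB: tableau M x "certificate_length x" "time x" by (rule tableau)
  interpret TL: tiling "cells x" B Q "left_cell x" "up_cell x" "side east x" "side south x" "side west x" "side north x"
    by (rule tiling)
  let ?W = "columns x"
  let ?cc = TB.cell_class
  have left_c: "left_cell x (r * ?W + c) = r * ?W + TB.left_of c" if "c < ?W" for r c
    using cell_coordinates[OF that] by (simp add: left_cell_def TB.left_of_def width_eq)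
  have up_c: "up_cell x (r * ?W + c) = (if r = 0 then time x else r - 1) * ?W + c" if "c < ?W" for r c
  proof (cases r)
    case 0
    then show ?thesis using that by (simp add: up_cell_def)
  qed (simp add: up_cell_def)
  have class_c: "class_of x (r * ?W + c) = ?cc r c" if "c < ?W" for r c
    using cell_coordinates[OF that] by (simp add: class_of_def)
  have left_less: "TB.left_of c < ?W" if "c < ?W" for c
    using TB.left_right(3)[of c] that by (simp add: width_eq)
  have mem: "tile_of (?cc r c) t \<in> class_tiles M (?cc r c)" if "t < B" for r c t
    using tile_of[OF cell_class_less] that by blast
  show ?thesis
  proof
    assume "solvable_at x"
    then obtain \<tau> where t: "\<And>g. g < cells x \<Longrightarrow> \<tau> g < B"
      and w: "\<And>g. g < cells x \<Longrightarrow> side west x g (\<tau> g) = side east x (left_cell x g) (\<tau> (left_cell x g))"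
      and n: "\<And>g. g < cells x \<Longrightarrow> side north x g (\<tau> g) = side south x (up_cell x g) (\<tau> (up_cell x g))"
      unfolding TL.solvable_def by blast
    define \<sigma> where "\<sigma> r c = tile_of (?cc r c) (\<tau> (r * ?W + c))" for r c
    have "TB.is_tiling \<sigma>"
      unfolding TB.is_tiling_def width_eq
    proof (intro allI impI conjI)
      fix r c assume r: "r \<le> time x" and c: "c < ?W"
      let ?r = "if r = 0 then time x else r - 1"
      have r': "?r \<le> time x" using r by (cases r) simp_all
      note g = cell_coordinates(3)[OF c r] and gl = cell_coordinates(3)[OF left_less[OF c] r]
        and gu = cell_coordinates(3)[OF c r']
      show "\<sigma> r c \<in> class_tiles M (?cc r c)" unfolding \<sigma>_def by (rule mem[OF t[OF g]])
      show "west (\<sigma> r c) = east (\<sigma> r (TB.left_of c))"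
        using w[OF g] code_eq[OF cell_class_less cell_class_less mem[OF t[OF g]] mem[OF t[OF gl]]]
        by (simp add: \<sigma>_def side_def left_c[OF c] class_c[OF c] class_c[OF left_less[OF c]])
      show "north (\<sigma> r c) = south (\<sigma> ?r c)"
        using n[OF g] code_eq[OF cell_class_less cell_class_less mem[OF t[OF g]] mem[OF t[OF gu]]]
        unfolding \<sigma>_def side_def up_c[OF c] class_c[OF c] by blast
    qed
    then show "\<exists>\<tau>. TB.is_tiling \<tau>" by blast
  next
    assume "\<exists>\<tau>. TB.is_tiling \<tau>"
    then obtain \<sigma> where \<sigma>: "\<And>r c. r \<le> time x \<Longrightarrow> c < ?W \<Longrightarrow> \<sigma> r c \<in> class_tiles M (?cc r c)"
      "\<And>r c. r \<le> time x \<Longrightarrow> c < ?W \<Longrightarrow> west (\<sigma> r c) = east (\<sigma> r (TB.left_of c))"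
      "\<And>r c. r \<le> time x \<Longrightarrow> c < ?W \<Longrightarrow> north (\<sigma> r c) = south (\<sigma> (if r = 0 then time x else r - 1) c)"
      unfolding TB.is_tiling_def width_eq by metis
    define i where "i r c = (SOME t. t < B \<and> tile_of (?cc r c) t = \<sigma> r c)" for r c
    have i: "i r c < B \<and> tile_of (?cc r c) (i r c) = \<sigma> r c" if "r \<le> time x" "c < ?W" for r c
    proof -
      have "\<sigma> r c \<in> tile_of (?cc r c) ` {..<B}"
        unfolding tile_of[OF cell_class_less] by (rule \<sigma>(1)[OF that])
      then have "\<exists>t. t < B \<and> tile_of (?cc r c) t = \<sigma> r c" by (elim imageE) (metis lessThan_iff)
      then show ?thesis unfolding i_def by (rule someI_ex)
    qed
    define \<tau> where "\<tau> g = i (g div ?W) (g mod ?W)" for g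
    have side_c: "side f x (r * ?W + c) (\<tau> (r * ?W + c)) = code (f (\<sigma> r c))" if "r \<le> time x" "c < ?W" for f r c
      using i[OF that] cell_coordinates[OF that(2)] by (simp add: side_def \<tau>_def class_c[OF that(2)])
    have "\<tau> g < B \<and> side west x g (\<tau> g) = side east x (left_cell x g) (\<tau> (left_cell x g)) \<and>
        side north x g (\<tau> g) = side south x (up_cell x g) (\<tau> (up_cell x g))" if g: "g < cells x" for g
    proof -
      define r c where "r = g div ?W" and "c = g mod ?W"
      have rc: "r \<le> time x" "c < ?W" "g = r * ?W + c"
        using cell_row[OF g] columns_pos by (simp_all add: r_def c_def)
      have r': "(if r = 0 then time x else r - 1) \<le> time x" using rc(1) by (cases r) simp_all
      have "\<tau> g < B" using i[OF rc(1,2)] by (simp add: \<tau>_def r_def c_def)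
      then show ?thesis
        unfolding rc(3) left_c[OF rc(2)] up_c[OF rc(2)] side_c[OF rc(1,2)]
          side_c[OF rc(1) left_less[OF rc(2)]] side_c[OF r' rc(2)]
        using \<sigma>(2,3)[OF rc(1,2)] by simp
    qed
    then show "solvable_at x" unfolding TL.solvable_def by blast
  qed
qed

section \<open>Size parameters as functions of the input\<close>

definition weight :: nat where "weight = 2 * (1 + 4 * Q)"
definition options :: "bool list \<Rightarrow> nat" where "options x = cells x * B"
definition element :: "bool list \<Rightarrow> nat \<Rightarrow> nat" where
  "element x = tiling.elem (cells x) B Q (left_cell x) (up_cell x) (side east x) (side south x)
     (side west x) (side north x)"
definition leaf_room :: "bool list \<Rightarrow> nat" where "leaf_room x = weight + 2 + 2 * (weight * cells x)"
definition first_leaves :: "bool list \<Rightarrow> nat \<Rightarrow> nat" where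
  "first_leaves x h = (if h < (options x - cells x) * weight then weight + 2
     else weight + 2 + 2 * (h - (options x - cells x) * weight))"
definition second_leaves :: "bool list \<Rightarrow> nat \<Rightarrow> nat" where
  "second_leaves x h = weight + 2 + 2 * element x h"
definition vertices :: "bool list \<Rightarrow> nat" where
  "vertices x = 1 + options x + options x * weight + options x * weight * leaf_room x + (weight + leaf_room x + 2)"
definition first_parent :: "bool list \<Rightarrow> nat \<Rightarrow> nat" where
  "first_parent x = layout_parent (options x) weight (leaf_room x) (options x - cells x) (first_leaves x)"
definition second_parent :: "bool list \<Rightarrow> nat \<Rightarrow> nat" where
  "second_parent x = layout_parent (options x) weight (leaf_room x) (options x) (second_leaves x)"
definition budget :: "bool list \<Rightarrow> nat" where
  "budget x = 2 * (weight * cells x + (options x * weight - weight * cells x) * (weight * cells x - 1))"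
definition instance_code :: "bool list \<Rightarrow> bool list \<Rightarrow> bool list" where
  "instance_code lab x = graph_code lab (vertices x) (first_parent x) @
     graph_code lab (vertices x) (second_parent x) @ encode_nat (budget x)"

lemma instance_code_correct:
  fixes enc :: "'l \<Rightarrow> bool list"
  assumes "prefix_free enc" "a \<in> \<Sigma>"
  shows "instance_code (enc a) x \<in> tree_instances enc \<Sigma>"
    "instance_code (enc a) x \<in> ged_problem enc \<Sigma> C_E \<longleftrightarrow> solvable_at x"
proof -
  interpret tiling "cells x" B Q "left_cell x" "up_cell x" "side east x" "side south x" "side west x" "side north x"
    by (rule tiling)
  have w: "weight = 2 * r" by (simp add: weight_def r_def)
  have o: "options x = cells x * B" by (simp add: options_def)
  have H: "leaf_room x = H" by (simp add: leaf_room_def H_def D_def w)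
  have l1: "first_leaves x = leaves1"
    unfolding first_leaves_def leaves1_def D_def w o by (rule refl)
  have l2: "second_leaves x = leaves2"
    unfolding second_leaves_def leaves2_def D_def w element_def by (rule refl)
  have p: "first_parent x = par1" "second_parent x = par2"
    unfolding first_parent_def second_parent_def w o H l1 l2 by (rule refl)+
  have v: "vertices x = size"
    unfolding vertices_def size_def unfolding L_def w o H by (rule refl)
  have b: "budget x = 2 * surplus"
    unfolding budget_def surplus_def w o by (rule refl)
  have out: "instance_code (enc a) x = graph_code (enc a) size par1 @ graph_code (enc a) size par2 @ encode_nat (2 * surplus)"
    unfolding instance_code_def v p b ..
  show "instance_code (enc a) x \<in> tree_instances enc \<Sigma>"
    unfolding out by (rule reduction_correct(1)[OF assms])
  have "instance_code (enc a) x \<in> ged_problem enc \<Sigma> C_E \<longleftrightarrow> exact_cover"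
    unfolding out by (rule reduction_correct(2)[OF assms])
  also have "\<dots> \<longleftrightarrow> solvable"
    using solvable_imp_exact_cover exact_cover_imp_solvable by blast
  finally show "instance_code (enc a) x \<in> ged_problem enc \<Sigma> C_E \<longleftrightarrow> solvable" .
qed

lemma instance_code_decides:
  fixes enc :: "'l \<Rightarrow> bool list"
  assumes "prefix_free enc" "a \<in> \<Sigma>"
    and run: "\<And>z. computes_within M (poly q (length z)) z [z \<in> V]"
  shows "instance_code (enc a) x \<in> ged_problem enc \<Sigma> C_E \<longleftrightarrow>
    (\<exists>y. length y \<le> poly p (length x) \<and> string_pair x y \<in> V)"
proof -
  interpret TB: tableau M x "certificate_length x" "time x" by (rule tableau)
  have acc: "TB.accepts (string_pair x y) \<longleftrightarrow> string_pair x y \<in> V" if "length y \<le> certificate_length x" for y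
  proof -
    let ?u = "string_pair x y"
    have "length ?u \<le> 2 * length x + 2 + certificate_length x" using that by (simp add: TB.pair_nth)
    then have "poly q (length ?u) \<le> time x" unfolding time_def by (rule poly_nat_mono)
    from computes_within_mono[OF run this] have "snd (last (snd (TB.run ?u (time x)))) = string_contents [?u \<in> V]"
      by (auto simp: computes_within_def TB.run_def split: prod.splits)
    then show ?thesis by (simp add: TB.accepts_def string_contents_def)
  qed
  have "instance_code (enc a) x \<in> ged_problem enc \<Sigma> C_E \<longleftrightarrow> (\<exists>\<tau>. TB.is_tiling \<tau>)"
    using instance_code_correct(2)[OF assms(1,2)] solvable_iff_tiling by simp
  also have "\<dots> \<longleftrightarrow> (\<exists>y. length y \<le> certificate_length x \<and> TB.accepts (string_pair x y))"
    using TB.accepts_imp_tiling TB.tiling_imp_accepts by blast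
  also have "\<dots> \<longleftrightarrow> (\<exists>y. length y \<le> poly p (length x) \<and> string_pair x y \<in> V)"
    using acc unfolding certificate_length_def by blast
  finally show ?thesis .
qed

section \<open>Polynomial time of the reduction\<close>

lemma weight_pos: "weight > 0"
  by (simp add: weight_def)

lemma leaf_room_pos: "leaf_room x > 0"
  by (simp add: leaf_room_def)

lemma arith_sizes:
  "arith (\<lambda>x i. certificate_length x)" "arith (\<lambda>x i. time x)" "arith (\<lambda>x i. columns x)"
  "arith (\<lambda>x i. cells x)" "arith (\<lambda>x i. options x)" "arith (\<lambda>x i. leaf_room x)"
  "arith (\<lambda>x i. vertices x)" "arith (\<lambda>x i. budget x)"
  unfolding certificate_length_def time_def columns_def cells_def options_def leaf_room_def
    vertices_def budget_def
  by (intro arith_rules)+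

lemma arith_class_of:
  assumes "arith V"
  shows "arith (\<lambda>x i. class_of x (V x i))"
proof -
  \<comment> \<open>As a tape symbol, a bit of the input is 1 plus its value.\<close>
  have k: "tableau.kind x P c = (if c < 2 * length x then 1 + input_bit x (c div 2)
     else if c = 2 * length x then 1 else if c = 2 * length x + 1 then 2
     else if c < 2 * length x + 2 + P then 3 else 0)" for x P c
    unfolding tableau.kind_def[OF tableau] tableau.input_bound_def[OF tableau]
    by (auto simp: input_bit_def)
  show ?thesis
    unfolding class_of_def tableau.cell_class_def[OF tableau] k
    by (intro arith_rules arith_sizes assms columns_pos) simp
qed

lemma arith_left_cell:
  assumes "arith V"
  shows "arith (\<lambda>x i. left_cell x (V x i))"
  unfolding left_cell_def by (intro arith_rules arith_sizes assms columns_pos)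

lemma arith_up_cell:
  assumes "arith V"
  shows "arith (\<lambda>x i. up_cell x (V x i))"
  unfolding up_cell_def by (intro arith_rules arith_sizes assms columns_pos)

text \<open>Two table lookups, one over the 9 classes and one over the \<open>B\<close> tile
  indices.\<close>

lemma arith_side:
  assumes "arith U" "arith V" "\<And>x i. V x i < B"
  shows "arith (\<lambda>x i. side f x (U x i) (V x i))"
proof -
  have "arith (\<lambda>x i. code (f (tile_of k (V x i))))" for k
    by (rule arith_select[OF assms(2,3), of "\<lambda>t x i. code (f (tile_of k t))"]) (rule arith_const)
  then show ?thesis
    unfolding side_def
    by (rule arith_select[OF arith_class_of[OF assms(1)] class_of_less, of "\<lambda>k x i. code (f (tile_of k (V x i)))"])
qed

lemma arith_element:
  assumes "arith V"
  shows "arith (\<lambda>x i. element x (V x i))"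
proof -
  have base: "arith (\<lambda>x i. tiling.base Q (left_cell x) (up_cell x) (side east x) (side south x)
      (side west x) (side north x) (G x i) (U x i) (J x i))"
    if "arith G" "arith U" "\<And>x i. U x i < B" "arith J" for G U J
    unfolding tiling.base_def[OF tiling] tiling.r_def[OF tiling]
    by (intro arith_rules arith_left_cell arith_up_cell arith_side that)
  show ?thesis
    unfolding element_def tiling.elem_def[OF tiling] Let_def tiling.r_def[OF tiling]
    by (intro arith_rules arith_sizes base assms) (use B_pos in simp_all)
qed

lemma arith_layout_parent:
  assumes "arith K" "arith V" "\<And>U. arith U \<Longrightarrow> arith (\<lambda>x i. cd x (U x i))"
  shows "arith (\<lambda>x i. layout_parent (options x) weight (leaf_room x) (K x i) (cd x) (V x i))"
  unfolding layout_parent_def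
  by (intro arith_rules arith_sizes assms weight_pos leaf_room_pos)

lemma arith_parents:
  assumes "arith V"
  shows "arith (\<lambda>x i. first_parent x (V x i))" "arith (\<lambda>x i. second_parent x (V x i))"
  unfolding first_parent_def second_parent_def first_leaves_def second_leaves_def
  by (intro arith_layout_parent arith_rules arith_sizes arith_element assms | assumption)+

lemma printing_prog_graph_code:
  assumes "arith (\<lambda>x i. n x)" "\<And>V. arith V \<Longrightarrow> arith (\<lambda>x i. par x (V x i))"
  shows "printing_prog (\<lambda>x. graph_code lab (n x) (par x))"
proof -
  have S: "arith (\<lambda>x i. Suc i)"
    using arith_add[OF arith_index arith_const[of 1]] by simp
  have p: "arith (\<lambda>x i. par x (Suc i))" by (rule assms(2)[OF S])
  have n: "arith (\<lambda>x i. n x - 1)" by (intro arith_rules assms)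
  show ?thesis
    unfolding graph_code_def
    by (intro prog_append prog_print[OF printable_nat] prog_loop[OF assms(1)] prog_loop[OF n]
      printable_append printable_bits printable_nat assms(1) n p S)
qed

lemma instance_code_poly_time: "poly_time (instance_code lab)"
  unfolding instance_code_def[abs_def]
  by (intro printing_prog_poly_time prog_append prog_print[OF printable_nat] printing_prog_graph_code
    arith_sizes arith_parents)

end

text \<open>A single label \<open>a\<close> is used throughout, so the labeled and the unlabeled
  setting are instances of the same statement.\<close>

lemma ged_trees_NP_hard:
  fixes enc :: "'l \<Rightarrow> bool list"
  assumes enc: "prefix_free enc" and a: "a \<in> \<Sigma>"
  shows "NP_hard_on (tree_instances enc \<Sigma>) (ged_problem enc \<Sigma> C_E)"
  unfolding NP_hard_on_def
proof
  fix L assume "L \<in> class_NP"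
  then obtain V and p :: "nat poly" where V: "V \<in> class_P"
    and L: "\<And>x. x \<in> L \<longleftrightarrow> (\<exists>y. length y \<le> poly p (length x) \<and> string_pair x y \<in> V)"
    unfolding class_NP_def by blast
  obtain M and q :: "nat poly" where M: "wf_tm M"
    and run: "\<And>z. computes_within M (poly q (length z)) z [z \<in> V]"
    using V unfolding class_P_def poly_time_def by blast
  show "\<exists>f. poly_time f \<and> (\<forall>x. f x \<in> tree_instances enc \<Sigma> \<and> (x \<in> L \<longleftrightarrow> f x \<in> ged_problem enc \<Sigma> C_E))"
  proof (rule numeric_tiles[OF M])
    fix T Q :: nat and tile_of :: "nat \<Rightarrow> nat \<Rightarrow> tile" and code :: "colour \<Rightarrow> nat"
    assume tiles: "T > 0" "\<And>c. c < 9 \<Longrightarrow> tile_of c ` {..<T} = class_tiles M c" "\<And>b. code b < Q"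
      "\<And>c d t u. c < 9 \<Longrightarrow> d < 9 \<Longrightarrow> t \<in> class_tiles M c \<Longrightarrow> u \<in> class_tiles M d \<Longrightarrow>
         (code (west t) = code (east u) \<longleftrightarrow> west t = east u) \<and>
         (code (north t) = code (south u) \<longleftrightarrow> north t = south u)"
    interpret reduction M p q T Q tile_of code by (rule reduction.intro[OF M tiles])
    show ?thesis
      using instance_code_poly_time instance_code_correct(1)[OF enc a] instance_code_decides[OF enc a run] L
      by (intro exI[of _ "instance_code (enc a)"]) simp
  qed
qed

theorem mainTheorem4:
  "(\<forall>\<Sigma> :: nat set. finite \<Sigma> \<and> \<Sigma> \<noteq> {} \<longrightarrow>
      NP_hard_on (tree_instances encode_nat \<Sigma>) (ged_problem encode_nat \<Sigma> C_E)) \<and>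
   NP_hard_on (tree_instances encode_unit UNIV) (ged_problem encode_unit UNIV C_E)"
  using ged_trees_NP_hard[OF prefix_free_nat] ged_trees_NP_hard[OF prefix_free_unit UNIV_I] by blast

end
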